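(* Let $\{X_{k,i}; i \geq 1, k \geq 1\}$ be an array of i.i.d. random variables, write $X_i = X_{1,i}$ for $i \geq 1$, and let $\{p_n; n \geq 1\}$ be a sequence of positive integers such that $n/p_n$ is bounded away from $0$ and $\infty$. Define $$W_n = \max_{1 \leq i < j \leq p_n} \Big| \sum_{k=1}^n X_{k,i} X_{k,j} \Big|, \quad n \geq 1.$$ Then $$\lim_{n \to \infty} \frac{W_n}{\sqrt{n \log n}} = 2 \quad \text{a.s.}$$ if and only if $$EX_1 = 0, \quad EX_1^2 = 1 \quad \text{and} \quad \sum_{n=1}^{\infty} P\Big(\max_{1 \leq i < j \leq n} |X_i X_j| \geq \sqrt{n \log n}\Big) < \infty.$$
   Context: $\log$ denotes the natural logarithm. *)

theory Defs
  imports "HOL-Probability.Probability"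
begin

text \<open>W_n = max over 1 <= i < j <= p_n of |sum_{k=1}^n X_{k,i} X_{k,j}|.
  The 0 inserted only matters when the index set is empty (p_n = 1); all terms are >= 0.\<close>
definition Wmax :: "(nat \<Rightarrow> nat \<Rightarrow> 'a \<Rightarrow> real) \<Rightarrow> (nat \<Rightarrow> nat) \<Rightarrow> nat \<Rightarrow> 'a \<Rightarrow> real" where
  "Wmax X p n \<omega> = Max (insert 0 {\<bar>\<Sum>k=1..n. X k i \<omega> * X k j \<omega>\<bar> | i j. 1 \<le> i \<and> i < j \<and> j \<le> p n})"

text \<open>max over 1 <= i < j <= n of |X_i X_j| where X_i = X_{1,i} (0 for n < 2, where the set is empty).\<close>
definition Mmax :: "(nat \<Rightarrow> nat \<Rightarrow> 'a \<Rightarrow> real) \<Rightarrow> nat \<Rightarrow> 'a \<Rightarrow> real" where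
  "Mmax X n \<omega> = Max (insert 0 {\<bar>X 1 i \<omega> * X 1 j \<omega>\<bar> | i j. 1 \<le> i \<and> i < j \<and> j \<le> n})"

end

theory Submission
  imports Defs "HOL-Real_Asymp.Real_Asymp"
begin

text \<open>
  Sufficiency. The summability condition does not change when the number of columns and the
  threshold are multiplied by constants, since any two of \<open>c * m\<close> columns lie in two of \<open>c\<close> blocks
  of length \<open>m\<close>. Two consequences follow: a third moment is finite, and along a geometric sequence
  of sample sizes \<open>N\<close> almost surely no product \<open>X k i * X k j\<close> in the relevant part of the array
  exceeds \<open>\<eta> * sqrt (N * ln N)\<close>, so the products may be truncated at that level. With
  \<open>\<lambda> = \<theta> * sqrt (ln N / N)\<close> a third-order Taylor expansion shows that the moment generating
  function at \<open>\<lambda>\<close> of a truncated sum of \<open>N\<close> products is \<open>N powr (\<theta>^2 / 2)\<close> up to a constant factor.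
  Chernoff's inequality bounds the probability that one sum exceeds \<open>x * sqrt (N * ln N)\<close> by
  \<open>N powr (- x^2 / 2)\<close>, and exponential tilting gives a lower bound of almost the same order. As there
  are of the order of \<open>N^2\<close> pairs, the critical value is \<open>x = 2\<close>; the lower bound for the maximum
  comes from the second moment method, where two pairs sharing a column are handled by applying
  Chernoff's inequality to the sum of the two truncated sums. The increments between consecutive
  members of the geometric sequence are negligible by Chernoff's inequality with a large \<open>\<theta>\<close>.

  Necessity. The rows are independent and \<open>X n i * X n j\<close> is the difference of two consecutive sums,
  so the second Borel--Cantelli lemma yields the summability condition and with it a third moment.
  A nonzero mean would make a single sum grow linearly, and rescaling the array to unit variance
  shows that the limit is twice the variance.
\<close>

section \<open>Exponential moments and Borel--Cantelli\<close>

text \<open>The truncation level is the delicate choice. The moment generating function of one row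
  is raised to the power \<open>N\<close>, so every one-row error must be o(1/N). Truncating at
  \<tau> of order \<open>sqrt (N * ln N)\<close> shifts the mean by O(1/\<tau>^2) when a third
  moment is finite, and this shift times \<lambda> is small enough. The Taylor remainder is of order
  \<lambda>^3 times \<open>exp (2 * \<lambda> * \<tau>)\<close> for two truncated products, so the
  exponential must stay well below \<open>sqrt N\<close>. This is the origin of the recurring
  condition \<open>\<theta> * \<eta> \<le> 1/8\<close>, which yields the power 1/4. A large \<theta>
  forces a small \<eta>, affordable because summability is insensitive to constants.

  Checking all products up to row \<open>2 * N\<close> costs \<open>2 * N\<close> times a term of
  the series. Along a geometric sequence this is summable, since of the order of \<open>N\<close>
  integers near \<open>N\<close> have comparable terms. The ratio of the sequence is taken so close
  to 1 that an increment has variance a small multiple of \<open>N\<close>; Chernoff with large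
  \<theta> then beats the number of pairs and of sample sizes together.\<close>

lemma exp_taylor3: "\<bar>exp x - (1 + x + x\<^sup>2/2)\<bar> \<le> \<bar>x\<bar>^3 * exp \<bar>x\<bar>" for x :: real
proof -
  obtain t where t: "\<bar>t\<bar> \<le> \<bar>x\<bar>" and e: "exp x = (\<Sum>m<3. x^m / fact m) + exp t / fact 3 * x^3"
    using Maclaurin_exp_le[of x 3] by blast
  have "exp x - (1 + x + x\<^sup>2/2) = exp t / 6 * x^3"
    using e by (simp add: eval_nat_numeral)
  then have "\<bar>exp x - (1 + x + x\<^sup>2/2)\<bar> = exp t / 6 * \<bar>x\<bar>^3"
    by (simp only: abs_mult power_abs) simp
  also have "\<dots> \<le> exp \<bar>x\<bar> * \<bar>x\<bar>^3"
  proof (rule mult_right_mono)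
    have "exp t \<le> exp \<bar>x\<bar>" using t by simp
    then show "exp t / 6 \<le> exp \<bar>x\<bar>" using exp_gt_zero[of t] by linarith
  qed simp
  finally show ?thesis by (simp add: mult.commute)
qed

text \<open>This is \<open>ln (1 + y) \<ge> y - 2 * y^2\<close> exponentiated. It turns a lower
  bound on a moment generating function into an exponential, so that the bound survives the product
  over many rows.\<close>

lemma exp_le_one_plus: "exp (y - 2 * y\<^sup>2) \<le> 1 + y" if "\<bar>y\<bar> \<le> 1/2" for y :: real
proof -
  have "y - 2 * y\<^sup>2 \<le> ln (1 + y)"
    using abs_ln_one_plus_x_minus_x_bound[OF that] by linarith
  then have "exp (y - 2 * y\<^sup>2) \<le> exp (ln (1 + y))" by simp
  then show ?thesis using that by simp
qed

context prob_space
begin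

lemma integrable_bounded:
  fixes f :: "'a \<Rightarrow> real"
  assumes "f \<in> borel_measurable M" and "\<And>\<omega>. \<bar>f \<omega>\<bar> \<le> b"
  shows "integrable M f"
  using assms by (intro integrable_const_bound[where B=b]) auto

lemma integrable_exp_bounded:
  assumes [measurable]: "V \<in> borel_measurable M" and bd: "\<And>\<omega>. \<bar>V \<omega>\<bar> \<le> b"
  shows "integrable M (\<lambda>\<omega>. exp (l * V \<omega> :: real))"
proof (rule integrable_bounded[where b="exp (\<bar>l\<bar> * b)"])
  fix \<omega>
  have "l * V \<omega> \<le> \<bar>l\<bar> * \<bar>V \<omega>\<bar>" by (metis abs_ge_self abs_mult)
  also have "\<dots> \<le> \<bar>l\<bar> * b" using bd by (intro mult_left_mono) auto
  finally show "\<bar>exp (l * V \<omega>)\<bar> \<le> exp (\<bar>l\<bar> * b)" by simp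
qed simp

lemma integrable_power_bounded:
  assumes [measurable]: "V \<in> borel_measurable M" and bd: "\<And>\<omega>. \<bar>V \<omega>\<bar> \<le> b"
  shows "integrable M (\<lambda>\<omega>. (V \<omega> :: real) ^ n)" "integrable M (\<lambda>\<omega>. \<bar>V \<omega> :: real\<bar> ^ n)"
  using bd by (auto intro!: integrable_bounded[where b="b^n"] power_mono simp: power_abs)

text \<open>The remainder keeps the factor \<open>exp (\<bar>l\<bar> * b)\<close>: with
  \<open>b\<close> a truncation level and \<open>l\<close> of order \<open>sqrt (ln N / N)\<close>
  this is a small power of \<open>N\<close>, which a finite third moment can absorb.\<close>

lemma mgf_taylor3:
  fixes V :: "'a \<Rightarrow> real"
  assumes V[measurable]: "V \<in> borel_measurable M" and bd: "\<And>\<omega>. \<bar>V \<omega>\<bar> \<le> b"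
  shows "\<bar>expectation (\<lambda>\<omega>. exp (l * V \<omega>))
      - (1 + l * expectation V + l\<^sup>2/2 * expectation (\<lambda>\<omega>. (V \<omega>)\<^sup>2))\<bar>
    \<le> \<bar>l\<bar>^3 * exp (\<bar>l\<bar> * b) * expectation (\<lambda>\<omega>. \<bar>V \<omega>\<bar>^3)"
proof -
  note [simp] = integrable_exp_bounded[OF V bd] integrable_power_bounded[OF V bd]
    integrable_bounded[OF V bd]
  have eq: "expectation (\<lambda>\<omega>. exp (l * V \<omega>) - (1 + l * V \<omega> + l\<^sup>2/2 * (V \<omega>)\<^sup>2))
      = expectation (\<lambda>\<omega>. exp (l * V \<omega>))
      - (1 + l * expectation V + l\<^sup>2/2 * expectation (\<lambda>\<omega>. (V \<omega>)\<^sup>2))"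
    by (simp add: prob_space)
  have "\<bar>expectation (\<lambda>\<omega>. exp (l * V \<omega>) - (1 + l * V \<omega> + l\<^sup>2/2 * (V \<omega>)\<^sup>2))\<bar>
    \<le> expectation (\<lambda>\<omega>. \<bar>exp (l * V \<omega>) - (1 + l * V \<omega> + l\<^sup>2/2 * (V \<omega>)\<^sup>2)\<bar>)"
    by (rule integral_abs_bound)
  also have "\<dots> \<le> expectation (\<lambda>\<omega>. \<bar>l\<bar>^3 * exp (\<bar>l\<bar> * b) * \<bar>V \<omega>\<bar>^3)"
  proof (rule integral_mono)
    fix \<omega>
    have "\<bar>exp (l * V \<omega>) - (1 + l * V \<omega> + l\<^sup>2/2 * (V \<omega>)\<^sup>2)\<bar>
        \<le> \<bar>l * V \<omega>\<bar>^3 * exp \<bar>l * V \<omega>\<bar>"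
      using exp_taylor3[of "l * V \<omega>"] by (simp add: power_mult_distrib)
    also have "\<dots> \<le> \<bar>l * V \<omega>\<bar>^3 * exp (\<bar>l\<bar> * b)"
      using bd by (intro mult_left_mono) (auto simp: abs_mult intro!: mult_left_mono)
    finally show "\<bar>exp (l * V \<omega>) - (1 + l * V \<omega> + l\<^sup>2/2 * (V \<omega>)\<^sup>2)\<bar>
       \<le> \<bar>l\<bar>^3 * exp (\<bar>l\<bar> * b) * \<bar>V \<omega>\<bar>^3"
      by (simp add: abs_mult power_mult_distrib mult_ac)
  qed simp_all
  finally show ?thesis unfolding eq by simp
qed

lemma mgf_sum:
  assumes "finite K" and ind: "indep_vars (\<lambda>_. borel) V K"
    and bd: "\<And>k \<omega>. k \<in> K \<Longrightarrow> \<bar>V k \<omega>\<bar> \<le> b"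
  shows "expectation (\<lambda>\<omega>. exp (l * (\<Sum>k\<in>K. V k \<omega>))) = (\<Prod>k\<in>K. expectation (\<lambda>\<omega>. exp (l * V k \<omega> :: real)))"
proof -
  have V: "V k \<in> borel_measurable M" if "k \<in> K" for k
    using ind that by (auto simp: indep_vars_def)
  have "expectation (\<lambda>\<omega>. exp (l * (\<Sum>k\<in>K. V k \<omega>))) = expectation (\<lambda>\<omega>. \<Prod>k\<in>K. exp (l * V k \<omega>))"
    using \<open>finite K\<close> by (simp add: exp_sum sum_distrib_left)
  also have "\<dots> = (\<Prod>k\<in>K. expectation (\<lambda>\<omega>. exp (l * V k \<omega>)))"
  proof (rule indep_vars_lebesgue_integral)
    show "indep_vars (\<lambda>_. borel) (\<lambda>k \<omega>. exp (l * V k \<omega>)) K"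
      by (rule indep_vars_compose2[OF ind]) simp
    show "integrable M (\<lambda>\<omega>. exp (l * V k \<omega>))" if "k \<in> K" for k
      using integrable_exp_bounded[OF V[OF that] bd[OF that]] .
  qed fact
  finally show ?thesis .
qed

lemma chernoff:
  assumes "integrable M (\<lambda>\<omega>. exp (l * S \<omega>))" and [measurable]: "S \<in> borel_measurable M" and "0 \<le> l"
  shows "prob {\<omega>\<in>space M. x \<le> S \<omega>} \<le> exp (- l * x) * expectation (\<lambda>\<omega>. exp (l * S \<omega> :: real))"
proof -
  have "prob {\<omega>\<in>space M. x \<le> S \<omega>} \<le> prob {\<omega>\<in>space M. exp (l * x) \<le> exp (l * S \<omega>)}"
    using \<open>0 \<le> l\<close> by (intro finite_measure_mono) (auto intro: mult_left_mono)
  also have "\<dots> \<le> expectation (\<lambda>\<omega>. exp (l * S \<omega> :: real)) / exp (l * x)"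
    using assms(1) by (intro integral_Markov_inequality_measure[where A="{}"]) auto
  finally show ?thesis by (simp add: exp_minus field_simps)
qed

text \<open>Exponential tilting: under the tilted measure with density proportional to exp (\<theta> T) almost
  all mass sits where \<open>T\<close> is close to \<open>\<theta> u\<close>, because the mass outside the window is
  controlled by the exponential moments at \<open>\<theta> \<plusminus> \<epsilon>\<close>.\<close>

lemma tilting_lower_bound:
  fixes T :: "'a \<Rightarrow> real"
  assumes T[measurable]: "T \<in> borel_measurable M" and bd: "\<And>\<omega>. \<bar>T \<omega>\<bar> \<le> b"
    and lo: "exp (\<theta>\<^sup>2/2 * u - 1) \<le> expectation (\<lambda>\<omega>. exp (\<theta> * T \<omega>))"
    and hi1: "expectation (\<lambda>\<omega>. exp ((\<theta> + \<epsilon>) * T \<omega>)) \<le> exp ((\<theta> + \<epsilon>)\<^sup>2/2 * u + 1)"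
    and hi2: "expectation (\<lambda>\<omega>. exp ((\<theta> - \<epsilon>) * T \<omega>)) \<le> exp ((\<theta> - \<epsilon>)\<^sup>2/2 * u + 1)"
    and "0 \<le> \<epsilon>" "0 \<le> \<theta>" and small: "4 * exp (2 - \<epsilon>\<^sup>2/2 * u) \<le> 1"
  shows "exp (- 1) / 2 * exp (- (\<theta>\<^sup>2/2 + \<theta> * \<epsilon>) * u) \<le> prob {\<omega>\<in>space M. (\<theta> - \<epsilon>) * u \<le> T \<omega>}"
proof -
  define A where "A = {\<omega>\<in>space M. (\<theta> - \<epsilon>) * u \<le> T \<omega>}"
  have [measurable]: "A \<in> sets M" unfolding A_def by measurable
  note int = integrable_exp_bounded[OF T bd]
  \<comment> \<open>Above the window the factor
    \<open>exp (\<epsilon> * (T - (\<theta> + \<epsilon>) * u))\<close> is at least 1, which trades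
    the moment at \<theta> for the one at \<open>\<theta> + \<epsilon>\<close>; below the window the
    same is done with \<open>\<theta> - \<epsilon>\<close>.\<close>
  have pw: "exp (\<theta> * T \<omega>) \<le> exp (\<theta> * (\<theta> + \<epsilon>) * u) * indicator A \<omega>
      + exp (- \<epsilon> * (\<theta> + \<epsilon>) * u) * exp ((\<theta> + \<epsilon>) * T \<omega>)
      + exp (\<epsilon> * (\<theta> - \<epsilon>) * u) * exp ((\<theta> - \<epsilon>) * T \<omega>)" (is "_ \<le> ?a + ?b + ?c") if "\<omega> \<in> space M" for \<omega>
  proof -
    have nn: "0 \<le> ?a" "0 \<le> ?b" "0 \<le> ?c" by auto
    consider "T \<omega> > (\<theta> + \<epsilon>) * u" | "T \<omega> < (\<theta> - \<epsilon>) * u" | "(\<theta> - \<epsilon>) * u \<le> T \<omega>" "T \<omega> \<le> (\<theta> + \<epsilon>) * u"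
      by linarith
    then show ?thesis
    proof cases
      case 1
      have "\<epsilon> * ((\<theta> + \<epsilon>) * u) \<le> \<epsilon> * T \<omega>" using 1 \<open>0 \<le> \<epsilon>\<close> by (intro mult_left_mono) auto
      then have "exp (\<theta> * T \<omega>) \<le> ?b" unfolding exp_add[symmetric] by (simp add: algebra_simps)
      then show ?thesis using nn by linarith
    next
      case 2
      have "\<epsilon> * T \<omega> \<le> \<epsilon> * ((\<theta> - \<epsilon>) * u)" using 2 \<open>0 \<le> \<epsilon>\<close> by (intro mult_left_mono) auto
      then have "exp (\<theta> * T \<omega>) \<le> ?c" unfolding exp_add[symmetric] by (simp add: algebra_simps)
      then show ?thesis using nn by linarith
    next
      case 3
      have "\<theta> * T \<omega> \<le> \<theta> * ((\<theta> + \<epsilon>) * u)" using 3 \<open>0 \<le> \<theta>\<close> by (intro mult_left_mono) auto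
      moreover have "\<omega> \<in> A" using 3 that by (simp add: A_def)
      ultimately have "exp (\<theta> * T \<omega>) \<le> ?a" by (simp add: algebra_simps)
      then show ?thesis using nn by linarith
    qed
  qed
  have "exp (\<theta>\<^sup>2/2 * u - 1) \<le> expectation (\<lambda>\<omega>. exp (\<theta> * T \<omega>))" by (rule lo)
  also have "\<dots> \<le> expectation (\<lambda>\<omega>. exp (\<theta> * (\<theta> + \<epsilon>) * u) * indicator A \<omega>
      + exp (- \<epsilon> * (\<theta> + \<epsilon>) * u) * exp ((\<theta> + \<epsilon>) * T \<omega>)
      + exp (\<epsilon> * (\<theta> - \<epsilon>) * u) * exp ((\<theta> - \<epsilon>) * T \<omega>))"
    using pw int by (intro integral_mono) (auto intro!: integrable_mult_right simp: less_top[symmetric])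
  also have "\<dots> = exp (\<theta> * (\<theta> + \<epsilon>) * u) * prob A
      + exp (- \<epsilon> * (\<theta> + \<epsilon>) * u) * expectation (\<lambda>\<omega>. exp ((\<theta> + \<epsilon>) * T \<omega>))
      + exp (\<epsilon> * (\<theta> - \<epsilon>) * u) * expectation (\<lambda>\<omega>. exp ((\<theta> - \<epsilon>) * T \<omega>))"
    using int by (simp add: less_top[symmetric])
  also have "\<dots> \<le> exp (\<theta> * (\<theta> + \<epsilon>) * u) * prob A
      + exp (- \<epsilon> * (\<theta> + \<epsilon>) * u) * exp ((\<theta> + \<epsilon>)\<^sup>2/2 * u + 1)
      + exp (\<epsilon> * (\<theta> - \<epsilon>) * u) * exp ((\<theta> - \<epsilon>)\<^sup>2/2 * u + 1)"
    using hi1 hi2 by (intro add_mono mult_left_mono) auto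
  \<comment> \<open>Completing the square leaves a gain of \<open>\<epsilon>^2/2 * u\<close> against
    the moment at \<theta>; the 2 in the exponent pays for the errors -1 and +1 in the
    hypotheses.\<close>
  also have "exp (- \<epsilon> * (\<theta> + \<epsilon>) * u) * exp ((\<theta> + \<epsilon>)\<^sup>2/2 * u + 1) = exp (\<theta>\<^sup>2/2*u - 1) * exp (2 - \<epsilon>\<^sup>2/2 * u)"
    unfolding exp_add[symmetric] by (simp add: field_simps power2_eq_square)
  also have "exp (\<epsilon> * (\<theta> - \<epsilon>) * u) * exp ((\<theta> - \<epsilon>)\<^sup>2/2 * u + 1) = exp (\<theta>\<^sup>2/2*u - 1) * exp (2 - \<epsilon>\<^sup>2/2 * u)"
    unfolding exp_add[symmetric] by (simp add: field_simps power2_eq_square)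
  also have "exp (\<theta>\<^sup>2/2*u - 1) * exp (2 - \<epsilon>\<^sup>2/2 * u) \<le> exp (\<theta>\<^sup>2/2*u - 1) * (1/4)"
    using small by (intro mult_left_mono) auto
  \<comment> \<open>Each tail takes at most a quarter of \<open>exp (\<theta>^2/2*u - 1)\<close>, so
    half of it remains for the window.\<close>
  finally have *: "exp (\<theta>\<^sup>2/2*u - 1) / 2 \<le> exp (\<theta> * (\<theta> + \<epsilon>) * u) * prob A"
    using small by (simp add: field_simps)
  have "exp (- 1) / 2 * exp (- (\<theta>\<^sup>2/2 + \<theta> * \<epsilon>) * u) = exp (- \<theta> * (\<theta> + \<epsilon>) * u) * (exp (\<theta>\<^sup>2/2*u - 1) / 2)"
    by (simp add: exp_add[symmetric] field_simps power2_eq_square)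
  also have "\<dots> \<le> exp (- \<theta> * (\<theta> + \<epsilon>) * u) * (exp (\<theta> * (\<theta> + \<epsilon>) * u) * prob A)"
    using * by (intro mult_left_mono) auto
  also have "\<dots> = prob A" by (simp add: exp_add[symmetric] mult.assoc[symmetric])
  finally show ?thesis unfolding A_def .
qed

text \<open>Chebyshev's inequality for the number \<open>Y\<close> of events that occur: where none
  occurs, \<open>(Y - m)^2 = m^2\<close>. The product form avoids a division by the expected number,
  which is bounded below only later.\<close>

lemma second_moment_method:
  assumes "finite T" and A[measurable]: "\<And>t. t \<in> T \<Longrightarrow> A t \<in> events"
  shows "prob (space M - (\<Union>t\<in>T. A t)) * (\<Sum>t\<in>T. prob (A t))\<^sup>2
     \<le> (\<Sum>t\<in>T. \<Sum>t'\<in>T. prob (A t \<inter> A t') - prob (A t) * prob (A t'))"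
proof -
  define m where "m = (\<Sum>t\<in>T. prob (A t))"
  define Y where "Y \<omega> = (\<Sum>t\<in>T. indicator (A t) \<omega> :: real)" for \<omega>
  define B where "B = space M - (\<Union>t\<in>T. A t)"
  have [measurable]: "B \<in> events" using \<open>finite T\<close> unfolding B_def by (intro sets.Diff sets.top sets.finite_UN) auto
  have sq: "(Y \<omega> - m)\<^sup>2 = (\<Sum>t\<in>T. \<Sum>t'\<in>T. indicator (A t \<inter> A t') \<omega>) - 2 * m * (\<Sum>t\<in>T. indicator (A t) \<omega>) + m\<^sup>2" for \<omega>
    by (simp add: Y_def power2_eq_square algebra_simps sum_product indicator_inter_arith)
  have iT: "integrable M (\<lambda>\<omega>. indicator (A t) \<omega> :: real)" "integrable M (\<lambda>\<omega>. indicator (A t \<inter> A t') \<omega> :: real)"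
    if "t \<in> T" "t' \<in> T" for t t'
    using that A by (auto simp: less_top[symmetric])
  have int: "integrable M (\<lambda>\<omega>. (Y \<omega> - m)\<^sup>2)"
    unfolding sq using iT by (intro Bochner_Integration.integrable_add Bochner_Integration.integrable_diff Bochner_Integration.integrable_sum integrable_mult_right) auto
  have "prob B * m\<^sup>2 = expectation (\<lambda>\<omega>. m\<^sup>2 * indicator B \<omega>)" by simp
  also have "\<dots> \<le> expectation (\<lambda>\<omega>. (Y \<omega> - m)\<^sup>2)"
  proof (rule integral_mono[OF _ int])
    show "integrable M (\<lambda>\<omega>. m\<^sup>2 * indicator B \<omega>)" by (auto simp: less_top[symmetric])
    show "m\<^sup>2 * indicator B \<omega> \<le> (Y \<omega> - m)\<^sup>2" for \<omega>
    proof (cases "\<omega> \<in> B")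
      case True
      then have "Y \<omega> = 0" unfolding Y_def B_def by (intro sum.neutral) (auto simp: indicator_def)
      with True show ?thesis by simp
    qed simp
  qed
  also have "\<dots> = (\<Sum>t\<in>T. \<Sum>t'\<in>T. prob (A t \<inter> A t')) - 2 * m * (\<Sum>t\<in>T. prob (A t)) + m\<^sup>2"
    unfolding sq using iT A by (simp add: prob_space Bochner_Integration.integral_sum Bochner_Integration.integrable_sum)
  also have "\<dots> = (\<Sum>t\<in>T. \<Sum>t'\<in>T. prob (A t \<inter> A t')) - m\<^sup>2"
    by (simp add: m_def power2_eq_square)
  also have "\<dots> = (\<Sum>t\<in>T. \<Sum>t'\<in>T. prob (A t \<inter> A t') - prob (A t) * prob (A t'))"
    by (simp add: m_def power2_eq_square sum_product sum_subtractf)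
  finally show ?thesis unfolding B_def m_def .
qed

text \<open>If almost surely only finitely many events occur, some tail intersection
  \<open>D m\<close> of complements has positive probability. By independence and
  \<open>1 - x \<le> exp (- x)\<close> every partial sum beyond \<open>m\<close> is then at most
  \<open>- ln (prob (D m))\<close>. Independence is asked of the complements, since the product
  formula is applied to them.\<close>

lemma borel_cantelli_2:
  assumes ind: "indep_events (\<lambda>n. space M - A n) {1 :: nat..}" and A[measurable]: "\<And>n. A n \<in> events"
    and ae: "AE \<omega> in M. eventually (\<lambda>n. \<omega> \<notin> A n) sequentially"
  shows "summable (\<lambda>n. prob (A n))"
proof -
  \<comment> \<open>Starting at \<open>Suc m\<close> keeps out index 0, which the independence
    hypothesis does not cover.\<close>
  define D where "D m = (\<Inter>n\<in>{Suc m..}. space M - A n)" for m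
  have D: "D m \<in> events" for m unfolding D_def by (intro sets.countable_INT') auto
  have "AE \<omega> in M. \<exists>m. \<omega> \<in> D m"
    using ae AE_space by eventually_elim (auto simp: D_def eventually_sequentially intro: Suc_leD)
  have "\<exists>m. prob (D m) > 0"
  proof (rule ccontr)
    assume "\<not> ?thesis"
    then have "prob (D m) = 0" for m by (meson linorder_not_less measure_nonneg order_antisym)
    then have "AE \<omega> in M. \<omega> \<notin> D m" for m
      using D by (subst (asm) prob_eq_0) auto
    then have "AE \<omega> in M. \<forall>m. \<omega> \<notin> D m" by (subst AE_all_countable) auto
    with \<open>AE \<omega> in M. \<exists>m. \<omega> \<in> D m\<close> have "AE \<omega> in M. False" by eventually_elim auto
    then show False by simp
  qed
  then obtain m where m: "prob (D m) > 0" by auto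
  have bound: "(\<Sum>n\<in>{Suc m..<Suc m+k}. prob (A n)) \<le> - ln (prob (D m))" for k
  proof (cases "k = 0")
    case True then show ?thesis using m by (simp add: ln_le_zero_iff)
  next
    case False
    have "prob (D m) \<le> prob (\<Inter>n\<in>{Suc m..<Suc m+k}. space M - A n)"
      using False by (intro finite_measure_mono sets.finite_INT) (auto simp: D_def)
    also have "\<dots> = (\<Prod>n\<in>{Suc m..<Suc m+k}. prob (space M - A n))"
    proof -
      have "{Suc m..<Suc m + k} \<subseteq> {1..}" "{Suc m..<Suc m + k} \<noteq> {}" "finite {Suc m..<Suc m + k}" using False by auto
      then show ?thesis using ind unfolding indep_events_def by blast
    qed
    also have "\<dots> = (\<Prod>n\<in>{Suc m..<Suc m+k}. 1 - prob (A n))"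
      by (intro prod.cong refl prob_compl) auto
    also have "\<dots> \<le> (\<Prod>n\<in>{Suc m..<Suc m+k}. exp (- prob (A n)))"
      using exp_ge_add_one_self[of "- prob (A n)" for n] by (intro prod_mono) auto
    also have "\<dots> = exp (- (\<Sum>n\<in>{Suc m..<Suc m+k}. prob (A n)))"
      by (simp only: sum_negf[symmetric] exp_sum[OF finite_atLeastLessThan])
    finally have "ln (prob (D m)) \<le> - (\<Sum>n\<in>{Suc m..<Suc m+k}. prob (A n))"
      using m by (metis ln_exp ln_le_cancel_iff exp_gt_zero)
    then show ?thesis by simp
  qed
  have "summable (\<lambda>n. prob (A (n + Suc m)))"
  proof (rule bounded_imp_summable)
    show "(\<Sum>k\<le>n. prob (A (k + Suc m))) \<le> - ln (prob (D m))" for n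
    proof -
      have "(\<Sum>k\<le>n. prob (A (k + Suc m))) = (\<Sum>n\<in>{Suc m..<Suc m+Suc n}. prob (A n))"
        using sum.shift_bounds_nat_ivl[of "\<lambda>n. prob (A n)" 0 "Suc m" "Suc n"]
        by (simp add: atLeast0LessThan lessThan_Suc_atMost add.commute)
      then show ?thesis using bound[of "Suc n"] by simp
    qed
  qed simp
  then show ?thesis using summable_iff_shift[of "\<lambda>n. prob (A n)" "Suc m"] by blast
qed

end

section \<open>The normalisation and the one-row moment generating function\<close>

definition scl :: "nat \<Rightarrow> real" where
  "scl n = sqrt (real n * ln (real n))"

lemma scl_nonneg [simp]: "0 \<le> scl n"
  by (cases "n = 0") (auto simp: scl_def)

lemma scl_pos: "2 \<le> n \<Longrightarrow> 0 < scl n"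
  by (simp add: scl_def)

lemma scl_mono: "m \<le> n \<Longrightarrow> scl m \<le> scl n"
proof (cases "m = 0")
  case False
  assume "m \<le> n"
  then have "real m * ln (real m) \<le> real n * ln (real n)"
    using False by (intro mult_mono) auto
  then show ?thesis by (simp add: scl_def)
qed (use scl_nonneg[of n] in \<open>simp add: scl_def\<close>)

text \<open>With Chernoff parameter \<open>\<theta> * sqrt (ln N / N)\<close> and threshold
  \<open>x * scl N\<close> the exponent becomes \<open>\<theta> * x * ln N\<close>, so all tail
  bounds are powers of \<open>N\<close>.\<close>

lemma sqrt_mult_scl: "sqrt (ln (real n) / real n) * scl n = ln (real n)" if "2 \<le> n"
  using that by (simp add: scl_def real_sqrt_mult real_sqrt_divide)

lemma filterlim_scl: "filterlim scl at_top sequentially"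
  unfolding scl_def by real_asymp

text \<open>The first four limits are \<open>N\<close> times the one-row errors: truncation bias of
  the mean, truncation error of the second moment, Taylor remainder with its exponential factor
  bounded by \<open>N powr (1/4)\<close>, and the square of the main term. The leading
  \<open>N\<close> accounts for a product over \<open>N\<close> rows.\<close>

lemma rate_limits:
  "(\<lambda>N. real N * (sqrt (ln (real N) / real N) / (scl N)\<^sup>2)) \<longlonglongrightarrow> 0"
  "(\<lambda>N. real N * (ln (real N) / real N / scl N)) \<longlonglongrightarrow> 0"
  "(\<lambda>N. real N * (sqrt (ln (real N) / real N)^3 * real N powr (1/4))) \<longlonglongrightarrow> 0"
  "(\<lambda>N. real N * (ln (real N) / real N)\<^sup>2) \<longlonglongrightarrow> 0"
  "(\<lambda>N. ln (real N) / real N) \<longlonglongrightarrow> 0"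
  "(\<lambda>N. 1 / real N) \<longlonglongrightarrow> 0"
  unfolding scl_def by real_asymp+

text \<open>The bounds on \<open>V\<close> are those satisfied by products truncated at \<open>\<eta> * scl N\<close> and by
  sums of two of them, the truncation bias being controlled by the third absolute moment.\<close>

lemma (in prob_space) mgf_eventually:
  fixes \<theta> \<eta> B v :: real
  assumes "0 < \<eta>" "\<bar>\<theta>\<bar> * \<eta> \<le> 1/8" "0 \<le> B" "0 \<le> v"
  shows "eventually (\<lambda>N. \<forall>V. V \<in> borel_measurable M \<longrightarrow> (\<forall>\<omega>. \<bar>V \<omega>\<bar> \<le> 2 * (\<eta> * scl N)) \<longrightarrow>
       \<bar>expectation V\<bar> \<le> B / (\<eta> * scl N)\<^sup>2 \<longrightarrow> \<bar>expectation (\<lambda>\<omega>. (V \<omega>)\<^sup>2) - v\<bar> \<le> B / (\<eta> * scl N) \<longrightarrow>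
       expectation (\<lambda>\<omega>. \<bar>V \<omega>\<bar>^3) \<le> B \<longrightarrow>
       exp (v * \<theta>\<^sup>2/2 * (ln (real N) / real N) - 1 / real N)
          \<le> expectation (\<lambda>\<omega>. exp (\<theta> * sqrt (ln (real N) / real N) * V \<omega>)) \<and>
       expectation (\<lambda>\<omega>. exp (\<theta> * sqrt (ln (real N) / real N) * V \<omega>))
          \<le> exp (v * \<theta>\<^sup>2/2 * (ln (real N) / real N) + 1 / real N)) sequentially"
proof -
  define s where "s N = sqrt (ln (real N) / real N)" for N :: nat
  \<comment> \<open>The three summands bound the bias of the mean, the error of the second moment
    and the Taylor remainder; \<open>y0 N\<close> is the main term.\<close>
  define D where "D N = \<bar>\<theta>\<bar> * B / \<eta>\<^sup>2 * (s N / (scl N)\<^sup>2)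
     + \<theta>\<^sup>2 * B / (2 * \<eta>) * (ln (real N) / real N / scl N) + \<bar>\<theta>\<bar>^3 * B * ((s N)^3 * real N powr (1/4))" for N
  define y0 where "y0 N = v * \<theta>\<^sup>2/2 * (ln (real N) / real N)" for N :: nat
  have ND: "(\<lambda>N. real N * D N) \<longlonglongrightarrow> 0"
  proof -
    have "(\<lambda>N. \<bar>\<theta>\<bar> * B / \<eta>\<^sup>2 * (real N * (s N / (scl N)\<^sup>2))
     + \<theta>\<^sup>2 * B / (2 * \<eta>) * (real N * (ln (real N) / real N / scl N))
     + \<bar>\<theta>\<bar>^3 * B * (real N * ((s N)^3 * real N powr (1/4)))) \<longlonglongrightarrow>
       \<bar>\<theta>\<bar> * B / \<eta>\<^sup>2 * 0 + \<theta>\<^sup>2 * B / (2 * \<eta>) * 0 + \<bar>\<theta>\<bar>^3 * B * 0"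
      unfolding s_def by (intro tendsto_intros rate_limits)
    moreover have "real N * D N = \<bar>\<theta>\<bar> * B / \<eta>\<^sup>2 * (real N * (s N / (scl N)\<^sup>2))
     + \<theta>\<^sup>2 * B / (2 * \<eta>) * (real N * (ln (real N) / real N / scl N))
     + \<bar>\<theta>\<bar>^3 * B * (real N * ((s N)^3 * real N powr (1/4)))" for N
      unfolding D_def by (simp only: distrib_left mult.left_commute[of "real N" "\<bar>\<theta>\<bar> * B / \<eta>\<^sup>2"]
        mult.left_commute[of "real N" "\<theta>\<^sup>2 * B / (2 * \<eta>)"] mult.left_commute[of "real N" "\<bar>\<theta>\<bar>^3 * B"])
    ultimately show ?thesis by simp
  qed
  have D: "D \<longlonglongrightarrow> 0"
  proof -
    have "(\<lambda>N. (real N * D N) * (1 / real N)) \<longlonglongrightarrow> 0 * 0"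
      by (intro tendsto_intros ND rate_limits)
    moreover have "eventually (\<lambda>N. (real N * D N) * (1 / real N) = D N) sequentially"
      using eventually_gt_at_top[of 0] by eventually_elim simp
    ultimately show ?thesis by (simp add: tendsto_cong)
  qed
  have y0: "y0 \<longlonglongrightarrow> v * \<theta>\<^sup>2/2 * 0" unfolding y0_def by (intro tendsto_intros rate_limits)
  then have y0: "y0 \<longlonglongrightarrow> 0" by simp
  have "(\<lambda>N. (v * \<theta>\<^sup>2/2)\<^sup>2 * (real N * (ln (real N) / real N)\<^sup>2)) \<longlonglongrightarrow> (v * \<theta>\<^sup>2/2)\<^sup>2 * 0"
    by (intro tendsto_intros rate_limits)
  moreover have "real N * (y0 N)\<^sup>2 = (v * \<theta>\<^sup>2/2)\<^sup>2 * (real N * (ln (real N) / real N)\<^sup>2)" for N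
    unfolding y0_def power_mult_distrib[of "v * \<theta>\<^sup>2/2"] by (rule mult.left_commute)
  ultimately have y02: "(\<lambda>N. real N * (y0 N)\<^sup>2) \<longlonglongrightarrow> 0"
    by (simp only: mult_zero_right)
  have "(\<lambda>N. real N * D N + 2 * (real N * (y0 N)\<^sup>2 + 2 * y0 N * (real N * D N) + (real N * D N) * D N))
      \<longlonglongrightarrow> 0 + 2 * (0 + 2 * 0 * 0 + 0 * 0)"
    by (intro tendsto_intros ND D y0 y02)
  then have "(\<lambda>N. real N * (D N + 2 * (y0 N + D N)\<^sup>2)) \<longlonglongrightarrow> 0"
    by (simp add: algebra_simps power2_eq_square)
  \<comment> \<open>The square stems from \<open>exp_le_one_plus\<close>. A value below 1 means that
    each row is accurate up to a factor between \<open>exp (- 1 / N)\<close> and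
    \<open>exp (1 / N)\<close>, hence \<open>N\<close> rows up to a constant factor.\<close>
  then have ev1: "eventually (\<lambda>N. real N * (D N + 2 * (y0 N + D N)\<^sup>2) < 1) sequentially"
    by (rule order_tendstoD) simp
  have "(\<lambda>N. y0 N + D N) \<longlonglongrightarrow> 0 + 0" by (intro tendsto_intros y0 D)
  then have ev2: "eventually (\<lambda>N. y0 N + D N < 1/2) sequentially"
    by (rule order_tendstoD) simp
  show ?thesis
    using ev1 ev2 eventually_ge_at_top[of 2]
  proof eventually_elim
    case (elim N)
    have N: "0 < real N" "0 < scl N" using elim(3) scl_pos by auto
    show ?case
    proof (intro allI impI, goal_cases)
      case (1 V)
      note V = 1(1) and bd = 1(2) and m1 = 1(3) and m2 = 1(4) and m3 = 1(5)
      define l where "l = \<theta> * s N"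
      define E where "E = expectation (\<lambda>\<omega>. exp (l * V \<omega>))"
      have s0: "0 \<le> s N" "(s N)\<^sup>2 = ln (real N) / real N" using elim(3) by (auto simp: s_def)
      have sl: "s N * scl N = ln (real N)" unfolding s_def by (rule sqrt_mult_scl[OF elim(3)])
      \<comment> \<open>The exponent is \<open>2 * (1/8) * ln N\<close>, the 2 leaving room for sums
        of two truncated products. Any power below 1/2 would keep \<open>N\<close> times the Taylor
        remainder negligible.\<close>
      have ex: "exp (\<bar>l\<bar> * (2 * (\<eta> * scl N))) \<le> real N powr (1/4)"
      proof -
        have "\<bar>l\<bar> * (2 * (\<eta> * scl N)) = 2 * (\<bar>\<theta>\<bar> * \<eta>) * (s N * scl N)"
          using s0 by (simp add: l_def abs_mult)
        also have "\<dots> \<le> 2 * (1/8) * ln (real N)"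
          unfolding sl using assms elim(3) by (intro mult_right_mono mult_left_mono) auto
        finally have "exp (\<bar>l\<bar> * (2 * (\<eta> * scl N))) \<le> exp (1/4 * ln (real N))" by simp
        also have "\<dots> = real N powr (1/4)" using N by (simp add: powr_def)
        finally show ?thesis .
      qed
      have "\<bar>E - (1 + l * expectation V + l\<^sup>2/2 * expectation (\<lambda>\<omega>. (V \<omega>)\<^sup>2))\<bar>
        \<le> \<bar>l\<bar>^3 * exp (\<bar>l\<bar> * (2 * (\<eta> * scl N))) * expectation (\<lambda>\<omega>. \<bar>V \<omega>\<bar>^3)"
        unfolding E_def using bd by (intro mgf_taylor3 V) auto
      also have "\<dots> \<le> \<bar>l\<bar>^3 * real N powr (1/4) * B"
        using ex m3 by (intro mult_mono mult_left_mono) (auto intro!: integral_nonneg_AE)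
      finally have R: "\<bar>E - (1 + l * expectation V + l\<^sup>2/2 * expectation (\<lambda>\<omega>. (V \<omega>)\<^sup>2))\<bar> \<le> \<bar>l\<bar>^3 * real N powr (1/4) * B" .
      have "\<bar>l * expectation V\<bar> \<le> \<bar>l\<bar> * (B / (\<eta> * scl N)\<^sup>2)"
        unfolding abs_mult using m1 by (intro mult_left_mono) auto
      moreover have "\<bar>l\<^sup>2/2 * (expectation (\<lambda>\<omega>. (V \<omega>)\<^sup>2) - v)\<bar> \<le> l\<^sup>2/2 * (B / (\<eta> * scl N))"
        unfolding abs_mult using m2 by (intro mult_mono) auto
      moreover have "l\<^sup>2/2 * v = y0 N" using s0 by (simp add: l_def y0_def power_mult_distrib mult_ac)
      ultimately have "\<bar>E - 1 - y0 N\<bar> \<le> \<bar>l\<bar> * (B / (\<eta> * scl N)\<^sup>2) + l\<^sup>2/2 * (B / (\<eta> * scl N)) + \<bar>l\<bar>^3 * real N powr (1/4) * B"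
        using R by (simp add: right_diff_distrib)
      also have "\<dots> = D N"
        using s0 by (simp add: D_def l_def abs_mult power_mult_distrib mult_ac)
      finally have z: "\<bar>E - 1 - y0 N\<bar> \<le> D N" .
      have D0: "0 \<le> D N" using z by linarith
      have y00: "0 \<le> y0 N" using assms elim(3) by (simp add: y0_def)
      have le: "D N + 2 * (y0 N + D N)\<^sup>2 \<le> 1 / real N"
        using elim(1) N by (simp add: field_simps)
      have "E \<le> exp (E - 1)" using exp_ge_add_one_self[of "E - 1"] by simp
      also have "\<dots> \<le> exp (y0 N + 1 / real N)"
        using z le zero_le_power2[of "y0 N + D N"] by (intro exp_le_cancel_iff[THEN iffD2]) linarith
      finally have up: "E \<le> exp (y0 N + 1 / real N)" .
      have zz: "\<bar>E - 1\<bar> \<le> y0 N + D N" using z y00 by linarith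
      have "(E - 1)\<^sup>2 \<le> (y0 N + D N)\<^sup>2" using zz by (rule abs_le_square_iff[THEN iffD1, of "E - 1" "y0 N + D N", OF order_trans]) simp
      then have "exp (y0 N - 1 / real N) \<le> exp ((E - 1) - 2 * (E - 1)\<^sup>2)"
        using z le by (intro exp_le_cancel_iff[THEN iffD2]) linarith
      also have "\<dots> \<le> E" using exp_le_one_plus[of "E - 1"] zz elim(2) by simp
      finally show ?case using up unfolding E_def l_def y0_def s_def by simp
    qed
  qed
qed

section \<open>Truncated products\<close>

definition trunc :: "real \<Rightarrow> real \<Rightarrow> real" where
  "trunc \<tau> z = (if \<bar>z\<bar> \<le> \<tau> then z else 0)"

lemma trunc_measurable [measurable]: "trunc \<tau> \<in> borel_measurable borel"
  unfolding trunc_def by measurable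

lemma abs_trunc: "0 \<le> \<tau> \<Longrightarrow> \<bar>trunc \<tau> z\<bar> \<le> \<tau>" "\<bar>trunc \<tau> z\<bar> \<le> \<bar>z\<bar>"
  by (auto simp: trunc_def)

text \<open>The error lives where an argument exceeds \<tau>; there a lower power is raised to the
  third at the cost of one factor \<open>1/\<tau>\<close> per step.\<close>

lemma trunc_error:
  assumes "0 < \<tau>"
  shows "\<bar>trunc \<tau> z - z\<bar> \<le> \<bar>z\<bar>^3 / \<tau>\<^sup>2"
    and "\<bar>trunc \<tau> z * trunc \<tau> w - z * w\<bar> \<le> (\<bar>z\<bar>^3 + \<bar>w\<bar>^3) / \<tau>"
    and "\<bar>(trunc \<tau> z)\<^sup>2 - z\<^sup>2\<bar> \<le> \<bar>z\<bar>^3 / \<tau>"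
proof -
  have sq: "m\<^sup>2 \<le> m^3 / \<tau>" if "\<tau> < m" for m
  proof -
    have "m\<^sup>2 * \<tau> \<le> m\<^sup>2 * m" using that by (intro mult_left_mono) auto
    then show ?thesis using assms by (simp add: field_simps eval_nat_numeral)
  qed
  show "\<bar>trunc \<tau> z - z\<bar> \<le> \<bar>z\<bar>^3 / \<tau>\<^sup>2"
  proof (cases "\<bar>z\<bar> \<le> \<tau>")
    case False
    then have "\<bar>z\<bar> * \<tau>\<^sup>2 \<le> \<bar>z\<bar> * \<bar>z\<bar>\<^sup>2" using assms by (intro mult_left_mono power_mono) auto
    then show ?thesis using False assms by (simp add: trunc_def field_simps eval_nat_numeral)
  qed (use assms in \<open>simp add: trunc_def\<close>)
  show "\<bar>(trunc \<tau> z)\<^sup>2 - z\<^sup>2\<bar> \<le> \<bar>z\<bar>^3 / \<tau>"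
    using sq[of "\<bar>z\<bar>"] assms by (auto simp: trunc_def)
  show "\<bar>trunc \<tau> z * trunc \<tau> w - z * w\<bar> \<le> (\<bar>z\<bar>^3 + \<bar>w\<bar>^3) / \<tau>"
  proof (cases "\<bar>z\<bar> \<le> \<tau> \<and> \<bar>w\<bar> \<le> \<tau>")
    case False
    \<comment> \<open>At least one factor is truncated to 0, and the larger of the two exceeds
      \<tau>, so the bound \<open>m^2 \<le> m^3 / \<tau>\<close> applies.\<close>
    define m where "m = max \<bar>z\<bar> \<bar>w\<bar>"
    have "\<bar>trunc \<tau> z * trunc \<tau> w - z * w\<bar> = \<bar>z\<bar> * \<bar>w\<bar>" using False by (auto simp: trunc_def abs_mult)
    also have "\<dots> \<le> m * m" unfolding m_def by (intro mult_mono) auto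
    also have "\<dots> = m\<^sup>2" by (simp add: power2_eq_square)
    also have "\<dots> \<le> m^3 / \<tau>" using False by (intro sq) (auto simp: m_def)
    also have "\<dots> \<le> (\<bar>z\<bar>^3 + \<bar>w\<bar>^3) / \<tau>" using assms by (intro divide_right_mono) (auto simp: m_def max_def)
    finally show ?thesis .
  qed (use assms in \<open>simp add: trunc_def\<close>)
qed

lemma abs_add_cube: "\<bar>a + b\<bar>^3 \<le> 4 * (\<bar>a\<bar>^3 + \<bar>b\<bar>^3)" for a b :: real
proof -
  have *: "(x + y)^3 \<le> 4 * (x^3 + y^3)" if "0 \<le> x" "0 \<le> y" for x y :: real
  proof -
    have "4 * (x^3 + y^3) - (x + y)^3 = 3 * ((x + y) * (x - y)\<^sup>2)"
      by (simp add: algebra_simps eval_nat_numeral)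
    moreover have "0 \<le> (x + y) * (x - y)\<^sup>2" using that by simp
    ultimately show ?thesis by linarith
  qed
  have "\<bar>a + b\<bar>^3 \<le> (\<bar>a\<bar> + \<bar>b\<bar>)^3" by (intro power_mono) auto
  also have "\<dots> \<le> 4 * (\<bar>a\<bar>^3 + \<bar>b\<bar>^3)" by (rule *) auto
  finally show ?thesis .
qed

context prob_space
begin

lemma expectation_close:
  fixes f g :: "'a \<Rightarrow> real"
  assumes "integrable M f" "integrable M g" "integrable M h" "\<And>\<omega>. \<bar>f \<omega> - g \<omega>\<bar> \<le> h \<omega>"
  shows "\<bar>expectation f - expectation g\<bar> \<le> expectation h"
proof -
  have "\<bar>expectation f - expectation g\<bar> = \<bar>expectation (\<lambda>\<omega>. f \<omega> - g \<omega>)\<bar>" using assms by simp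
  also have "\<dots> \<le> expectation (\<lambda>\<omega>. \<bar>f \<omega> - g \<omega>\<bar>)" by (rule integral_abs_bound)
  also have "\<dots> \<le> expectation h" using assms by (intro integral_mono) auto
  finally show ?thesis .
qed

lemma trunc_moments:
  assumes [measurable]: "Z \<in> borel_measurable M" and Z: "integrable M Z" "expectation Z = 0"
    "integrable M (\<lambda>\<omega>. (Z \<omega>)\<^sup>2)" "expectation (\<lambda>\<omega>. (Z \<omega>)\<^sup>2) = 1"
    "integrable M (\<lambda>\<omega>. \<bar>Z \<omega>\<bar>^3)" "expectation (\<lambda>\<omega>. \<bar>Z \<omega>\<bar>^3) = B" and "0 < \<tau>"
  shows "\<bar>expectation (\<lambda>\<omega>. trunc \<tau> (Z \<omega>))\<bar> \<le> B / \<tau>\<^sup>2"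
    and "\<bar>expectation (\<lambda>\<omega>. (trunc \<tau> (Z \<omega>))\<^sup>2) - 1\<bar> \<le> B / \<tau>"
    and "expectation (\<lambda>\<omega>. \<bar>trunc \<tau> (Z \<omega>)\<bar>^3) \<le> B"
proof -
  have bd: "\<bar>trunc \<tau> (Z \<omega>)\<bar> \<le> \<tau>" for \<omega> using \<open>0 < \<tau>\<close> abs_trunc by simp
  have mt: "(\<lambda>\<omega>. trunc \<tau> (Z \<omega>)) \<in> borel_measurable M" by measurable
  note int = integrable_bounded[OF mt bd] integrable_power_bounded[OF mt bd]
  have "\<bar>expectation (\<lambda>\<omega>. trunc \<tau> (Z \<omega>)) - expectation Z\<bar> \<le> expectation (\<lambda>\<omega>. \<bar>Z \<omega>\<bar>^3 / \<tau>\<^sup>2)"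
    using Z int trunc_error(1)[OF \<open>0 < \<tau>\<close>] by (intro expectation_close) auto
  then show "\<bar>expectation (\<lambda>\<omega>. trunc \<tau> (Z \<omega>))\<bar> \<le> B / \<tau>\<^sup>2" using Z by simp
  have "\<bar>expectation (\<lambda>\<omega>. (trunc \<tau> (Z \<omega>))\<^sup>2) - expectation (\<lambda>\<omega>. (Z \<omega>)\<^sup>2)\<bar> \<le> expectation (\<lambda>\<omega>. \<bar>Z \<omega>\<bar>^3 / \<tau>)"
    using Z int trunc_error(3)[OF \<open>0 < \<tau>\<close>] by (intro expectation_close) auto
  then show "\<bar>expectation (\<lambda>\<omega>. (trunc \<tau> (Z \<omega>))\<^sup>2) - 1\<bar> \<le> B / \<tau>" using Z by simp
  have "expectation (\<lambda>\<omega>. \<bar>trunc \<tau> (Z \<omega>)\<bar>^3) \<le> expectation (\<lambda>\<omega>. \<bar>Z \<omega>\<bar>^3)"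
    using Z int abs_trunc(2) by (intro integral_mono power_mono) auto
  then show "expectation (\<lambda>\<omega>. \<bar>trunc \<tau> (Z \<omega>)\<bar>^3) \<le> B" using Z by simp
qed

text \<open>\<open>Z\<close> and \<open>W\<close> stand for two products that share a column:
  dependent but uncorrelated, so the second moment of the sum is near 2, the mixed term being
  handled by \<open>trunc_error\<close>. The single constant 8 covers the three bounds, giving them
  the form that \<open>mgf_eventually\<close> expects.\<close>

lemma trunc_pair_moments:
  assumes mZ[measurable]: "Z \<in> borel_measurable M" and Z: "integrable M Z" "expectation Z = 0"
    "integrable M (\<lambda>\<omega>. (Z \<omega>)\<^sup>2)" "expectation (\<lambda>\<omega>. (Z \<omega>)\<^sup>2) = 1"
    "integrable M (\<lambda>\<omega>. \<bar>Z \<omega>\<bar>^3)" "expectation (\<lambda>\<omega>. \<bar>Z \<omega>\<bar>^3) = B"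
  and mW[measurable]: "W \<in> borel_measurable M" and W: "integrable M W" "expectation W = 0"
    "integrable M (\<lambda>\<omega>. (W \<omega>)\<^sup>2)" "expectation (\<lambda>\<omega>. (W \<omega>)\<^sup>2) = 1"
    "integrable M (\<lambda>\<omega>. \<bar>W \<omega>\<bar>^3)" "expectation (\<lambda>\<omega>. \<bar>W \<omega>\<bar>^3) = B"
  and ZW: "integrable M (\<lambda>\<omega>. Z \<omega> * W \<omega>)" "expectation (\<lambda>\<omega>. Z \<omega> * W \<omega>) = 0" and "0 < \<tau>"
  defines "V \<equiv> \<lambda>\<omega>. trunc \<tau> (Z \<omega>) + trunc \<tau> (W \<omega>)"
  shows "\<bar>expectation V\<bar> \<le> 8 * B / \<tau>\<^sup>2"
    and "\<bar>expectation (\<lambda>\<omega>. (V \<omega>)\<^sup>2) - 2\<bar> \<le> 8 * B / \<tau>"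
    and "expectation (\<lambda>\<omega>. \<bar>V \<omega>\<bar>^3) \<le> 8 * B"
proof -
  note mZ' = trunc_moments[OF mZ Z \<open>0 < \<tau>\<close>] and mW' = trunc_moments[OF mW W \<open>0 < \<tau>\<close>]
  have B: "0 \<le> B" unfolding Z(6)[symmetric] by (intro integral_nonneg_AE) auto
  have bd: "\<bar>trunc \<tau> z\<bar> \<le> \<tau>" for z using \<open>0 < \<tau>\<close> abs_trunc by simp
  have mt: "(\<lambda>\<omega>. trunc \<tau> (Z \<omega>)) \<in> borel_measurable M" "(\<lambda>\<omega>. trunc \<tau> (W \<omega>)) \<in> borel_measurable M"
    by measurable
  note int = integrable_bounded[OF mt(1) bd] integrable_power_bounded[OF mt(1) bd]
    integrable_bounded[OF mt(2) bd] integrable_power_bounded[OF mt(2) bd]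
  have intp: "integrable M (\<lambda>\<omega>. trunc \<tau> (Z \<omega>) * trunc \<tau> (W \<omega>))"
    using \<open>0 < \<tau>\<close> by (intro integrable_bounded[where b="\<tau> * \<tau>"]) (auto simp: abs_mult intro!: mult_mono bd)
  have "\<bar>expectation (\<lambda>\<omega>. trunc \<tau> (Z \<omega>) * trunc \<tau> (W \<omega>)) - expectation (\<lambda>\<omega>. Z \<omega> * W \<omega>)\<bar>
     \<le> expectation (\<lambda>\<omega>. (\<bar>Z \<omega>\<bar>^3 + \<bar>W \<omega>\<bar>^3) / \<tau>)"
    using Z W ZW intp trunc_error(2)[OF \<open>0 < \<tau>\<close>] by (intro expectation_close) auto
  also have "\<dots> = 2 * B / \<tau>" using Z W by simp
  finally have cross: "\<bar>expectation (\<lambda>\<omega>. trunc \<tau> (Z \<omega>) * trunc \<tau> (W \<omega>))\<bar> \<le> 2 * B / \<tau>" using ZW by simp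
  have "expectation V = expectation (\<lambda>\<omega>. trunc \<tau> (Z \<omega>)) + expectation (\<lambda>\<omega>. trunc \<tau> (W \<omega>))"
    unfolding V_def using int by simp
  then have "\<bar>expectation V\<bar> \<le> 2 * (B / \<tau>\<^sup>2)" using mZ'(1) mW'(1) by linarith
  moreover have "0 \<le> B / \<tau>\<^sup>2" using B by simp
  ultimately show "\<bar>expectation V\<bar> \<le> 8 * B / \<tau>\<^sup>2" by linarith
  have sq: "(V \<omega>)\<^sup>2 = (trunc \<tau> (Z \<omega>))\<^sup>2 + (trunc \<tau> (W \<omega>))\<^sup>2 + 2 * (trunc \<tau> (Z \<omega>) * trunc \<tau> (W \<omega>))" for \<omega>
    unfolding V_def by (simp add: power2_eq_square algebra_simps)
  have "expectation (\<lambda>\<omega>. (V \<omega>)\<^sup>2) = expectation (\<lambda>\<omega>. (trunc \<tau> (Z \<omega>))\<^sup>2) + expectation (\<lambda>\<omega>. (trunc \<tau> (W \<omega>))\<^sup>2)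
      + 2 * expectation (\<lambda>\<omega>. trunc \<tau> (Z \<omega>) * trunc \<tau> (W \<omega>))"
    unfolding sq using int intp by simp
  then have "\<bar>expectation (\<lambda>\<omega>. (V \<omega>)\<^sup>2) - 2\<bar> \<le> 6 * (B / \<tau>)" using mZ'(2) mW'(2) cross by linarith
  moreover have "0 \<le> B / \<tau>" using B \<open>0 < \<tau>\<close> by simp
  ultimately show "\<bar>expectation (\<lambda>\<omega>. (V \<omega>)\<^sup>2) - 2\<bar> \<le> 8 * B / \<tau>" by linarith
  have mV: "V \<in> borel_measurable M" unfolding V_def by measurable
  have bV: "\<bar>V \<omega>\<bar> \<le> 2 * \<tau>" for \<omega> unfolding V_def using bd[of "Z \<omega>"] bd[of "W \<omega>"] by linarith
  have "expectation (\<lambda>\<omega>. \<bar>V \<omega>\<bar>^3) \<le> expectation (\<lambda>\<omega>. 4 * (\<bar>trunc \<tau> (Z \<omega>)\<bar>^3 + \<bar>trunc \<tau> (W \<omega>)\<bar>^3))"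
    using int integrable_power_bounded[OF mV bV] by (intro integral_mono) (use abs_add_cube in \<open>auto simp: V_def\<close>)
  also have "\<dots> = 4 * (expectation (\<lambda>\<omega>. \<bar>trunc \<tau> (Z \<omega>)\<bar>^3) + expectation (\<lambda>\<omega>. \<bar>trunc \<tau> (W \<omega>)\<bar>^3))"
    using int by simp
  also have "\<dots> \<le> 8 * B" using add_mono[OF mZ'(3) mW'(3)] by simp
  finally show "expectation (\<lambda>\<omega>. \<bar>V \<omega>\<bar>^3) \<le> 8 * B" .
qed

end

section \<open>Independence and equality of laws inside the array\<close>

locale iid_array = prob_space M for M :: "'a measure" +
  fixes X :: "nat \<Rightarrow> nat \<Rightarrow> 'a \<Rightarrow> real"
  assumes indep: "indep_vars (\<lambda>_. borel) (\<lambda>(k, i). X k i) ({1..} \<times> {1..})"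
    and ident: "\<And>k i. k \<ge> 1 \<Longrightarrow> i \<ge> 1 \<Longrightarrow> distr M borel (X k i) = distr M borel (X 1 1)"
begin

lemma X_measurable [measurable]: "1 \<le> k \<Longrightarrow> 1 \<le> i \<Longrightarrow> X k i \<in> borel_measurable M"
  using indep unfolding indep_vars_def by force

text \<open>Distinct entries are disjoint singleton blocks of the index set, so independence of
  blocks yields independence of any injective selection.\<close>

lemma indep_reindex:
  assumes inj: "inj_on f I" and sub: "f ` I \<subseteq> {1..} \<times> {1..}"
  shows "indep_vars (\<lambda>_. borel) (\<lambda>i. X (fst (f i)) (snd (f i))) I"
proof -
  have "indep_vars (\<lambda>i. PiM {f i} (\<lambda>_. borel)) (\<lambda>i \<omega>. restrict (\<lambda>p. (case p of (k, i) \<Rightarrow> X k i) \<omega>) {f i}) I"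
    using inj sub by (intro indep_vars_restrict[OF indep]) (auto simp: disjoint_family_on_def inj_on_def)
  then have "indep_vars (\<lambda>_. borel) (\<lambda>i \<omega>. (\<lambda>x. x (f i)) (restrict (\<lambda>p. (case p of (k, i) \<Rightarrow> X k i) \<omega>) {f i})) I"
    by (rule indep_vars_compose2) simp
  then show ?thesis by (simp add: case_prod_beta)
qed

lemma joint_law:
  assumes "I \<noteq> {}" and inj: "inj_on f I" and sub: "f ` I \<subseteq> {1..} \<times> {1..}"
  shows "distr M (PiM I (\<lambda>_. borel)) (\<lambda>\<omega>. \<lambda>i\<in>I. X (fst (f i)) (snd (f i)) \<omega>)
     = PiM I (\<lambda>_. distr M borel (X 1 1))"
proof -
  have 1: "1 \<le> fst (f i)" "1 \<le> snd (f i)" if "i \<in> I" for i using sub that by force+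
  have "distr M (PiM I (\<lambda>_. borel)) (\<lambda>\<omega>. \<lambda>i\<in>I. X (fst (f i)) (snd (f i)) \<omega>)
     = PiM I (\<lambda>i. distr M borel (X (fst (f i)) (snd (f i))))"
    using assms 1 by (intro indep_vars_iff_distr_eq_PiM'[THEN iffD1, OF _ _ indep_reindex]) auto
  also have "\<dots> = PiM I (\<lambda>_. distr M borel (X 1 1))"
    using 1 by (intro PiM_cong refl ident) auto
  finally show ?thesis .
qed

text \<open>By \<open>joint_law\<close> an injectively indexed family of entries has the same
  product law whatever the injection. Events can therefore be moved to another row or another choice
  of columns.\<close>

lemma prob_transfer:
  assumes "inj_on f I" "f ` I \<subseteq> {1..} \<times> {1..}" "inj_on g I" "g ` I \<subseteq> {1..} \<times> {1..}" "I \<noteq> {}"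
    and P: "Measurable.pred (PiM I (\<lambda>_. borel)) P"
  shows "prob {\<omega>\<in>space M. P (\<lambda>i\<in>I. X (fst (f i)) (snd (f i)) \<omega>)}
       = prob {\<omega>\<in>space M. P (\<lambda>i\<in>I. X (fst (g i)) (snd (g i)) \<omega>)}"
proof -
  define A where "A = {x\<in>space (PiM I (\<lambda>_. borel :: real measure)). P x}"
  have A: "A \<in> sets (PiM I (\<lambda>_. borel))" unfolding A_def using P by (simp add: pred_def)
  have *: "prob {\<omega>\<in>space M. P (\<lambda>i\<in>I. X (fst (h i)) (snd (h i)) \<omega>)}
     = measure (PiM I (\<lambda>_. distr M borel (X 1 1))) A" if "inj_on h I" "h ` I \<subseteq> {1..} \<times> {1..}" for h
  proof -
    have m: "(\<lambda>\<omega>. \<lambda>i\<in>I. X (fst (h i)) (snd (h i)) \<omega>) \<in> measurable M (PiM I (\<lambda>_. borel))"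
      using that by (intro measurable_restrict X_measurable) force+
    have "prob {\<omega>\<in>space M. P (\<lambda>i\<in>I. X (fst (h i)) (snd (h i)) \<omega>)}
      = prob ((\<lambda>\<omega>. \<lambda>i\<in>I. X (fst (h i)) (snd (h i)) \<omega>) -` A \<inter> space M)"
      using measurable_space[OF m] by (intro arg_cong[where f=prob]) (auto simp: A_def)
    also have "\<dots> = measure (distr M (PiM I (\<lambda>_. borel)) (\<lambda>\<omega>. \<lambda>i\<in>I. X (fst (h i)) (snd (h i)) \<omega>)) A"
      using measure_distr[OF m A] by simp
    finally show ?thesis unfolding joint_law[OF \<open>I \<noteq> {}\<close> that] .
  qed
  show ?thesis using *[of f] *[of g] assms by simp
qed

text \<open>The sets \<open>{k} \<times> J\<close> are disjoint for distinct \<open>k\<close>. A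
  general target space \<open>N k\<close> and a possibly infinite \<open>J\<close> let this serve
  both the summands of a row sum and the row events of the Borel--Cantelli argument.\<close>

lemma indep_rows:
  assumes "J \<subseteq> {1..}" and f[measurable]: "\<And>k. f k \<in> measurable (PiM J (\<lambda>_. borel)) (N k)"
  shows "indep_vars N (\<lambda>k \<omega>. f k (\<lambda>j\<in>J. X k j \<omega>)) {1..}"
proof -
  have "indep_vars (\<lambda>k. PiM ({k} \<times> J) (\<lambda>_. borel)) (\<lambda>k \<omega>. restrict (\<lambda>p. (case p of (k, i) \<Rightarrow> X k i) \<omega>) ({k} \<times> J)) {1..}"
    using assms by (intro indep_vars_restrict[OF indep]) (auto simp: disjoint_family_on_def)
  then have "indep_vars N (\<lambda>k \<omega>. (\<lambda>x. f k (\<lambda>j\<in>J. x (k, j))) (restrict (\<lambda>p. (case p of (k, i) \<Rightarrow> X k i) \<omega>) ({k} \<times> J))) {1..}"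
    by (rule indep_vars_compose2) measurable
  then show ?thesis by (simp cong: restrict_cong)
qed

lemma indep_entries:
  assumes "1 \<le> k" "1 \<le> i" "1 \<le> k'" "1 \<le> i'" "(k, i) \<noteq> (k', i')"
  shows "indep_var borel (X k i) borel (X k' i')"
proof -
  have "indep_var borel ((\<lambda>x. x (k, i)) \<circ> (\<lambda>\<omega>. restrict (\<lambda>p. (case p of (k, i) \<Rightarrow> X k i) \<omega>) {(k, i)}))
       borel ((\<lambda>x. x (k', i')) \<circ> (\<lambda>\<omega>. restrict (\<lambda>p. (case p of (k, i) \<Rightarrow> X k i) \<omega>) {(k', i')}))"
    using assms by (intro indep_var_compose[OF indep_var_restrict[OF indep]]) auto
  then show ?thesis by (simp add: comp_def)
qed

lemma moment_X:
  assumes "1 \<le> k" "1 \<le> i" and [measurable]: "f \<in> borel_measurable borel"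
  shows "expectation (\<lambda>\<omega>. f (X k i \<omega>) :: real) = expectation (\<lambda>\<omega>. f (X 1 1 \<omega>))"
    and "integrable M (\<lambda>\<omega>. f (X k i \<omega>) :: real) \<longleftrightarrow> integrable M (\<lambda>\<omega>. f (X 1 1 \<omega>))"
proof -
  have "expectation (\<lambda>\<omega>. f (X k i \<omega>)) = (\<integral>x. f x \<partial>distr M borel (X k i))"
    using assms by (subst integral_distr) auto
  also have "\<dots> = expectation (\<lambda>\<omega>. f (X 1 1 \<omega>))"
    unfolding ident[OF assms(1,2)] by (subst integral_distr) auto
  finally show "expectation (\<lambda>\<omega>. f (X k i \<omega>) :: real) = expectation (\<lambda>\<omega>. f (X 1 1 \<omega>))" .
  have "integrable M (\<lambda>\<omega>. f (X k i \<omega>)) \<longleftrightarrow> integrable (distr M borel (X k i)) f"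
    using assms by (subst integrable_distr_eq) auto
  also have "\<dots> \<longleftrightarrow> integrable M (\<lambda>\<omega>. f (X 1 1 \<omega>))"
    unfolding ident[OF assms(1,2)] by (subst integrable_distr_eq) auto
  finally show "integrable M (\<lambda>\<omega>. f (X k i \<omega>) :: real) \<longleftrightarrow> integrable M (\<lambda>\<omega>. f (X 1 1 \<omega>))" .
qed

definition Z :: "nat \<Rightarrow> nat \<Rightarrow> nat \<Rightarrow> 'a \<Rightarrow> real" where
  "Z k i j \<omega> = X k i \<omega> * X k j \<omega>"

lemma Z_measurable [measurable]: "1 \<le> k \<Longrightarrow> 1 \<le> i \<Longrightarrow> 1 \<le> j \<Longrightarrow> Z k i j \<in> borel_measurable M"
  unfolding Z_def by measurable

lemma Z_commute: "Z k i j = Z k j i"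
  by (simp add: Z_def fun_eq_iff mult.commute)

text \<open>Asking \<open>f\<close> to be multiplicative covers the identity, the square and the
  absolute cube at once: the moment of a product of two entries is the square of the moment of one
  entry.\<close>

lemma moment_Z:
  assumes "1 \<le> k" "1 \<le> i" "1 \<le> j" "i \<noteq> j" and [measurable]: "f \<in> borel_measurable borel"
    and f: "\<And>x y. f (x * y) = f x * (f y :: real)" and int: "integrable M (\<lambda>\<omega>. f (X 1 1 \<omega>))"
  shows "expectation (\<lambda>\<omega>. f (Z k i j \<omega>)) = (expectation (\<lambda>\<omega>. f (X 1 1 \<omega>)))\<^sup>2"
    and "integrable M (\<lambda>\<omega>. f (Z k i j \<omega>))"
proof -
  have "indep_var borel (f \<circ> X k i) borel (f \<circ> X k j)"
    using assms by (intro indep_var_compose[OF indep_entries]) auto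
  then have iv: "indep_var borel (\<lambda>\<omega>. f (X k i \<omega>)) borel (\<lambda>\<omega>. f (X k j \<omega>))" by (simp add: comp_def)
  note m = moment_X(2)[of k i f] moment_X(2)[of k j f] moment_X(1)[of k i f] moment_X(1)[of k j f]
  show "integrable M (\<lambda>\<omega>. f (Z k i j \<omega>))"
    unfolding Z_def f using m assms by (intro indep_var_integrable[OF iv]) auto
  show "expectation (\<lambda>\<omega>. f (Z k i j \<omega>)) = (expectation (\<lambda>\<omega>. f (X 1 1 \<omega>)))\<^sup>2"
    unfolding Z_def f using m assms by (subst indep_var_lebesgue_integral[OF iv]) (auto simp: power2_eq_square)
qed

end

section \<open>Deviation bounds for truncated sums\<close>

text \<open>The third moment belongs to the standing assumptions because the deviation bounds rest
  on it; \<open>third_moment\<close> supplies it from the summability condition.\<close>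

locale iid_array_std = iid_array +
  assumes int1: "integrable M (X 1 1)" and mean: "expectation (X 1 1) = 0"
    and int2: "integrable M (\<lambda>\<omega>. (X 1 1 \<omega>)\<^sup>2)" and var: "expectation (\<lambda>\<omega>. (X 1 1 \<omega>)\<^sup>2) = 1"
    and int3: "integrable M (\<lambda>\<omega>. \<bar>X 1 1 \<omega>\<bar>^3)"
begin

text \<open>By independence of the factors this is the third absolute moment of a product of two
  entries.\<close>

definition B :: real where "B = (expectation (\<lambda>\<omega>. \<bar>X 1 1 \<omega>\<bar>^3))\<^sup>2"

lemma B_nonneg: "0 \<le> B"
  by (simp add: B_def)

lemma Z_moments:
  assumes "1 \<le> k" "1 \<le> i" "1 \<le> j" "i \<noteq> j"
  shows "integrable M (Z k i j)" "expectation (Z k i j) = 0"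
    "integrable M (\<lambda>\<omega>. (Z k i j \<omega>)\<^sup>2)" "expectation (\<lambda>\<omega>. (Z k i j \<omega>)\<^sup>2) = 1"
    "integrable M (\<lambda>\<omega>. \<bar>Z k i j \<omega>\<bar>^3)" "expectation (\<lambda>\<omega>. \<bar>Z k i j \<omega>\<bar>^3) = B"
  using moment_Z[OF assms, of "\<lambda>x. x"] moment_Z[OF assms, of "\<lambda>x. x\<^sup>2"] moment_Z[OF assms, of "\<lambda>x. \<bar>x\<bar>^3"]
    int1 mean int2 var int3
  by (simp_all add: B_def power_mult_distrib abs_mult)

text \<open>The integrand is the square of the shared entry times two further entries, and each of
  the latter contributes a factor of mean 0. The auxiliary \<open>f\<close> squares exactly the
  shared column, so that independence of three distinct entries applies.\<close>

lemma Z_cross: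
  assumes "1 \<le> k" "1 \<le> i" "1 \<le> j" "1 \<le> j'" "i \<noteq> j" "i \<noteq> j'" "j \<noteq> j'"
  shows "integrable M (\<lambda>\<omega>. Z k i j \<omega> * Z k i j' \<omega>)" "expectation (\<lambda>\<omega>. Z k i j \<omega> * Z k i j' \<omega>) = 0"
proof -
  define f where "f a x = (if a = i then x\<^sup>2 else x)" for a and x :: real
  have [measurable]: "f a \<in> borel_measurable borel" for a unfolding f_def by measurable
  have "indep_vars (\<lambda>_. borel) (\<lambda>a. X k a) {i, j, j'}"
    using indep_reindex[of "\<lambda>a. (k, a)" "{i, j, j'}"] assms by (simp add: inj_on_def)
  then have iv: "indep_vars (\<lambda>_. borel) (\<lambda>a \<omega>. f a (X k a \<omega>)) {i, j, j'}"
    by (rule indep_vars_compose2) simp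
  have int: "integrable M (\<lambda>\<omega>. f a (X k a \<omega>))" if "a \<in> {i, j, j'}" for a
    using that moment_X(2)[of k a "f a"] assms int1 int2 by (auto simp: f_def)
  have eq: "(\<Prod>a\<in>{i, j, j'}. f a (X k a \<omega>)) = Z k i j \<omega> * Z k i j' \<omega>" for \<omega>
    using assms by (simp add: f_def Z_def power2_eq_square)
  show "integrable M (\<lambda>\<omega>. Z k i j \<omega> * Z k i j' \<omega>)"
    using indep_vars_integrable[OF _ iv int] unfolding eq by simp
  have "expectation (\<lambda>\<omega>. Z k i j \<omega> * Z k i j' \<omega>) = (\<Prod>a\<in>{i, j, j'}. expectation (\<lambda>\<omega>. f a (X k a \<omega>)))"
    using indep_vars_lebesgue_integral[OF _ iv int] unfolding eq by simp
  also have "\<dots> = 0"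
    using moment_X(1)[of k j "\<lambda>x. x"] mean assms by (intro prod_zero) (auto simp: f_def intro!: bexI[of _ j])
  finally show "expectation (\<lambda>\<omega>. Z k i j \<omega> * Z k i j' \<omega>) = 0" .
qed

text \<open>An arbitrary set of rows is allowed so that the sum over the first \<open>N\<close> rows
  and the increments beyond row \<open>N\<close> obey the same bounds.\<close>

definition S :: "real \<Rightarrow> nat set \<Rightarrow> nat \<Rightarrow> nat \<Rightarrow> 'a \<Rightarrow> real" where
  "S \<tau> K i j \<omega> = (\<Sum>k\<in>K. trunc \<tau> (Z k i j \<omega>))"

lemma S_commute: "S \<tau> K i j = S \<tau> K j i"
  by (simp add: S_def Z_commute fun_eq_iff)

lemma S_measurable [measurable]: "K \<subseteq> {1..} \<Longrightarrow> 1 \<le> i \<Longrightarrow> 1 \<le> j \<Longrightarrow> S \<tau> K i j \<in> borel_measurable M"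
  unfolding S_def by (intro borel_measurable_sum measurable_compose[OF Z_measurable trunc_measurable]) auto

lemma S_bounded: "0 \<le> \<tau> \<Longrightarrow> \<bar>S \<tau> K i j \<omega>\<bar> \<le> real (card K) * \<tau>"
proof -
  assume "0 \<le> \<tau>"
  have "\<bar>S \<tau> K i j \<omega>\<bar> \<le> (\<Sum>k\<in>K. \<bar>trunc \<tau> (Z k i j \<omega>)\<bar>)" unfolding S_def by (rule sum_abs)
  also have "\<dots> \<le> real (card K) * \<tau>" using \<open>0 \<le> \<tau>\<close> by (intro sum_bounded_above abs_trunc)
  finally show ?thesis .
qed

lemma indep_trunc:
  assumes "K \<subseteq> {1..}" "1 \<le> i" "1 \<le> j" "1 \<le> j'"
  shows "indep_vars (\<lambda>_. borel) (\<lambda>k \<omega>. trunc \<tau> (Z k i j \<omega>)) K"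
    and "indep_vars (\<lambda>_. borel) (\<lambda>k \<omega>. trunc \<tau> (Z k i j \<omega>) + trunc \<tau> (Z k i j' \<omega>)) K"
proof -
  have "indep_vars (\<lambda>_. borel) (\<lambda>k \<omega>. (\<lambda>x. trunc \<tau> (x i * x j)) (\<lambda>a\<in>{i,j}. X k a \<omega>)) {1..}"
    using assms by (intro indep_rows) auto
  then show "indep_vars (\<lambda>_. borel) (\<lambda>k \<omega>. trunc \<tau> (Z k i j \<omega>)) K"
    using indep_vars_subset[OF _ assms(1)] by (auto simp: Z_def)
  have "indep_vars (\<lambda>_. borel) (\<lambda>k \<omega>. (\<lambda>x. trunc \<tau> (x i * x j) + trunc \<tau> (x i * x j')) (\<lambda>a\<in>{i,j,j'}. X k a \<omega>)) {1..}"
    using assms by (intro indep_rows) auto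
  then show "indep_vars (\<lambda>_. borel) (\<lambda>k \<omega>. trunc \<tau> (Z k i j \<omega>) + trunc \<tau> (Z k i j' \<omega>)) K"
    using indep_vars_subset[OF _ assms(1)] by (auto simp: Z_def)
qed

lemma prod_exp_bounds:
  assumes "\<And>k. k \<in> K \<Longrightarrow> exp a \<le> f k" "\<And>k. k \<in> K \<Longrightarrow> f k \<le> exp (b :: real)"
  shows "exp (real (card K) * a) \<le> prod f K" "prod f K \<le> exp (real (card K) * b)"
proof -
  have "(\<Prod>k\<in>K. exp a) \<le> prod f K" using assms by (intro prod_mono) auto
  then show "exp (real (card K) * a) \<le> prod f K" by (simp add: exp_of_nat_mult)
  have "0 \<le> f k" if "k \<in> K" for k using assms(1)[OF that] exp_gt_zero[of a] by linarith
  then have "prod f K \<le> (\<Prod>k\<in>K. exp b)" using assms by (intro prod_mono) auto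
  then show "prod f K \<le> exp (real (card K) * b)" by (simp add: exp_of_nat_mult)
qed

text \<open>The one-row estimate is multiplied over the independent rows in \<open>K\<close>. How
  large \<open>N\<close> must be does not depend on \<open>K\<close>, \<open>i\<close>,
  \<open>j\<close>, as union bounds over pairs and sample sizes require; for a short increment the
  exponent shrinks with \<open>card K\<close>.\<close>

lemma S_mgf:
  assumes "0 < \<eta>" "\<bar>\<theta>\<bar> * \<eta> \<le> 1/8"
  shows "eventually (\<lambda>N. \<forall>K i j. finite K \<longrightarrow> K \<subseteq> {1..} \<longrightarrow> 1 \<le> i \<longrightarrow> 1 \<le> j \<longrightarrow> i \<noteq> j \<longrightarrow>
     exp (real (card K) * (\<theta>\<^sup>2/2 * (ln (real N) / real N) - 1 / real N))
        \<le> expectation (\<lambda>\<omega>. exp (\<theta> * sqrt (ln (real N) / real N) * S (\<eta> * scl N) K i j \<omega>)) \<and>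
     expectation (\<lambda>\<omega>. exp (\<theta> * sqrt (ln (real N) / real N) * S (\<eta> * scl N) K i j \<omega>))
        \<le> exp (real (card K) * (\<theta>\<^sup>2/2 * (ln (real N) / real N) + 1 / real N))) sequentially"
  using mgf_eventually[OF assms mult_nonneg_nonneg[OF _ B_nonneg], of 8 1, simplified] eventually_ge_at_top[of 2]
proof eventually_elim
  case (elim N)
  show ?case
  proof (intro allI impI, goal_cases)
  case (1 K i j)
  define \<tau> where "\<tau> = \<eta> * scl N"
  define E where "E k = expectation (\<lambda>\<omega>. exp (\<theta> * sqrt (ln (real N) / real N) * trunc \<tau> (Z k i j \<omega>)))" for k
  have \<tau>: "0 < \<tau>" using elim(2) scl_pos assms by (simp add: \<tau>_def)
  have bd: "\<bar>trunc \<tau> (Z k i j \<omega>)\<bar> \<le> \<tau>" for k \<omega> using \<tau> abs_trunc by simp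
  have E: "exp (\<theta>\<^sup>2/2 * (ln (real N) / real N) - 1 / real N) \<le> E k \<and>
      E k \<le> exp (\<theta>\<^sup>2/2 * (ln (real N) / real N) + 1 / real N)" if "k \<in> K" for k
  proof -
    have k: "1 \<le> k" using that 1 by auto
    have i: "1 \<le> i" "1 \<le> j" "i \<noteq> j" using 1 by auto
    note mZ = Z_measurable[OF k i(1,2)]
    have mt: "(\<lambda>\<omega>. trunc \<tau> (Z k i j \<omega>)) \<in> borel_measurable M"
      by (rule measurable_compose[OF mZ trunc_measurable])
    note m = trunc_moments[OF mZ Z_moments[OF k i] \<tau>]
    \<comment> \<open>The one-row estimate is instantiated with the constants of a sum of two
      products; a single product meets them with room to spare.\<close>
    have "B / \<tau>\<^sup>2 \<le> 8 * B / \<tau>\<^sup>2" "B / \<tau> \<le> 8 * B / \<tau>" "B \<le> 8 * B" using B_nonneg \<tau> by (auto intro!: divide_right_mono)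
    moreover have "\<bar>trunc \<tau> (Z k i j \<omega>)\<bar> \<le> 2 * \<tau>" for \<omega> using bd[of k \<omega>] \<tau> by linarith
    ultimately show ?thesis
      using elim(1)[rule_format, folded \<tau>_def, OF mt _ order_trans[OF m(1)] order_trans[OF m(2)] order_trans[OF m(3)]]
      unfolding E_def by simp
  qed
  have "expectation (\<lambda>\<omega>. exp (\<theta> * sqrt (ln (real N) / real N) * S \<tau> K i j \<omega>)) = prod E K"
    unfolding S_def E_def using 1 bd by (intro mgf_sum indep_trunc(1)[where j'=j]) auto
  then show ?case using prod_exp_bounds[of K, OF E[THEN conjunct1] E[THEN conjunct2]] unfolding \<tau>_def by simp
qed
qed

text \<open>Two products sharing column \<open>i\<close> are uncorrelated, so each row has variance
  close to 2 and \<open>\<theta>^2\<close> replaces \<open>\<theta>^2/2\<close>.\<close>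

lemma S_pair_mgf:
  assumes "0 < \<eta>" "\<bar>\<theta>\<bar> * \<eta> \<le> 1/8"
  shows "eventually (\<lambda>N. \<forall>K i j j'. finite K \<longrightarrow> K \<subseteq> {1..} \<longrightarrow> 1 \<le> i \<longrightarrow> 1 \<le> j \<longrightarrow> 1 \<le> j' \<longrightarrow> i \<noteq> j \<longrightarrow> i \<noteq> j' \<longrightarrow> j \<noteq> j' \<longrightarrow>
     expectation (\<lambda>\<omega>. exp (\<theta> * sqrt (ln (real N) / real N) * (S (\<eta> * scl N) K i j \<omega> + S (\<eta> * scl N) K i j' \<omega>)))
        \<le> exp (real (card K) * (\<theta>\<^sup>2 * (ln (real N) / real N) + 1 / real N))) sequentially"
  using mgf_eventually[OF assms mult_nonneg_nonneg[OF _ B_nonneg], of 8 2, simplified] eventually_ge_at_top[of 2]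
proof eventually_elim
  case (elim N)
  show ?case
  proof (intro allI impI, goal_cases)
  case (1 K i j j')
  define \<tau> where "\<tau> = \<eta> * scl N"
  define V where "V k \<omega> = trunc \<tau> (Z k i j \<omega>) + trunc \<tau> (Z k i j' \<omega>)" for k \<omega>
  define E where "E k = expectation (\<lambda>\<omega>. exp (\<theta> * sqrt (ln (real N) / real N) * V k \<omega>))" for k
  have \<tau>: "0 < \<tau>" using elim(2) scl_pos assms by (simp add: \<tau>_def)
  have bd: "\<bar>V k \<omega>\<bar> \<le> 2 * \<tau>" for k \<omega>
    using abs_trunc(1)[of \<tau> "Z k i j \<omega>"] abs_trunc(1)[of \<tau> "Z k i j' \<omega>"] \<tau> unfolding V_def by linarith
  have E: "exp (\<theta>\<^sup>2 * (ln (real N) / real N) - 1 / real N) \<le> E k \<and>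
      E k \<le> exp (\<theta>\<^sup>2 * (ln (real N) / real N) + 1 / real N)" if "k \<in> K" for k
  proof -
    have k: "1 \<le> k" using that 1 by auto
    have i: "1 \<le> i" "1 \<le> j" "i \<noteq> j" "1 \<le> j'" "i \<noteq> j'" "j \<noteq> j'" using 1 by auto
    note mZ = Z_measurable[OF k i(1,2)] Z_measurable[OF k i(1,4)]
    have mt: "V k \<in> borel_measurable M"
      unfolding V_def by (intro borel_measurable_add measurable_compose[OF mZ(1) trunc_measurable] measurable_compose[OF mZ(2) trunc_measurable])
    note m = trunc_pair_moments[OF mZ(1) Z_moments[OF k i(1,2,3)] mZ(2) Z_moments[OF k i(1,4,5)]
        Z_cross[OF k i(1,2,4,3,5,6)] \<tau>, folded V_def]
    show ?thesis
      using elim(1)[rule_format, OF mt] m bd unfolding E_def \<tau>_def[symmetric] by simp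
  qed
  have "expectation (\<lambda>\<omega>. exp (\<theta> * sqrt (ln (real N) / real N) * (\<Sum>k\<in>K. V k \<omega>))) = prod E K"
    unfolding E_def using 1 bd by (intro mgf_sum indep_trunc(2)[of K i j j' \<tau>, folded V_def]) auto
  then show ?case using prod_exp_bounds[of K, OF E[THEN conjunct1] E[THEN conjunct2]] unfolding \<tau>_def[symmetric] by (simp add: S_def V_def sum.distrib)
qed
qed

text \<open>\<theta> stays free: for \<open>N\<close> rows the best choice is \<theta> = x, whereas
  short increments profit from a much larger \<theta>, because their quadratic term carries the
  small factor \<open>card K / N\<close>.\<close>

lemma S_tail:
  assumes "0 < \<eta>" "0 \<le> \<theta>" "\<theta> * \<eta> \<le> 1/8"
  shows "eventually (\<lambda>N. \<forall>K i j x. finite K \<longrightarrow> K \<subseteq> {1..} \<longrightarrow> 1 \<le> i \<longrightarrow> 1 \<le> j \<longrightarrow> i \<noteq> j \<longrightarrow>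
     prob {\<omega>\<in>space M. x * scl N \<le> \<bar>S (\<eta> * scl N) K i j \<omega>\<bar>}
       \<le> 2 * exp (real (card K) / real N * (\<theta>\<^sup>2/2 * ln (real N) + 1) - \<theta> * x * ln (real N))) sequentially"
proof -
  have t: "\<bar>\<theta>\<bar> * \<eta> \<le> 1/8" "\<bar>- \<theta>\<bar> * \<eta> \<le> 1/8" using assms by simp_all
  show ?thesis
    using S_mgf[OF assms(1) t(1)] S_mgf[OF assms(1) t(2)] eventually_ge_at_top[of 2]
  proof eventually_elim
  case (elim N)
  show ?case
  proof (intro allI impI, goal_cases)
  case (1 K i j x)
    define T where "T = S (\<eta> * scl N) K i j"
    define l where "l = \<theta> * sqrt (ln (real N) / real N)"
    define r where "r = exp (real (card K) * (\<theta>\<^sup>2/2 * (ln (real N) / real N) + 1 / real N))"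
    have [measurable]: "T \<in> borel_measurable M" using 1 by (auto simp: T_def intro!: S_measurable)
    have bd: "\<bar>T \<omega>\<bar> \<le> real (card K) * (\<eta> * scl N)" for \<omega>
      unfolding T_def using assms by (intro S_bounded) auto
    have l0: "0 \<le> l" using assms elim by (simp add: l_def)
    have lx: "- l * (x * scl N) = - \<theta> * x * ln (real N)"
      using sqrt_mult_scl[of N] elim(3) unfolding l_def by (simp add: mult_ac)
    have e: "expectation (\<lambda>\<omega>. exp (l * T \<omega>)) \<le> r" "expectation (\<lambda>\<omega>. exp (l * - T \<omega>)) \<le> r"
      using elim(1)[rule_format, of K i j] elim(2)[rule_format, of K i j] 1 unfolding l_def r_def T_def by simp_all
    have i: "integrable M (\<lambda>\<omega>. exp (l * T \<omega>))" "integrable M (\<lambda>\<omega>. exp (l * - T \<omega>))"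
      using integrable_exp_bounded[of T _ l, OF _ bd] integrable_exp_bounded[of T _ "-l", OF _ bd] by simp_all
    have "prob {\<omega>\<in>space M. x * scl N \<le> \<bar>T \<omega>\<bar>}
      \<le> prob ({\<omega>\<in>space M. x * scl N \<le> T \<omega>} \<union> {\<omega>\<in>space M. x * scl N \<le> - T \<omega>})"
      by (intro finite_measure_mono) auto
    also have "\<dots> \<le> prob {\<omega>\<in>space M. x * scl N \<le> T \<omega>} + prob {\<omega>\<in>space M. x * scl N \<le> - T \<omega>}"
      by (intro measure_Un_le) auto
    also have "\<dots> \<le> exp (- l * (x * scl N)) * r + exp (- l * (x * scl N)) * r"
      using chernoff[OF i(1) _ l0, of "x * scl N"] chernoff[OF i(2) _ l0, of "x * scl N"] e
      by (intro add_mono) (auto elim!: order_trans intro!: mult_left_mono)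
    also have "\<dots> = 2 * exp (real (card K) / real N * (\<theta>\<^sup>2/2 * ln (real N) + 1) - \<theta> * x * ln (real N))"
      unfolding lx r_def by (simp add: exp_add[symmetric] add_divide_distrib distrib_left)
    finally show ?case unfolding T_def .
  qed
qed
qed

text \<open>If both sums exceed the level, their sum exceeds twice the level. At \<theta> = x the
  bound is \<open>exp 1 * N powr (- x^2)\<close>, the order of the product of two separate Chernoff
  bounds: sharing a column costs no power of \<open>N\<close>.\<close>

lemma S_joint_tail:
  assumes "0 < \<eta>" "0 \<le> \<theta>" "\<theta> * \<eta> \<le> 1/8"
  shows "eventually (\<lambda>N. \<forall>i j j' x. 1 \<le> i \<longrightarrow> 1 \<le> j \<longrightarrow> 1 \<le> j' \<longrightarrow> i \<noteq> j \<longrightarrow> i \<noteq> j' \<longrightarrow> j \<noteq> j' \<longrightarrow>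
     prob {\<omega>\<in>space M. x * scl N \<le> S (\<eta> * scl N) {1..N} i j \<omega> \<and> x * scl N \<le> S (\<eta> * scl N) {1..N} i j' \<omega>}
       \<le> exp (\<theta>\<^sup>2 * ln (real N) + 1 - 2 * \<theta> * x * ln (real N))) sequentially"
proof -
  have t: "\<bar>\<theta>\<bar> * \<eta> \<le> 1/8" using assms by simp
  show ?thesis
    using S_pair_mgf[OF assms(1) t] eventually_ge_at_top[of 2]
  proof eventually_elim
  case (elim N)
  show ?case
  proof (intro allI impI, goal_cases)
  case (1 i j j' x)
    define T where "T j = S (\<eta> * scl N) {1..N} i j" for j
    define l where "l = \<theta> * sqrt (ln (real N) / real N)"
    define r where "r = exp (\<theta>\<^sup>2 * ln (real N) + 1)"
    have [measurable]: "T j \<in> borel_measurable M" "T j' \<in> borel_measurable M"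
      using 1 by (auto simp: T_def intro!: S_measurable)
    have bd: "\<bar>T j \<omega> + T j' \<omega>\<bar> \<le> 2 * (real N * (\<eta> * scl N))" for \<omega>
      using S_bounded[of "\<eta> * scl N" "{1..N}" i j \<omega>] S_bounded[of "\<eta> * scl N" "{1..N}" i j' \<omega>] assms
      unfolding T_def by (simp add: abs_le_iff)
    have l0: "0 \<le> l" using assms elim by (simp add: l_def)
    have lx: "- l * (2 * (x * scl N)) = - 2 * \<theta> * x * ln (real N)"
      using sqrt_mult_scl[of N] elim(2) unfolding l_def by (simp add: mult_ac)
    have "expectation (\<lambda>\<omega>. exp (l * (T j \<omega> + T j' \<omega>)))
       \<le> exp (real (card {1..N}) * (\<theta>\<^sup>2 * (ln (real N) / real N) + 1 / real N))"
      unfolding l_def T_def by (rule elim(1)[rule_format, of "{1..N}"]) (use 1 in auto)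
    also have "\<dots> = r" using elim(2) by (simp add: r_def field_simps)
    finally have e: "expectation (\<lambda>\<omega>. exp (l * (T j \<omega> + T j' \<omega>))) \<le> r" .
    have i: "integrable M (\<lambda>\<omega>. exp (l * (T j \<omega> + T j' \<omega>)))"
      using integrable_exp_bounded[of "\<lambda>\<omega>. T j \<omega> + T j' \<omega>" _ l, OF _ bd] by simp
    have "prob {\<omega>\<in>space M. x * scl N \<le> T j \<omega> \<and> x * scl N \<le> T j' \<omega>}
      \<le> prob {\<omega>\<in>space M. 2 * (x * scl N) \<le> T j \<omega> + T j' \<omega>}"
      by (intro finite_measure_mono) auto
    also have "\<dots> \<le> exp (- l * (2 * (x * scl N))) * r"
      using chernoff[OF i _ l0, of "2 * (x * scl N)"] e
      by (auto elim!: order_trans intro!: mult_left_mono)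
    also have "\<dots> = exp (\<theta>\<^sup>2 * ln (real N) + 1 - 2 * \<theta> * x * ln (real N))"
      unfolding lx r_def by (simp add: exp_add[symmetric])
    finally show ?case unfolding T_def .
  qed
qed
qed

text \<open>Tilting is applied to \<open>sqrt (ln N / N) * S\<close> with \<open>u = ln N\<close>.
  It uses the moment generating function at \<theta> and at
  \<open>\<theta> \<plusminus> \<epsilon>\<close>, whence the condition on
  \<open>(\<theta> + \<epsilon>) * \<eta>\<close>.\<close>

lemma S_lower:
  assumes "0 < \<eta>" "0 \<le> \<theta>" "0 < \<epsilon>" "(\<theta> + \<epsilon>) * \<eta> \<le> 1/8"
  shows "eventually (\<lambda>N. \<forall>i j. 1 \<le> i \<longrightarrow> 1 \<le> j \<longrightarrow> i \<noteq> j \<longrightarrow>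
     exp (- 1) / 2 * exp (- (\<theta>\<^sup>2/2 + \<theta> * \<epsilon>) * ln (real N))
     \<le> prob {\<omega>\<in>space M. (\<theta> - \<epsilon>) * scl N \<le> S (\<eta> * scl N) {1..N} i j \<omega>}) sequentially"
proof -
  have ev: "eventually (\<lambda>N. 4 * exp (2 - \<epsilon>\<^sup>2/2 * ln (real N)) \<le> 1) sequentially"
    using \<open>0 < \<epsilon>\<close> by real_asymp
  have t: "\<bar>\<theta>\<bar> * \<eta> \<le> 1/8" "\<bar>\<theta> + \<epsilon>\<bar> * \<eta> \<le> 1/8" "\<bar>\<theta> - \<epsilon>\<bar> * \<eta> \<le> 1/8"
  proof -
    have *: "\<bar>\<theta>\<bar> \<le> \<theta> + \<epsilon>" "\<bar>\<theta> + \<epsilon>\<bar> \<le> \<theta> + \<epsilon>" "\<bar>\<theta> - \<epsilon>\<bar> \<le> \<theta> + \<epsilon>" using assms by auto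
    show "\<bar>\<theta>\<bar> * \<eta> \<le> 1/8" "\<bar>\<theta> + \<epsilon>\<bar> * \<eta> \<le> 1/8" "\<bar>\<theta> - \<epsilon>\<bar> * \<eta> \<le> 1/8"
      using *[THEN mult_right_mono, of \<eta>] assms by linarith+
  qed
  show ?thesis
    using ev eventually_ge_at_top[of 2] S_mgf[OF assms(1) t(1)] S_mgf[OF assms(1) t(2)] S_mgf[OF assms(1) t(3)]
  proof eventually_elim
  case (elim N)
  show ?case
  proof (intro allI impI, goal_cases)
  case (1 i j)
    define s where "s = sqrt (ln (real N) / real N)"
    define T where "T \<omega> = s * S (\<eta> * scl N) {1..N} i j \<omega>" for \<omega>
    have s: "0 < s" using elim(2) by (simp add: s_def)
    have m: "T \<in> borel_measurable M"
      unfolding T_def using 1 by (intro borel_measurable_times S_measurable) auto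
    have bd: "\<bar>T \<omega>\<bar> \<le> s * (real N * (\<eta> * scl N))" for \<omega>
      using S_bounded[of "\<eta> * scl N" "{1..N}" i j \<omega>] assms s unfolding T_def by (simp add: abs_mult)
    have c: "real (card {1..N}) * (a * (ln (real N) / real N) + 1 / real N) = a * ln (real N) + 1"
      "real (card {1..N}) * (a * (ln (real N) / real N) - 1 / real N) = a * ln (real N) - 1" for a
      using elim(2) by (auto simp: field_simps)
    note e = elim(3)[rule_format, of "{1..N}" i j, unfolded c] elim(4)[rule_format, of "{1..N}" i j, unfolded c]
      elim(5)[rule_format, of "{1..N}" i j, unfolded c]
    have bound: "exp (- 1) / 2 * exp (- (\<theta>\<^sup>2/2 + \<theta> * \<epsilon>) * ln (real N)) \<le> prob {\<omega>\<in>space M. (\<theta> - \<epsilon>) * ln (real N) \<le> T \<omega>}"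
      using e 1 elim assms by (intro tilting_lower_bound[OF m bd]) (auto simp: T_def s_def mult.assoc)
    have iff: "(\<theta> - \<epsilon>) * ln (real N) \<le> T \<omega> \<longleftrightarrow> (\<theta> - \<epsilon>) * scl N \<le> S (\<eta> * scl N) {1..N} i j \<omega>" for \<omega>
    proof -
      have eq: "(\<theta> - \<epsilon>) * ln (real N) = s * ((\<theta> - \<epsilon>) * scl N)"
        using sqrt_mult_scl[of N] elim(2) unfolding s_def by (simp add: mult_ac)
      show ?thesis unfolding T_def eq using s by (simp only: mult_le_cancel_left_pos)
    qed
    show ?case using bound unfolding iff .
  qed
qed
qed

end

section \<open>Existence of a large pair by the second moment method\<close>

context iid_array_std
begin

lemma S_disjoint_indep:
  assumes "K \<subseteq> {1..}" "1 \<le> i" "1 \<le> j" "1 \<le> i'" "1 \<le> j'" "{i, j} \<inter> {i', j'} = {}"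
  shows "prob ({\<omega>\<in>space M. x \<le> S \<tau> K i j \<omega>} \<inter> {\<omega>\<in>space M. x \<le> S \<tau> K i' j' \<omega>})
    = prob {\<omega>\<in>space M. x \<le> S \<tau> K i j \<omega>} * prob {\<omega>\<in>space M. x \<le> S \<tau> K i' j' \<omega>}"
proof -
  define F where "F a b y = (\<Sum>k\<in>K. trunc \<tau> (y (k, a) * y (k, b)))" for a b and y :: "nat \<times> nat \<Rightarrow> real"
  have mF: "F a b \<in> borel_measurable (PiM (K \<times> {a, b}) (\<lambda>_. borel))" for a b
    unfolding F_def by measurable
  have "indep_var borel (F i j \<circ> (\<lambda>\<omega>. restrict (\<lambda>p. (case p of (k, i) \<Rightarrow> X k i) \<omega>) (K \<times> {i, j})))
      borel (F i' j' \<circ> (\<lambda>\<omega>. restrict (\<lambda>p. (case p of (k, i) \<Rightarrow> X k i) \<omega>) (K \<times> {i', j'})))"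
    by (rule indep_var_compose[OF indep_var_restrict[OF indep] mF mF]) (use assms in auto)
  moreover have "F a b \<circ> (\<lambda>\<omega>. restrict (\<lambda>p. (case p of (k, i) \<Rightarrow> X k i) \<omega>) (K \<times> {a, b})) = S \<tau> K a b" for a b
    by (simp add: fun_eq_iff F_def S_def Z_def)
  ultimately have "indep_var borel (S \<tau> K i j) borel (S \<tau> K i' j')" by simp
  from prob_indep_random_variable[OF this, of "{x..}" "{x..}"] show ?thesis
    by (simp add: Int_def conj_ac)
qed

text \<open>Taking one column from each of two disjoint ranges gives \<open>m^2\<close> pairs, and
  two distinct pairs share a column in the same position or not at all. The reciprocal of the
  expected number of large pairs is O(\<open>N powr (- 2 * \<epsilon>)\<close>) and produces the
  first term of \<open>K\<close>. Coincidences through a shared column contribute, relative to the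
  squared mean, O(\<open>N powr (8 * \<epsilon> - 1)\<close>) and produce the second; \<epsilon> is
  small enough for this to be dominated.\<close>

lemma no_large_pair:
  assumes \<epsilon>: "0 < \<epsilon>" "\<epsilon> \<le> 1/32" and \<eta>: "0 < \<eta>" "\<eta> \<le> 1/16" and "0 < c"
  defines "K \<equiv> 2 * exp 1 / c\<^sup>2 + 8 * exp 3 / c"
  shows "eventually (\<lambda>N. \<forall>m\<ge>1. c * real N \<le> real m \<longrightarrow>
    prob (space M - (\<Union>(i, j)\<in>{1..m} \<times> {m+1..2*m}. {\<omega>\<in>space M. (2 - 3 * \<epsilon>) * scl N \<le> S (\<eta> * scl N) {1..N} i j \<omega>}))
      \<le> K * exp (- 2 * \<epsilon> * ln (real N))) sequentially"
proof -
  have th1: "(2 - 2 * \<epsilon> + \<epsilon>) * \<eta> \<le> 1/8" "(2 - 3 * \<epsilon>) * \<eta> \<le> 1/8"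
  proof -
    have "(2 - 2 * \<epsilon> + \<epsilon>) * \<eta> \<le> 2 * \<eta>" "(2 - 3 * \<epsilon>) * \<eta> \<le> 2 * \<eta>" using assms by (auto intro!: mult_right_mono)
    then show "(2 - 2 * \<epsilon> + \<epsilon>) * \<eta> \<le> 1/8" "(2 - 3 * \<epsilon>) * \<eta> \<le> 1/8" using \<eta> by linarith+
  qed
  have th2: "0 \<le> 2 - 2 * \<epsilon>" "0 \<le> 2 - 3 * \<epsilon>" using \<epsilon> by auto
  show ?thesis
    using S_lower[OF \<eta>(1) th2(1) \<epsilon>(1) th1(1)] S_joint_tail[OF \<eta>(1) th2(2) th1(2)] eventually_ge_at_top[of 2]
  proof eventually_elim
    case (elim N)
    show ?case
    proof (intro allI impI)
      fix m :: nat assume m: "1 \<le> m" "c * real N \<le> real m"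
      define u where "u = ln (real N)"
      define x where "x = 2 - 3 * \<epsilon>"
      define A where "A t = {\<omega>\<in>space M. x * scl N \<le> S (\<eta> * scl N) {1..N} (fst t) (snd t) \<omega>}" for t
      define T where "T = {1..m} \<times> {m+1..2*m}"
      define q where "q = exp (- 1) / 2 * exp (- (2 - 2 * \<epsilon>) * u)"
      define J where "J = exp (1 - (4 - 12 * \<epsilon>) * u)"
      define P0 where "P0 = prob (space M - (\<Union>t\<in>T. A t))"
      define E where "E = (\<Sum>t\<in>T. prob (A t))"
      have u0: "0 \<le> u" using elim(3) by (simp add: u_def)
      have eN: "real N = exp u" using elim(3) by (simp add: u_def)
      have mA[measurable]: "A t \<in> events" if "t \<in> T" for t
        unfolding A_def using that S_measurable[of "{1..N}" "fst t" "snd t" "\<eta> * scl N"] by (auto simp: T_def)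
      have pA: "q \<le> prob (A t)" if "t \<in> T" for t
      proof -
        have "q \<le> exp (- 1) / 2 * exp (- ((2 - 2 * \<epsilon>)\<^sup>2/2 + (2 - 2 * \<epsilon>) * \<epsilon>) * ln (real N))"
        proof -
          \<comment> \<open>Tilting at \<open>2 - 2 * \<epsilon>\<close> brings the exponent of one
            pair below 2, so that of the order of \<open>N^2\<close> pairs contain many large ones
            on average.\<close>
          have "(2 - 2 * \<epsilon>)\<^sup>2/2 + (2 - 2 * \<epsilon>) * \<epsilon> = 2 - 2 * \<epsilon>" by (simp add: power2_eq_square field_simps)
          then show ?thesis by (simp add: q_def u_def)
        qed
        also have "\<dots> \<le> prob {\<omega>\<in>space M. (2 - 2 * \<epsilon> - \<epsilon>) * scl N \<le> S (\<eta> * scl N) {1..N} (fst t) (snd t) \<omega>}"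
          using that by (intro elim(1)[rule_format]) (auto simp: T_def)
        also have "2 - 2 * \<epsilon> - \<epsilon> = x" by (simp add: x_def)
        finally show ?thesis by (simp add: A_def)
      qed
      have pJ: "prob (A (i, j) \<inter> A (i, j')) \<le> J" "prob (A (j, i) \<inter> A (j', i)) \<le> J"
        if "1 \<le> i" "1 \<le> j" "1 \<le> j'" "i \<noteq> j" "i \<noteq> j'" "j \<noteq> j'" for i j j'
      proof -
        have "prob {\<omega>\<in>space M. x * scl N \<le> S (\<eta> * scl N) {1..N} i j \<omega> \<and> x * scl N \<le> S (\<eta> * scl N) {1..N} i j' \<omega>}
          \<le> exp (x\<^sup>2 * ln (real N) + 1 - 2 * x * x * ln (real N))"
          unfolding x_def using that by (intro elim(2)[rule_format]) auto
        also have "\<dots> \<le> J"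
        proof -
          \<comment> \<open>Chernoff at \<theta> = x leaves the exponent \<open>- x^2\<close>, and
            \<open>(2 - 3 * \<epsilon>)^2 \<ge> 4 - 12 * \<epsilon>\<close>.\<close>
          have "(4 - 12 * \<epsilon>) * u \<le> x\<^sup>2 * u" using u0 by (intro mult_right_mono) (auto simp: x_def power2_eq_square algebra_simps)
          then show ?thesis unfolding J_def u_def[symmetric] by (simp add: power2_eq_square mult_ac)
        qed
        finally have 1: "prob {\<omega>\<in>space M. x * scl N \<le> S (\<eta> * scl N) {1..N} i j \<omega> \<and> x * scl N \<le> S (\<eta> * scl N) {1..N} i j' \<omega>} \<le> J" .
        have 2: "A (i, j) \<inter> A (i, j') = {\<omega>\<in>space M. x * scl N \<le> S (\<eta> * scl N) {1..N} i j \<omega> \<and> x * scl N \<le> S (\<eta> * scl N) {1..N} i j' \<omega>}"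
          by (auto simp: A_def)
        have 3: "A (j, i) = A (i, j)" "A (j', i) = A (i, j')" by (auto simp: A_def S_commute[of _ _ i])
        show "prob (A (i, j) \<inter> A (i, j')) \<le> J" "prob (A (j, i) \<inter> A (j', i)) \<le> J" unfolding 3 2 using 1 by auto
      qed
      have J0: "0 \<le> J" by (simp add: J_def)
      have var: "(\<Sum>t'\<in>T. prob (A t \<inter> A t') - prob (A t) * prob (A t')) \<le> prob (A t) + 2 * real m * J" if t: "t \<in> T" for t
      proof -
        obtain i j where ij: "t = (i, j)" "1 \<le> i" "i \<le> m" "m + 1 \<le> j" "j \<le> 2 * m" using t by (auto simp: T_def)
        \<comment> \<open>Covariances vanish for disjoint pairs. The others are bounded by joint
          probabilities: the pair itself, and at most \<open>m\<close> pairs for each of its two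
          columns.\<close>
        have "(\<Sum>t'\<in>T. prob (A t \<inter> A t') - prob (A t) * prob (A t'))
          \<le> (\<Sum>t'\<in>T. (if t' = t then prob (A t) else 0) + ((if fst t' = i then J else 0) + (if snd t' = j then J else 0)))"
        proof (rule sum_mono)
          fix t' assume t': "t' \<in> T"
          obtain i' j' where ij': "t' = (i', j')" "1 \<le> i'" "i' \<le> m" "m + 1 \<le> j'" "j' \<le> 2 * m" using t' by (auto simp: T_def)
          have nn: "0 \<le> prob (A t) * prob (A t')" by simp
          consider "t' = t" | "i' = i" "j' \<noteq> j" | "i' \<noteq> i" "j' = j" | "i' \<noteq> i" "j' \<noteq> j" using ij ij' by auto
          then show "prob (A t \<inter> A t') - prob (A t) * prob (A t')
            \<le> (if t' = t then prob (A t) else 0) + ((if fst t' = i then J else 0) + (if snd t' = j then J else 0))"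
          proof cases
            case 1
            have "prob (A t \<inter> A t') - prob (A t) * prob (A t') \<le> prob (A t)" using nn 1 by simp
            then show ?thesis by (rule order_trans) (use J0 1 in auto)
          next
            case 2
            then have "prob (A t \<inter> A t') \<le> J" using ij ij' pJ(1)[of i j j'] by auto
            then have "prob (A t \<inter> A t') - prob (A t) * prob (A t') \<le> J" using nn by linarith
            then show ?thesis using 2 by (simp add: ij ij')
          next
            case 3
            then have "prob (A t \<inter> A t') \<le> J" using ij ij' pJ(2)[of j i i'] by auto
            then have "prob (A t \<inter> A t') - prob (A t) * prob (A t') \<le> J" using nn by linarith
            then show ?thesis using 3 by (simp add: ij ij')
          next
            case 4
            have "prob (A t \<inter> A t') = prob (A t) * prob (A t')"
              unfolding A_def using ij ij' 4 by (intro S_disjoint_indep) auto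
            then show ?thesis using 4 by (simp add: ij ij')
          qed
        qed
        also have "\<dots> = (\<Sum>t'\<in>T. if t' = t then prob (A t) else 0)
            + ((\<Sum>t'\<in>T. if fst t' = i then J else 0) + (\<Sum>t'\<in>T. if snd t' = j then J else 0))"
          by (simp add: sum.distrib)
        also have "(\<Sum>t'\<in>T. if t' = t then prob (A t) else 0) = prob (A t)"
          using t by (simp add: T_def)
        also have "(\<Sum>t'\<in>T. if fst t' = i then J else 0) = (\<Sum>i'\<in>{1..m}. \<Sum>j'\<in>{m+1..2*m}. if i' = i then J else 0)"
          unfolding T_def by (subst sum.cartesian_product) (auto intro!: sum.cong)
        also have "\<dots> = (\<Sum>i'\<in>{1..m}. if i' = i then real m * J else 0)" by (intro sum.cong) auto
        also have "\<dots> = real m * J" using ij by simp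
        also have "(\<Sum>t'\<in>T. if snd t' = j then J else 0) = (\<Sum>i'\<in>{1..m}. \<Sum>j'\<in>{m+1..2*m}. if j' = j then J else 0)"
          unfolding T_def by (subst sum.cartesian_product) (auto intro!: sum.cong)
        also have "\<dots> = real m * J" using ij by simp
        finally show ?thesis by (simp add: mult_ac)
      qed
      have "P0 * E\<^sup>2 \<le> (\<Sum>t\<in>T. \<Sum>t'\<in>T. prob (A t \<inter> A t') - prob (A t) * prob (A t'))"
        unfolding P0_def E_def by (intro second_moment_method mA) (auto simp: T_def)
      also have "\<dots> \<le> (\<Sum>t\<in>T. prob (A t) + 2 * real m * J)" by (intro sum_mono var)
      also have "\<dots> = E + real m^2 * (2 * real m * J)"
        by (simp add: sum.distrib E_def T_def power2_eq_square)
      finally have main: "P0 * E\<^sup>2 \<le> E + real m^2 * (2 * real m * J)" .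
      have q0: "0 < q" by (simp add: q_def)
      have iq: "1 / q = 2 * exp 1 * exp ((2 - 2 * \<epsilon>) * u)" 
      proof -
        have "(2 * exp 1 * exp ((2 - 2 * \<epsilon>) * u)) * q = (exp 1 * exp (- 1)) * (exp ((2 - 2 * \<epsilon>) * u) * exp (- (2 - 2 * \<epsilon>) * u))"
          by (simp add: q_def)
        also have "\<dots> = 1" by (simp only: exp_add[symmetric]) (simp add: algebra_simps)
        finally show ?thesis using q0 by (intro divide_eq_eq[THEN iffD2]) auto
      qed
      have iN: "1 / real N = exp (- u)" unfolding eN by (simp add: exp_minus field_simps)
      have Eq: "real m^2 * q \<le> E"
      proof -
        have "real (card T) * q \<le> E" unfolding E_def using pA by (intro sum_bounded_below) auto
        then show ?thesis by (simp add: T_def power2_eq_square)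
      qed
      have mq: "0 < real m^2 * q" using m q0 by simp
      have m0: "0 < real m" using m(1) by simp
      have E0: "0 < E" using mq Eq by linarith
      have "P0 \<le> (E + real m^2 * (2 * real m * J)) / E\<^sup>2" using main Eq mq by (simp add: field_simps)
      also have "\<dots> = 1 / E + real m^2 * (2 * real m * J) / E\<^sup>2" using Eq mq by (simp add: field_simps power2_eq_square)
      also have "\<dots> \<le> 1 / (real m^2 * q) + real m^2 * (2 * real m * J) / (real m^2 * q)\<^sup>2"
        using Eq mq J0 m0 q0 mult_pos_pos[OF E0 mq] mult_pos_pos[OF zero_less_power[OF E0] zero_less_power[OF mq]]
        by (intro add_mono divide_left_mono power_mono) (auto simp: mult_nonneg_nonneg)
      also have "real m^2 * (2 * real m * J) / (real m^2 * q)\<^sup>2 = 2 * J / (real m * q\<^sup>2)"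
        using m q0 by (simp add: field_simps power2_eq_square)
      also have "1 / (real m^2 * q) \<le> 1 / ((c * real N)^2 * q)"
        using m q0 assms elim(3) by (intro divide_left_mono mult_right_mono power_mono) auto
      also have "2 * J / (real m * q\<^sup>2) \<le> 2 * J / (c * real N * q\<^sup>2)"
        using m q0 assms elim(3) J0 by (intro divide_left_mono mult_right_mono) auto
      also have "1 / ((c * real N)^2 * q) = 2 * exp 1 / c\<^sup>2 * exp (- 2 * \<epsilon> * u)"
      proof -
        have "1 / ((c * real N)^2 * q) = 1 / c\<^sup>2 * ((1 / real N) * (1 / real N)) * (1 / q)" by (simp add: power2_eq_square)
        also have "\<dots> = 2 * exp 1 / c\<^sup>2 * (exp (- u) * exp (- u) * exp ((2 - 2 * \<epsilon>) * u))" unfolding iq iN by simp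
        also have "exp (- u) * exp (- u) * exp ((2 - 2 * \<epsilon>) * u) = exp (- 2 * \<epsilon> * u)"
          by (simp add: exp_add[symmetric] algebra_simps)
        finally show ?thesis .
      qed
      also have "2 * J / (c * real N * q\<^sup>2) = 8 * exp 3 / c * exp (- (1 - 8 * \<epsilon>) * u)"
      proof -
        have "2 * J / (c * real N * q\<^sup>2) = 2 / c * J * (1 / real N) * ((1 / q) * (1 / q))" by (simp add: power2_eq_square)
        also have "\<dots> = 8 / c * (J * exp (- u) * (exp 1 * exp 1 * (exp ((2 - 2 * \<epsilon>) * u) * exp ((2 - 2 * \<epsilon>) * u))))"
          unfolding iq iN by simp
        also have "J * exp (- u) * (exp 1 * exp 1 * (exp ((2 - 2 * \<epsilon>) * u) * exp ((2 - 2 * \<epsilon>) * u))) = exp 3 * exp (- (1 - 8 * \<epsilon>) * u)"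
          unfolding J_def exp_add[symmetric] by (simp add: algebra_simps)
        finally show ?thesis by simp
      qed
      also have "8 * exp 3 / c * exp (- (1 - 8 * \<epsilon>) * u) \<le> 8 * exp 3 / c * exp (- 2 * \<epsilon> * u)"
      proof (intro mult_left_mono)
        have "2 * \<epsilon> * u \<le> (1 - 8 * \<epsilon>) * u" using \<epsilon> u0 by (intro mult_right_mono) auto
        then show "exp (- (1 - 8 * \<epsilon>) * u) \<le> exp (- 2 * \<epsilon> * u)" by (simp add: algebra_simps)
      qed (use assms in auto)
      finally have "P0 \<le> K * exp (- 2 * \<epsilon> * ln (real N))" by (simp add: K_def u_def distrib_right)
      moreover have "(\<Union>(i, j)\<in>T. {\<omega>\<in>space M. (2 - 3 * \<epsilon>) * scl N \<le> S (\<eta> * scl N) {1..N} i j \<omega>}) = (\<Union>t\<in>T. A t)"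
        by (auto simp: A_def x_def)
      ultimately show "prob (space M - (\<Union>(i, j)\<in>{1..m} \<times> {m+1..2*m}. {\<omega>\<in>space M. (2 - 3 * \<epsilon>) * scl N \<le> S (\<eta> * scl N) {1..N} i j \<omega>}))
      \<le> K * exp (- 2 * \<epsilon> * ln (real N))" by (simp add: P0_def T_def)
    qed
  qed
qed

end

section \<open>The maximum over a block of sample sizes\<close>

definition pairs :: "nat \<Rightarrow> (nat \<times> nat) set" where
  "pairs m = {(i, j). 1 \<le> i \<and> i < j \<and> j \<le> m}"

lemma finite_pairs [simp]: "finite (pairs m)"
  by (rule finite_subset[of _ "{1..m} \<times> {1..m}"]) (auto simp: pairs_def)

lemma card_pairs_le: "card (pairs m) \<le> m * m"
proof -
  have "card (pairs m) \<le> card ({1..m} \<times> {1..m})" by (intro card_mono) (auto simp: pairs_def)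
  then show ?thesis by simp
qed

section \<open>Large products within one row\<close>

context iid_array
begin

text \<open>\<open>Q n (scl n)\<close> is the general term of the summability condition. Number of
  columns and threshold are separate arguments because each is rescaled independently of the
  other.\<close>

definition Q :: "nat \<Rightarrow> real \<Rightarrow> real" where
  "Q m t = prob (\<Union>(i, j)\<in>pairs m. {\<omega>\<in>space M. t \<le> \<bar>Z 1 i j \<omega>\<bar>})"

lemma Z_event [measurable]: "1 \<le> k \<Longrightarrow> 1 \<le> i \<Longrightarrow> 1 \<le> j \<Longrightarrow> {\<omega>\<in>space M. t \<le> \<bar>Z k i j \<omega>\<bar>} \<in> events"
proof -
  assume "1 \<le> k" "1 \<le> i" "1 \<le> j"
  then have [measurable]: "Z k i j \<in> borel_measurable M" by simp
  show ?thesis by measurable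
qed

lemma row_event: "1 \<le> k \<Longrightarrow> (\<Union>(i, j)\<in>pairs m. {\<omega>\<in>space M. t \<le> \<bar>Z k i j \<omega>\<bar>}) \<in> events"
  by (intro sets.finite_UN finite_pairs) (auto simp: pairs_def intro!: Z_event)

text \<open>An instance of \<open>prob_transfer\<close>: the row and the choice of \<open>m\<close>
  distinct columns do not affect the probability. The case \<open>m = 0\<close> is separate since an
  empty family is excluded there.\<close>

lemma Q_embed:
  assumes "1 \<le> k" "inj_on e {1..m}" "e ` {1..m} \<subseteq> {1..}"
  shows "prob (\<Union>(i, j)\<in>pairs m. {\<omega>\<in>space M. t \<le> \<bar>Z k (e i) (e j) \<omega>\<bar>}) = Q m t"
proof (cases "m = 0")
  case True
  then have "pairs m = {}" by (auto simp: pairs_def)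
  then show ?thesis by (simp add: Q_def)
next
  case False
  define P where "P x = (\<exists>p\<in>pairs m. t \<le> \<bar>x (fst p) * x (snd p)\<bar>)" for x :: "nat \<Rightarrow> real"
  have P: "Measurable.pred (PiM {1..m} (\<lambda>_. borel)) P"
  proof -
    have "Measurable.pred (PiM {1..m} (\<lambda>_. borel)) (\<lambda>x. t \<le> \<bar>x (fst p) * x (snd p) :: real\<bar>)" if "p \<in> pairs m" for p
    proof -
      have [measurable]: "(\<lambda>x. x (fst p)) \<in> borel_measurable (PiM {1..m} (\<lambda>_. borel :: real measure))"
        "(\<lambda>x. x (snd p)) \<in> borel_measurable (PiM {1..m} (\<lambda>_. borel :: real measure))"
        using that by (auto simp: pairs_def)
      show ?thesis by measurable
    qed
    then show ?thesis unfolding P_def by (intro pred_intros_finite) auto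
  qed
  have P_restrict: "P (\<lambda>i\<in>{1..m}. f i) \<longleftrightarrow> (\<exists>p\<in>pairs m. t \<le> \<bar>f (fst p) * f (snd p)\<bar>)" for f
    unfolding P_def by (intro bex_cong) (auto simp: pairs_def)
  have ev: "(\<Union>(i, j)\<in>pairs m. {\<omega>\<in>space M. t \<le> \<bar>Z k' (h i) (h j) \<omega>\<bar>})
     = {\<omega>\<in>space M. P (\<lambda>i\<in>{1..m}. X (fst (k', h i)) (snd (k', h i)) \<omega>)}" for k' :: nat and h
    unfolding fst_conv snd_conv P_restrict Z_def by (auto simp: split_beta)
  have "inj_on (\<lambda>i. (k, e i)) {1..m}" "(\<lambda>i. (k, e i)) ` {1..m} \<subseteq> {1..} \<times> {1..}"
    "inj_on (\<lambda>i. (1 :: nat, i)) {1..m}" "(\<lambda>i. (1 :: nat, i)) ` {1..m} \<subseteq> {1..} \<times> {1..}" "{1..m} \<noteq> {}"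
    using assms False by (auto intro!: inj_onI dest: inj_onD)
  then have "prob {\<omega>\<in>space M. P (\<lambda>i\<in>{1..m}. X (fst (k, e i)) (snd (k, e i)) \<omega>)}
     = prob {\<omega>\<in>space M. P (\<lambda>i\<in>{1..m}. X (fst (1, i)) (snd (1 :: nat, i)) \<omega>)}"
    using P by (rule prob_transfer)
  then show ?thesis unfolding Q_def ev[of k e] ev[of 1 "\<lambda>i. i"] .
qed

lemma Q_row: "1 \<le> k \<Longrightarrow> prob (\<Union>(i, j)\<in>pairs m. {\<omega>\<in>space M. t \<le> \<bar>Z k i j \<omega>\<bar>}) = Q m t"
  using Q_embed[of k "\<lambda>i. i" m t] by simp

end

context iid_array_std
begin

lemma sum_Z_eq_S:
  assumes "\<And>k. 1 \<le> k \<Longrightarrow> k \<le> n \<Longrightarrow> \<bar>Z k i j \<omega>\<bar> \<le> \<tau>" "N \<le> n"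
  shows "(\<Sum>k=1..n. Z k i j \<omega>) = S \<tau> {1..N} i j \<omega> + S \<tau> {N+1..n} i j \<omega>"
proof -
  have "(\<Sum>k=1..n. Z k i j \<omega>) = (\<Sum>k=1..n. trunc \<tau> (Z k i j \<omega>))"
    using assms by (intro sum.cong) (auto simp: trunc_def)
  also have "\<dots> = (\<Sum>k\<in>{1..N} \<union> {N+1..n}. trunc \<tau> (Z k i j \<omega>))"
    using assms by (intro sum.cong) auto
  also have "\<dots> = S \<tau> {1..N} i j \<omega> + S \<tau> {N+1..n} i j \<omega>"
    unfolding S_def by (rule sum.union_disjoint) auto
  finally show ?thesis .
qed

text \<open>The exceptional event is a union of four: \<open>E1\<close>, some product among the
  first \<open>2 * N\<close> rows is too large to survive truncation; \<open>E2\<close>, a sum over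
  the first \<open>N\<close> rows is too large; \<open>E3\<close>, an increment up to some
  \<open>n\<close> in the block is too large; \<open>E4\<close>, no pair is large. Only
  \<open>E1\<close> depends on the tail of the entries. The parameters \<open>C\<close> and
  \<open>q\<close> enclose the number of columns at every \<open>n\<close> of the block.\<close>

lemma block_event:
  assumes \<epsilon>: "0 < \<epsilon>" "\<epsilon> \<le> 1/32" and C: "2 \<le> C" and q: "1 \<le> q"
  shows "\<exists>K. eventually (\<lambda>N. \<exists>E\<in>events.
     prob E \<le> 2 * real N * Q (C * N) (\<epsilon>/64 * scl N) + K * exp (- 2 * \<epsilon> * ln (real N)) \<and>
     (\<forall>\<omega>\<in>space M - E. \<forall>n. N \<le> n \<longrightarrow> real n \<le> (1 + \<epsilon>\<^sup>2/8) * real N \<longrightarrow>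
       (\<forall>i j. 1 \<le> i \<longrightarrow> i < j \<longrightarrow> j \<le> C * N \<longrightarrow> \<bar>\<Sum>k=1..n. Z k i j \<omega>\<bar> \<le> (2 + 2 * \<epsilon>) * scl N) \<and>
       (\<exists>i j. 1 \<le> i \<and> i < j \<and> j \<le> 2 * (N div q) \<and> (2 - 4 * \<epsilon>) * scl N \<le> \<bar>\<Sum>k=1..n. Z k i j \<omega>\<bar>))) sequentially"
proof -
  \<comment> \<open>The largest Chernoff parameter used is \<open>8 / \<epsilon>\<close>, for
    increments, and its product with \<eta> is then exactly 1/8.\<close>
  define \<eta> where "\<eta> = \<epsilon> / 64"
  \<comment> \<open>\<open>N div q\<close> is at least \<open>N / (2 * q)\<close> once
    \<open>N \<ge> 2 * q\<close>.\<close>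
  define c where "c = 1 / (2 * real q)"
  define K4 where "K4 = 2 * exp 1 / c\<^sup>2 + 8 * exp 3 / c"
  define K where "K = 2 * exp 1 * (real C)\<^sup>2 + 4 * exp 1 * (real C)\<^sup>2 + K4"
  have \<eta>: "0 < \<eta>" "\<eta> \<le> 1/16" using \<epsilon> by (auto simp: \<eta>_def)
  have c: "0 < c" using q by (simp add: c_def)
  have t1: "0 \<le> 2 + \<epsilon>" "(2 + \<epsilon>) * \<eta> \<le> 1/8"
  proof -
    have "(2 + \<epsilon>) * \<eta> \<le> 3 * (1/32/64)" using \<epsilon> by (intro mult_mono) (auto simp: \<eta>_def)
    then show "(2 + \<epsilon>) * \<eta> \<le> 1/8" by simp
  qed (use \<epsilon> in auto)
  have t2: "0 \<le> 8 / \<epsilon>" "8 / \<epsilon> * \<eta> \<le> 1/8" using \<epsilon> by (auto simp: \<eta>_def)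
  show ?thesis
    apply (rule exI[of _ K])
    using S_tail[OF \<eta>(1) t1] S_tail[OF \<eta>(1) t2] no_large_pair[OF \<epsilon> \<eta> c, folded K4_def]
      eventually_ge_at_top[of "2 * q"] eventually_ge_at_top[of 2]
  proof eventually_elim
    case (elim N)
    define u where "u = ln (real N)"
    define m where "m = N div q"
    define \<tau> where "\<tau> = \<eta> * scl N"
    define L where "L = {n\<in>{N..2*N}. real n \<le> (1 + \<epsilon>\<^sup>2/8) * real N}"
    define E1 where "E1 = (\<Union>k\<in>{1..2*N}. \<Union>(i, j)\<in>pairs (C * N). {\<omega>\<in>space M. \<tau> \<le> \<bar>Z k i j \<omega>\<bar>})"
    define E2 where "E2 = (\<Union>p\<in>pairs (C * N). {\<omega>\<in>space M. (2 + \<epsilon>) * scl N \<le> \<bar>S \<tau> {1..N} (fst p) (snd p) \<omega>\<bar>})"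
    define E3 where "E3 = (\<Union>n\<in>L. \<Union>p\<in>pairs (C * N). {\<omega>\<in>space M. \<epsilon> * scl N \<le> \<bar>S \<tau> {N+1..n} (fst p) (snd p) \<omega>\<bar>})"
    define E4 where "E4 = space M - (\<Union>(i, j)\<in>{1..m} \<times> {m+1..2*m}. {\<omega>\<in>space M. (2 - 3 * \<epsilon>) * scl N \<le> S \<tau> {1..N} i j \<omega>})"
    define E where "E = E1 \<union> E2 \<union> E3 \<union> E4"
    have u0: "0 \<le> u" and eN: "real N = exp u" using elim(5) by (auto simp: u_def)
    have "N = q * m + N mod q" by (simp add: m_def)
    then have "real N = real q * real m + real (N mod q)" by (metis of_nat_add of_nat_mult)
    moreover have "real (N mod q) \<le> real q" using q by (simp add: less_imp_le)
    moreover have "2 * real q \<le> real N" using elim(4) by (metis of_nat_le_iff of_nat_mult of_nat_numeral)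
    ultimately have "real N \<le> 2 * (real q * real m)" by linarith
    then have cm: "c * real N \<le> real m" using q by (simp add: c_def field_simps)
    have m1: "1 \<le> m"
    proof -
      have "0 < c * real N" using c elim(5) by simp
      then have "0 < real m" using cm by linarith
      then show ?thesis by simp
    qed
    have m2: "2 * m \<le> C * N"
    proof -
      have "m \<le> N" by (simp add: m_def)
      then show ?thesis using C by (intro mult_mono) auto
    qed
    have absS: "{\<omega>\<in>space M. x \<le> \<bar>S \<tau> K' i j \<omega>\<bar>} \<in> events" "{\<omega>\<in>space M. x \<le> S \<tau> K' i j \<omega>} \<in> events"
      if "K' \<subseteq> {1..}" "1 \<le> i" "1 \<le> j" for K' i j x
    proof -
      have [measurable]: "S \<tau> K' i j \<in> borel_measurable M" using that by simp
      show "{\<omega>\<in>space M. x \<le> \<bar>S \<tau> K' i j \<omega>\<bar>} \<in> events" "{\<omega>\<in>space M. x \<le> S \<tau> K' i j \<omega>} \<in> events" by measurable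
    qed
    have mE1: "E1 \<in> events" unfolding E1_def by (intro sets.finite_UN row_event) auto
    have mE2: "E2 \<in> events" unfolding E2_def by (intro sets.finite_UN finite_pairs absS) (auto simp: pairs_def)
    have mE3': "(\<Union>p\<in>pairs (C * N). {\<omega>\<in>space M. \<epsilon> * scl N \<le> \<bar>S \<tau> {N+1..n} (fst p) (snd p) \<omega>\<bar>}) \<in> events" for n
      by (intro sets.finite_UN finite_pairs absS) (auto simp: pairs_def)
    have fL: "finite L" by (simp add: L_def)
    have mE3: "E3 \<in> events" unfolding E3_def by (rule sets.finite_UN[OF fL mE3'])
    have mE4: "E4 \<in> events" unfolding E4_def by (intro sets.Diff sets.finite_UN sets.top) (auto intro!: absS)
    have mE: "E \<in> events" unfolding E_def using mE1 mE2 mE3 mE4 by auto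
    have cP: "real (card (pairs (C * N))) \<le> (real C)\<^sup>2 * exp (2 * u)"
    proof -
      have "real (card (pairs (C * N))) \<le> real (C * N * (C * N))" using card_pairs_le by (intro of_nat_mono)
      also have "\<dots> = (real C)\<^sup>2 * (exp u * exp u)" using eN by (simp add: power2_eq_square mult_ac)
      also have "exp u * exp u = exp (2 * u)" by (simp add: exp_add[symmetric])
      finally show ?thesis .
    qed
    have p1: "prob E1 \<le> 2 * real N * Q (C * N) (\<epsilon>/64 * scl N)"
    proof -
      have "prob E1 \<le> (\<Sum>k\<in>{1..2*N}. prob (\<Union>(i, j)\<in>pairs (C * N). {\<omega>\<in>space M. \<tau> \<le> \<bar>Z k i j \<omega>\<bar>}))"
        unfolding E1_def by (intro measure_UNION_le row_event) auto
      also have "\<dots> = (\<Sum>k\<in>{1..2*N}. Q (C * N) \<tau>)" by (intro sum.cong refl Q_row) auto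
      finally show ?thesis by (simp add: \<tau>_def \<eta>_def)
    qed
    have p2: "prob E2 \<le> 2 * exp 1 * (real C)\<^sup>2 * exp (- 2 * \<epsilon> * u)"
    proof -
      have "prob E2 \<le> (\<Sum>p\<in>pairs (C * N). prob {\<omega>\<in>space M. (2 + \<epsilon>) * scl N \<le> \<bar>S \<tau> {1..N} (fst p) (snd p) \<omega>\<bar>})"
        unfolding E2_def by (intro measure_UNION_le finite_pairs absS) (auto simp: pairs_def)
      \<comment> \<open>Since \<open>(2 + \<epsilon>)^2/2 \<ge> 2 + 2 * \<epsilon>\<close>, the tail
        of one pair beats the order \<open>N^2\<close> of pairs by
        \<open>N powr (- 2 * \<epsilon>)\<close>.\<close>
      also have "\<dots> \<le> (\<Sum>p\<in>pairs (C * N). 2 * exp (1 - (2 + 2 * \<epsilon>) * u))"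
      proof (rule sum_mono)
        fix p assume p: "p \<in> pairs (C * N)"
        have "prob {\<omega>\<in>space M. (2 + \<epsilon>) * scl N \<le> \<bar>S \<tau> {1..N} (fst p) (snd p) \<omega>\<bar>}
          \<le> 2 * exp (real (card {1..N}) / real N * ((2 + \<epsilon>)\<^sup>2/2 * ln (real N) + 1) - (2 + \<epsilon>) * (2 + \<epsilon>) * ln (real N))"
          unfolding \<tau>_def using p by (intro elim(1)[rule_format]) (auto simp: pairs_def)
        also have "real (card {1..N}) / real N * ((2 + \<epsilon>)\<^sup>2/2 * ln (real N) + 1) - (2 + \<epsilon>) * (2 + \<epsilon>) * ln (real N)
           = 1 - (2 + \<epsilon>)\<^sup>2/2 * u"
          using elim(5) by (simp add: u_def power2_eq_square)
        also have "2 * exp (1 - (2 + \<epsilon>)\<^sup>2/2 * u) \<le> 2 * exp (1 - (2 + 2 * \<epsilon>) * u)"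
        proof -
          have "(2 + 2 * \<epsilon>) * u \<le> (2 + \<epsilon>)\<^sup>2/2 * u" using u0 by (intro mult_right_mono) (auto simp: power2_eq_square algebra_simps)
          then show ?thesis by simp
        qed
        finally show "prob {\<omega>\<in>space M. (2 + \<epsilon>) * scl N \<le> \<bar>S \<tau> {1..N} (fst p) (snd p) \<omega>\<bar>} \<le> 2 * exp (1 - (2 + 2 * \<epsilon>) * u)" .
      qed
      also have "\<dots> = real (card (pairs (C * N))) * (2 * exp (1 - (2 + 2 * \<epsilon>) * u))" by simp
      also have "\<dots> \<le> (real C)\<^sup>2 * exp (2 * u) * (2 * exp (1 - (2 + 2 * \<epsilon>) * u))" using cP by (intro mult_right_mono) auto
      also have "\<dots> = 2 * (real C)\<^sup>2 * (exp (2 * u) * exp (1 - (2 + 2 * \<epsilon>) * u))" by simp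
      also have "exp (2 * u) * exp (1 - (2 + 2 * \<epsilon>) * u) = exp 1 * exp (- 2 * \<epsilon> * u)"
        by (simp add: exp_add[symmetric] algebra_simps)
      finally show ?thesis by (simp add: mult_ac)
    qed
    have p3: "prob E3 \<le> 4 * exp 1 * (real C)\<^sup>2 * exp (- 2 * \<epsilon> * u)"
    proof -
      have e8: "\<epsilon>\<^sup>2/8 \<le> 1"
      proof -
        have "\<epsilon>\<^sup>2 \<le> 1" using \<epsilon> by (intro power_le_one) auto
        then show ?thesis by simp
      qed
      have "prob E3 \<le> (\<Sum>n\<in>L. prob (\<Union>p\<in>pairs (C * N). {\<omega>\<in>space M. \<epsilon> * scl N \<le> \<bar>S \<tau> {N+1..n} (fst p) (snd p) \<omega>\<bar>}))"
        unfolding E3_def using fL mE3' by (intro measure_UNION_le) auto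
      also have "\<dots> \<le> (\<Sum>n\<in>L. \<Sum>p\<in>pairs (C * N). prob {\<omega>\<in>space M. \<epsilon> * scl N \<le> \<bar>S \<tau> {N+1..n} (fst p) (snd p) \<omega>\<bar>})"
        by (intro sum_mono measure_UNION_le finite_pairs absS) (auto simp: pairs_def)
      \<comment> \<open>The fourth power of \<open>1/N\<close> leaves a factor \<open>1/N\<close>
        after summing over the sample sizes, of order \<open>N\<close>, and the pairs, of order
        \<open>N^2\<close>.\<close>
      also have "\<dots> \<le> (\<Sum>n\<in>L. \<Sum>p\<in>pairs (C * N). 2 * exp (1 - 4 * u))"
      proof (intro sum_mono)
        fix n p assume n: "n \<in> L" and p: "p \<in> pairs (C * N)"
        have "real n - real N \<le> \<epsilon>\<^sup>2/8 * real N" using n by (simp add: L_def algebra_simps)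
        then have r: "(real n - real N) / real N \<le> \<epsilon>\<^sup>2/8" using elim(5) by (simp add: field_simps)
        have "prob {\<omega>\<in>space M. \<epsilon> * scl N \<le> \<bar>S \<tau> {N+1..n} (fst p) (snd p) \<omega>\<bar>}
          \<le> 2 * exp (real (card {N+1..n}) / real N * ((8 / \<epsilon>)\<^sup>2/2 * ln (real N) + 1) - 8 / \<epsilon> * \<epsilon> * ln (real N))"
          unfolding \<tau>_def using p by (intro elim(2)[rule_format]) (auto simp: pairs_def)
        also have "real (card {N+1..n}) = real n - real N" using n by (auto simp: L_def of_nat_diff)
        \<comment> \<open>The block ratio \<open>1 + \<epsilon>^2/8\<close> is matched to \<theta> =
          \<open>8 / \<epsilon>\<close>: the quadratic term is at most \<open>4 * u\<close>, half of
          the linear gain \<open>8 * u\<close>.\<close>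
        also have "(real n - real N) / real N * ((8 / \<epsilon>)\<^sup>2/2 * ln (real N) + 1) - 8 / \<epsilon> * \<epsilon> * ln (real N)
          \<le> \<epsilon>\<^sup>2/8 * ((8 / \<epsilon>)\<^sup>2/2 * u + 1) - 8 * u"
          unfolding u_def[symmetric] using r u0 \<epsilon> by (intro diff_mono mult_right_mono) auto
        also have "\<dots> = 4 * u + \<epsilon>\<^sup>2/8 - 8 * u" using \<epsilon> by (simp add: field_simps power2_eq_square)
        also have "\<dots> \<le> 1 - 4 * u" using e8 by simp
        finally show "prob {\<omega>\<in>space M. \<epsilon> * scl N \<le> \<bar>S \<tau> {N+1..n} (fst p) (snd p) \<omega>\<bar>} \<le> 2 * exp (1 - 4 * u)" by simp
      qed
      also have "\<dots> = real (card L) * (real (card (pairs (C * N))) * (2 * exp (1 - 4 * u)))" by simp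
      also have "\<dots> \<le> (2 * exp u) * (((real C)\<^sup>2 * exp (2 * u)) * (2 * exp (1 - 4 * u)))"
      proof (intro mult_mono cP order_refl)
        have "card L \<le> card {N..2*N}" unfolding L_def by (intro card_mono) auto
        also have "\<dots> \<le> 2 * N" using elim(5) by simp
        finally have "real (card L) \<le> real (2 * N)" by (rule of_nat_mono)
        then show "real (card L) \<le> 2 * exp u" by (simp add: eN[symmetric])
      qed auto
      also have "\<dots> = 4 * (real C)\<^sup>2 * (exp u * exp (2 * u) * exp (1 - 4 * u))" by simp
      also have "exp u * exp (2 * u) * exp (1 - 4 * u) = exp 1 * exp (- u)"
        by (simp add: exp_add[symmetric] algebra_simps)
      also have "4 * (real C)\<^sup>2 * (exp 1 * exp (- u)) \<le> 4 * (real C)\<^sup>2 * (exp 1 * exp (- 2 * \<epsilon> * u))"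
      proof (intro mult_left_mono)
        have "2 * \<epsilon> * u \<le> 1 * u" using \<epsilon> u0 by (intro mult_right_mono) auto
        then show "exp (- u) \<le> exp (- 2 * \<epsilon> * u)" by simp
      qed auto
      finally show ?thesis by (simp add: mult_ac)
    qed
    have p4: "prob E4 \<le> K4 * exp (- 2 * \<epsilon> * u)"
      unfolding E4_def \<tau>_def u_def using elim(3) m1 cm by blast
    have "prob E \<le> prob E1 + prob E2 + prob E3 + prob E4"
      unfolding E_def using measure_Un_le[of "E1 \<union> E2 \<union> E3" M E4] measure_Un_le[of "E1 \<union> E2" M E3]
        measure_Un_le[of E1 M E2] mE1 mE2 mE3 mE4 by auto
    then have pE: "prob E \<le> 2 * real N * Q (C * N) (\<epsilon>/64 * scl N) + K * exp (- 2 * \<epsilon> * ln (real N))"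
      using p1 p2 p3 p4 by (simp add: K_def u_def distrib_right)
    have good: "(\<forall>i j. 1 \<le> i \<longrightarrow> i < j \<longrightarrow> j \<le> C * N \<longrightarrow> \<bar>\<Sum>k=1..n. Z k i j \<omega>\<bar> \<le> (2 + 2 * \<epsilon>) * scl N) \<and>
       (\<exists>i j. 1 \<le> i \<and> i < j \<and> j \<le> 2 * (N div q) \<and> (2 - 4 * \<epsilon>) * scl N \<le> \<bar>\<Sum>k=1..n. Z k i j \<omega>\<bar>)"
      if \<omega>: "\<omega> \<in> space M - E" and n: "N \<le> n" "real n \<le> (1 + \<epsilon>\<^sup>2/8) * real N" for \<omega> n
    proof -
      have "\<epsilon>\<^sup>2 \<le> 1" using \<epsilon> by (intro power_le_one) auto
      then have "(1 + \<epsilon>\<^sup>2/8) * real N \<le> 2 * real N" by (intro mult_right_mono) auto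
      then have "real n \<le> real (2 * N)" using n by simp
      then have n2: "n \<le> 2 * N" by (simp only: of_nat_le_iff)
      have nL: "n \<in> L" using n n2 by (simp add: L_def)
      have dec: "(\<Sum>k=1..n. Z k i j \<omega>) = S \<tau> {1..N} i j \<omega> + S \<tau> {N+1..n} i j \<omega>"
        and b2: "\<bar>S \<tau> {1..N} i j \<omega>\<bar> < (2 + \<epsilon>) * scl N"
        and b3: "\<bar>S \<tau> {N+1..n} i j \<omega>\<bar> < \<epsilon> * scl N"
        if ij: "1 \<le> i" "i < j" "j \<le> C * N" for i j
      proof -
        have p: "(i, j) \<in> pairs (C * N)" using ij by (simp add: pairs_def)
        show "(\<Sum>k=1..n. Z k i j \<omega>) = S \<tau> {1..N} i j \<omega> + S \<tau> {N+1..n} i j \<omega>"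
        proof (rule sum_Z_eq_S[OF _ n(1)])
          fix k assume "1 \<le> k" "k \<le> n"
          then have "k \<in> {1..2*N}" using n2 by auto
          moreover have "\<omega> \<in> space M" "\<omega> \<notin> E1" using \<omega> by (auto simp: E_def)
          ultimately have "\<not> \<tau> \<le> \<bar>Z k i j \<omega>\<bar>" using p unfolding E1_def by blast
          then show "\<bar>Z k i j \<omega>\<bar> \<le> \<tau>" by simp
        qed
        have "\<omega> \<in> space M" "\<omega> \<notin> E2" "\<omega> \<notin> E3" using \<omega> by (auto simp: E_def)
        then have "\<not> (2 + \<epsilon>) * scl N \<le> \<bar>S \<tau> {1..N} i j \<omega>\<bar>" "\<not> \<epsilon> * scl N \<le> \<bar>S \<tau> {N+1..n} i j \<omega>\<bar>"
          using p nL unfolding E2_def E3_def by force+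
        then show "\<bar>S \<tau> {1..N} i j \<omega>\<bar> < (2 + \<epsilon>) * scl N" "\<bar>S \<tau> {N+1..n} i j \<omega>\<bar> < \<epsilon> * scl N" by auto
      qed
      have "\<bar>\<Sum>k=1..n. Z k i j \<omega>\<bar> \<le> (2 + 2 * \<epsilon>) * scl N" if ij: "1 \<le> i" "i < j" "j \<le> C * N" for i j
      proof -
        have "\<bar>\<Sum>k=1..n. Z k i j \<omega>\<bar> \<le> (2 + \<epsilon>) * scl N + \<epsilon> * scl N"
          using dec[OF ij] b2[OF ij] b3[OF ij] by linarith
        then show ?thesis by (simp add: algebra_simps)
      qed
      moreover have "\<exists>i j. 1 \<le> i \<and> i < j \<and> j \<le> 2 * (N div q) \<and> (2 - 4 * \<epsilon>) * scl N \<le> \<bar>\<Sum>k=1..n. Z k i j \<omega>\<bar>"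
      proof -
        have "\<omega> \<in> space M" "\<omega> \<notin> E4" using \<omega> by (auto simp: E_def)
        then obtain i j where ij: "i \<in> {1..m}" "j \<in> {m+1..2*m}" "(2 - 3 * \<epsilon>) * scl N \<le> S \<tau> {1..N} i j \<omega>"
          unfolding E4_def by auto
        have ij': "1 \<le> i" "i < j" "j \<le> C * N" using ij m2 by auto
        have "(2 - 3 * \<epsilon>) * scl N - \<epsilon> * scl N \<le> \<bar>\<Sum>k=1..n. Z k i j \<omega>\<bar>"
          using dec[OF ij'] b3[OF ij'] ij(3) by linarith
        then have "(2 - 4 * \<epsilon>) * scl N \<le> \<bar>\<Sum>k=1..n. Z k i j \<omega>\<bar>" by (simp add: algebra_simps)
        then show ?thesis using ij' ij(2) unfolding m_def by auto
      qed
      ultimately show ?thesis by blast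
    qed
    show ?case using mE pE good by blast
  qed
qed

end

section \<open>The summability condition\<close>

text \<open>Every term of the original series is repeated \<open>D\<close> times in a row.\<close>

lemma summable_div:
  fixes f :: "nat \<Rightarrow> real"
  assumes f: "summable f" "\<And>n. 0 \<le> f n" and "1 \<le> D"
  shows "summable (\<lambda>n. f (n div D))"
proof (rule summableI_nonneg_bounded[where x = "real D * suminf f"])
  fix k
  have "(\<Sum>n<k. f (n div D)) \<le> (\<Sum>n<k * D. f (n div D))"
    using assms by (intro sum_mono2) auto
  also have "\<dots> = (\<Sum>m<k. \<Sum>n\<in>{m * D..<m * D + D}. f (n div D))"
    by (rule sum.nat_group[symmetric])
  also have "\<dots> = (\<Sum>m<k. \<Sum>n\<in>{m * D..<m * D + D}. f m)"
  proof (rule sum.cong[OF refl], rule sum.cong[OF refl])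
    fix m n assume "n \<in> {m * D..<m * D + D}"
    then have "D * m \<le> n" "n < D * Suc m" by (simp_all only: atLeastLessThan_iff mult.commute[of m] mult_Suc_right add.commute[of D])
    then have "n div D = m" by (rule div_nat_eqI)
    then show "f (n div D) = f m" by simp
  qed
  also have "\<dots> = real D * (\<Sum>m<k. f m)" by (simp add: sum_distrib_left)
  also have "\<dots> \<le> real D * suminf f" using f by (intro mult_left_mono sum_le_suminf) auto
  finally show "(\<Sum>n<k. f (n div D)) \<le> real D * suminf f" .
qed (rule f)

lemma summable_blocks:
  fixes g :: "nat \<Rightarrow> real"
  assumes g: "summable g" "\<And>n. 0 \<le> g n" and "mono N"
  shows "summable (\<lambda>l. \<Sum>n\<in>{N l..<N (Suc l)}. g n)"
proof (rule summableI_nonneg_bounded[where x = "suminf g"])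
  fix L
  have "(\<Sum>l<L. \<Sum>n\<in>{N l..<N (Suc l)}. g n) = (\<Sum>n\<in>{N 0..<N L}. g n)"
  proof (induction L)
    case (Suc L)
    have "N 0 \<le> N L" "N L \<le> N (Suc L)" by (auto intro!: monoD[OF \<open>mono N\<close>])
    then show ?case using Suc by (simp add: sum.atLeastLessThan_concat)
  qed simp
  also have "\<dots> \<le> suminf g" using g by (intro sum_le_suminf) auto
  finally show "(\<Sum>l<L. \<Sum>n\<in>{N l..<N (Suc l)}. g n) \<le> suminf g" .
qed (use g in \<open>auto intro: sum_nonneg\<close>)

context iid_array
begin

lemma Q_bounds: "0 \<le> Q m t" "Q m t \<le> 1"
  by (auto simp: Q_def)

lemma Q_mono: "m \<le> m' \<Longrightarrow> t' \<le> t \<Longrightarrow> Q m t \<le> Q m' t'"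
  unfolding Q_def by (intro finite_measure_mono row_event) (fastforce simp: pairs_def)+

text \<open>Any two columns among \<open>c * m\<close> lie in the union of two of the \<open>c\<close> blocks of length \<open>m\<close>.\<close>

lemma Q_blocks: "Q (c * m) t \<le> (real c)\<^sup>2 * Q (2 * m) t"
proof -
  \<comment> \<open>\<open>e a b\<close> lists block \<open>a\<close> and then block
    \<open>b\<close>. For \<open>a = b\<close> the neighbour \<open>a + 1\<close> stands in as
    second block, merely to keep the map injective; it may reach beyond column \<open>c * m\<close>,
    since \<open>Q_embed\<close> admits any columns.\<close>
  define e where "e a b x = (if x \<le> m then a * m + x else (if a = b then a + 1 else b) * m + (x - m))" for a b x :: nat
  define G where "G p = (\<Union>(i, j)\<in>pairs (2 * m). {\<omega>\<in>space M. t \<le> \<bar>Z 1 (e (fst p) (snd p) i) (e (fst p) (snd p) j) \<omega>\<bar>})" for p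
  have e1: "1 \<le> e a b x" if "1 \<le> x" for a b x using that by (auto simp: e_def)
  have inj: "inj_on (e a b) {1..2*m}" for a b
  proof -
    have ne: "a * m + x \<noteq> b' * m + y" if "a \<noteq> b'" "1 \<le> x" "x \<le> m" "1 \<le> y" "y \<le> m" for b' x y
    proof (cases "a < b'")
      case True
      then have "(a + 1) * m \<le> b' * m" by (intro mult_le_mono1) auto
      then show ?thesis using that by auto
    next
      case False
      then have "(b' + 1) * m \<le> a * m" using that by (intro mult_le_mono1) auto
      then show ?thesis using that by auto
    qed
    define b' where "b' = (if a = b then a + 1 else b)"
    have "a \<noteq> b'" by (auto simp: b'_def)
    have eq: "e a b x = (if x \<le> m then a * m + x else b' * m + (x - m))" for x by (simp add: e_def b'_def)
    show ?thesis
    proof (rule inj_onI)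
      fix x y assume xy: "x \<in> {1..2*m}" "y \<in> {1..2*m}" "e a b x = e a b y"
      consider "x \<le> m" "y \<le> m" | "x \<le> m" "m < y" | "m < x" "y \<le> m" | "m < x" "m < y" by linarith
      then show "x = y"
      proof cases
        case 2
        then have "1 \<le> y - m" "y - m \<le> m" using xy by auto
        then show ?thesis using 2 xy ne[OF \<open>a \<noteq> b'\<close>, of x "y - m"] by (auto simp: eq)
      next
        case 3
        then have "1 \<le> x - m" "x - m \<le> m" using xy by auto
        then show ?thesis using 3 xy ne[OF \<open>a \<noteq> b'\<close>, of y "x - m"] by (auto simp: eq)
      qed (use xy in \<open>auto simp: eq\<close>)
    qed
  qed
  have mG: "G p \<in> events" for p
    unfolding G_def by (intro sets.finite_UN finite_pairs) (auto simp: pairs_def intro!: Z_event e1)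
  have pG: "prob (G p) = Q (2 * m) t" for p
    unfolding G_def by (rule Q_embed) (use inj e1 in auto)
  have "(\<Union>(i, j)\<in>pairs (c * m). {\<omega>\<in>space M. t \<le> \<bar>Z 1 i j \<omega>\<bar>}) \<subseteq> (\<Union>p\<in>{..<c}\<times>{..<c}. G p)"
  proof safe
    fix \<omega> i j assume ij: "(i, j) \<in> pairs (c * m)" and \<omega>: "\<omega> \<in> space M" "t \<le> \<bar>Z 1 i j \<omega>\<bar>"
    \<comment> \<open>Columns are numbered from 1, so the shift by one puts the remainders
      \<open>r\<close> and \<open>s\<close> into the range from 1 to \<open>m\<close>.\<close>
    define a b where "a = (i - 1) div m" and "b = (j - 1) div m"
    define r s where "r = (i - 1) mod m + 1" and "s = (j - 1) mod m + 1"
    have ij': "1 \<le> i" "i < j" "j \<le> c * m" using ij by (auto simp: pairs_def)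
    have m: "0 < m" using ij' by (cases "m = 0") auto
    have i: "i = a * m + r" using ij' div_mult_mod_eq[of "i - 1" m] by (simp add: a_def r_def)
    have j: "j = b * m + s" using ij' div_mult_mod_eq[of "j - 1" m] by (simp add: b_def s_def)
    have r: "1 \<le> r" "r \<le> m" "1 \<le> s" "s \<le> m" using m by (auto simp: r_def s_def Suc_leI)
    have ab: "a < c" "b < c" using ij' m by (auto simp: a_def b_def less_mult_imp_div_less)
    have "\<omega> \<in> G (a, b)"
    proof (cases "a = b")
      case True
      then have "(r, s) \<in> pairs (2 * m)" using ij' i j r by (auto simp: pairs_def)
      moreover have "e a b r = i" "e a b s = j" using True r i j by (auto simp: e_def)
      ultimately show ?thesis using \<omega> unfolding G_def by force
    next
      case False
      then have "(r, m + s) \<in> pairs (2 * m)" using r by (auto simp: pairs_def)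
      moreover have "e a b r = i" "e a b (m + s) = j" using False r i j by (auto simp: e_def)
      ultimately show ?thesis using \<omega> unfolding G_def by force
    qed
    then show "\<omega> \<in> (\<Union>p\<in>{..<c}\<times>{..<c}. G p)" using ab by auto
  qed
  then have "Q (c * m) t \<le> prob (\<Union>p\<in>{..<c}\<times>{..<c}. G p)"
    unfolding Q_def using mG by (intro finite_measure_mono sets.finite_UN) auto
  also have "\<dots> \<le> (\<Sum>p\<in>{..<c}\<times>{..<c}. prob (G p))"
    using mG by (intro measure_UNION_le) auto
  also have "\<dots> = (real c)\<^sup>2 * Q (2 * m) t" by (simp add: pG power2_eq_square)
  finally show ?thesis .
qed

text \<open>Compare the term at \<open>n\<close> with the hypothesis at \<open>n div D\<close>. A
  large \<open>D\<close> lowers the threshold as far as desired, and the resulting surplus of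
  columns is a constant factor that \<open>Q_blocks\<close> turns into a constant in front.
  Repetition of terms is covered by \<open>summable_div\<close>.\<close>

lemma Q_summable_scale:
  assumes Q: "summable (\<lambda>n. Q (n div q) (b * scl n))" and "0 < b" "1 \<le> q" "0 < \<eta>"
  shows "summable (\<lambda>n. Q (C * n) (\<eta> * scl n))"
proof -
  \<comment> \<open>\<open>scl (n div D)\<close> is at most \<open>scl n / sqrt D\<close>, so
    \<open>D \<ge> b^2 / \<eta>^2\<close> brings the threshold \<open>b * scl (n div D)\<close>
    below \<open>\<eta> * scl n\<close>.\<close>
  obtain D0 :: nat where D0: "b\<^sup>2 / \<eta>\<^sup>2 \<le> real D0" using real_arch_simple by blast
  define D where "D = max 1 D0"
  have D: "1 \<le> D" "b\<^sup>2 \<le> \<eta>\<^sup>2 * real D"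
  proof -
    have "b\<^sup>2 \<le> \<eta>\<^sup>2 * real D0" using D0 \<open>0 < \<eta>\<close> by (simp add: field_simps)
    also have "\<dots> \<le> \<eta>\<^sup>2 * real D" by (intro mult_left_mono) (auto simp: D_def)
    finally show "b\<^sup>2 \<le> \<eta>\<^sup>2 * real D" .
  qed (simp add: D_def)
  have sc: "b * scl (n div D) \<le> \<eta> * scl n" for n
  proof (cases "n div D = 0")
    case True
    then show ?thesis using \<open>0 < \<eta>\<close> scl_nonneg[of n] by (simp add: scl_def)
  next
    case False
    define m where "m = n div D"
    have "1 \<le> m" using False by (simp add: m_def)
    have mD: "m * D \<le> n" by (simp add: m_def)
    have mn: "m \<le> n" using mD D(1) by (metis div_le_dividend m_def)
    have "b\<^sup>2 * real m \<le> (\<eta>\<^sup>2 * real D) * real m" using D(2) by (intro mult_right_mono) auto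
    also have "\<dots> = \<eta>\<^sup>2 * real (m * D)" by simp
    also have "\<dots> \<le> \<eta>\<^sup>2 * real n" using mD by (intro mult_left_mono of_nat_mono) auto
    finally have le: "b\<^sup>2 * real m \<le> \<eta>\<^sup>2 * real n" .
    have "(b\<^sup>2 * real m) * ln (real m) \<le> (\<eta>\<^sup>2 * real n) * ln (real n)"
      by (rule mult_mono[OF le]) (use \<open>1 \<le> m\<close> mn in auto)
    then have "sqrt (b\<^sup>2 * (real m * ln (real m))) \<le> sqrt (\<eta>\<^sup>2 * (real n * ln (real n)))" by (simp add: mult.assoc)
    also have "\<dots> = \<eta> * scl n" using \<open>0 < \<eta>\<close> by (simp add: scl_def real_sqrt_mult)
    finally show ?thesis using \<open>0 < b\<close> by (simp add: m_def scl_def real_sqrt_mult)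
  qed
  have bound: "Q (C * n) (\<eta> * scl n) \<le> (real (4 * C * D * q))\<^sup>2 * Q (n div D div q) (b * scl (n div D))" if "2 * D * q \<le> n" for n
  proof -
    define m where "m = n div D"
    \<comment> \<open>\<open>Q_blocks\<close> returns two blocks, so blocks of half the available
      number \<open>m div q\<close> of columns are used.\<close>
    define h where "h = m div q div 2"
    have "2 * q \<le> m" unfolding m_def using that D by (simp add: less_eq_div_iff_mult_less_eq mult_ac)
    then have m2: "2 \<le> m div q" using \<open>1 \<le> q\<close> by (simp add: less_eq_div_iff_mult_less_eq)
    have "n < D * (m + 1)" unfolding m_def using dividend_less_times_div[of D n] D by simp
    also have "D * (m + 1) \<le> D * (q * (4 * h))"
    proof (intro mult_le_mono2)
      \<comment> \<open>\<open>1 \<le> h\<close> absorbs both roundings: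
        \<open>m div q + 1 \<le> 2 * h + 2 \<le> 4 * h\<close>.\<close>
      have "m div q \<le> 2 * h + 1" "1 \<le> h" using m2 by (auto simp: h_def)
      then have "q * (m div q + 1) \<le> q * (4 * h)" by (intro mult_le_mono2) linarith
      moreover have "m < q * (m div q + 1)" using dividend_less_times_div[of q m] \<open>1 \<le> q\<close> by simp
      ultimately show "m + 1 \<le> q * (4 * h)" by linarith
    qed
    finally have "C * n \<le> C * (D * (q * (4 * h)))" by (intro mult_le_mono2) simp
    then have Cn: "C * n \<le> (4 * C * D * q) * h" by (simp add: mult_ac)
    have "Q (C * n) (\<eta> * scl n) \<le> Q ((4 * C * D * q) * h) (b * scl m)"
      using sc[of n] Cn by (intro Q_mono) (auto simp: m_def)
    also have "\<dots> \<le> (real (4 * C * D * q))\<^sup>2 * Q (2 * h) (b * scl m)" by (rule Q_blocks)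
    also have "\<dots> \<le> (real (4 * C * D * q))\<^sup>2 * Q (m div q) (b * scl m)"
    proof (rule mult_left_mono[OF Q_mono])
      show "2 * h \<le> m div q" unfolding h_def by (rule times_div_less_eq_dividend)
    qed simp_all
    finally show ?thesis by (simp add: m_def)
  qed
  have "summable (\<lambda>n. (real (4 * C * D * q))\<^sup>2 * Q (n div D div q) (b * scl (n div D)))"
    using summable_div[OF Q Q_bounds(1) D(1)] by (rule summable_mult)
  then show ?thesis
  proof (rule summable_comparison_test')
    show "norm (Q (C * n) (\<eta> * scl n)) \<le> (real (4 * C * D * q))\<^sup>2 * Q (n div D div q) (b * scl (n div D))"
      if "2 * D * q \<le> n" for n
      using bound[OF that] Q_bounds(1)[of "C * n" "\<eta> * scl n"] by (simp only: real_norm_def abs_of_nonneg)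
  qed
qed

section \<open>From the summability condition to a third moment\<close>

lemma Q_two: "Q 2 t = prob {\<omega>\<in>space M. t \<le> \<bar>Z 1 1 2 \<omega>\<bar>}"
proof -
  have "pairs 2 = {(1, 2)}" by (auto simp: pairs_def)
  then show ?thesis by (simp add: Q_def)
qed

text \<open>The products of columns 1 and 2, of columns 3 and 4, and so on are independent, and
  \<open>n div 2\<close> of them take part in the maximum.\<close>

lemma Q_disjoint_pairs: "1 - (1 - Q 2 t) ^ (n div 2) \<le> Q n t"
proof -
  define h where "h = n div 2"
  define B where "B i = {\<omega>\<in>space M. \<not> t \<le> \<bar>Z 1 (2 * i + 1) (2 * i + 2) \<omega>\<bar>}" for i
  have mZ: "{\<omega>\<in>space M. t \<le> \<bar>Z 1 (2 * i + 1) (2 * i + 2) \<omega>\<bar>} \<in> events" for i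
    by (intro Z_event) auto
  have B': "B i = space M - {\<omega>\<in>space M. t \<le> \<bar>Z 1 (2 * i + 1) (2 * i + 2) \<omega>\<bar>}" for i by (auto simp: B_def)
  have mB: "B i \<in> events" for i unfolding B' using mZ by auto
  have pB: "prob (B i) = 1 - Q 2 t" for i
  proof -
    have "prob {\<omega>\<in>space M. t \<le> \<bar>Z 1 (2 * i + 1) (2 * i + 2) \<omega>\<bar>} = Q 2 t"
    proof -
      define e where "e x = 2 * i + x" for x :: nat
      have p: "pairs 2 = {(1, 2)}" by (auto simp: pairs_def)
      have "inj_on e {1..2}" "e ` {1..2} \<subseteq> {1..}" by (auto simp: e_def intro: inj_onI)
      from Q_embed[OF order_refl this, of t] show ?thesis unfolding p by (simp add: e_def)
    qed
    then show ?thesis unfolding B' using mZ by (subst prob_compl) auto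
  qed
  have ind: "indep_events B UNIV"
  proof -
    define Y where "Y i \<omega> = Z 1 (2 * i + 1) (2 * i + 2) \<omega>" for i \<omega>
    have "indep_vars (\<lambda>i. PiM {(1, 2 * i + 1), (1, 2 * i + 2)} (\<lambda>_. borel))
       (\<lambda>i \<omega>. restrict (\<lambda>p. (case p of (k, i) \<Rightarrow> X k i) \<omega>) {(1, 2 * i + 1), (1, 2 * i + 2)}) UNIV"
    proof (rule indep_vars_restrict[OF indep])
      have "2 * a + 1 \<noteq> 2 * b + 2" for a b :: nat by presburger
      then have "2 * a + 1 \<noteq> 2 * b + 2" "2 * b + 2 \<noteq> 2 * a + 1" for a b :: nat by metis+
      then show "disjoint_family_on (\<lambda>i :: nat. {(1 :: nat, 2 * i + 1), (1, 2 * i + 2)}) UNIV"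
        unfolding disjoint_family_on_def by simp
    qed auto
    then have "indep_vars (\<lambda>_. borel) (\<lambda>i \<omega>. (\<lambda>x. x (1, 2 * i + 1) * x (1, 2 * i + 2))
       (restrict (\<lambda>p. (case p of (k, i) \<Rightarrow> X k i) \<omega>) {(1, 2 * i + 1), (1, 2 * i + 2)})) UNIV"
      by (rule indep_vars_compose2) simp
    then have "indep_vars (\<lambda>_. borel) Y UNIV" by (simp add: Y_def[abs_def] Z_def)
    then have "indep_events (\<lambda>i. {\<omega>\<in>space M. \<not> t \<le> \<bar>Y i \<omega>\<bar>}) UNIV"
      by (rule indep_eventsI_indep_vars) auto
    then show ?thesis by (simp add: B_def[abs_def] Y_def)
  qed
  have "1 - Q n t \<le> (1 - Q 2 t) ^ h"
  proof (cases "h = 0")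
    case False
    define A where "A = (\<Union>(i, j)\<in>pairs n. {\<omega>\<in>space M. t \<le> \<bar>Z 1 i j \<omega>\<bar>})"
    have "1 - Q n t = prob (space M - A)"
      unfolding Q_def A_def by (subst prob_compl) (auto intro!: row_event)
    also have "\<dots> \<le> prob (\<Inter>i\<in>{..<h}. B i)"
    proof (rule finite_measure_mono)
      show "space M - A \<subseteq> (\<Inter>i\<in>{..<h}. B i)"
      proof
        fix \<omega> assume \<omega>: "\<omega> \<in> space M - A"
        show "\<omega> \<in> (\<Inter>i\<in>{..<h}. B i)"
        proof
          fix i assume "i \<in> {..<h}"
          then have "(2 * i + 1, 2 * i + 2) \<in> pairs n" by (auto simp: pairs_def h_def)
          then show "\<omega> \<in> B i" using \<omega> unfolding A_def B_def by force
        qed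
      qed
      show "(\<Inter>i\<in>{..<h}. B i) \<in> events" using False mB by (intro sets.finite_INT) auto
    qed
    also have "\<dots> = (\<Prod>i\<in>{..<h}. prob (B i))" 
      using ind[unfolded indep_events_def, THEN conjunct2, rule_format, of "{..<h}"] False by auto
    also have "\<dots> = (1 - Q 2 t) ^ h" using pB by simp
    finally show ?thesis .
  qed (simp add: Q_bounds)
  then show ?thesis by (simp add: h_def)
qed

text \<open>As the terms tend to 0, \<open>Q_disjoint_pairs\<close> is in the range where
  \<open>1 - (1 - x)^h\<close> is comparable to \<open>h * x\<close>, so the union bound over
  disjoint pairs can be reversed up to a constant.\<close>

lemma summable_pair_tail:
  assumes Q: "summable (\<lambda>n. Q n (scl n))"
  shows "summable (\<lambda>n. real n * Q 2 (scl n))"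
proof -
  have "eventually (\<lambda>n. Q n (scl n) < 1/2) sequentially"
    using summable_LIMSEQ_zero[OF Q] by (rule order_tendstoD) simp
  then have "eventually (\<lambda>n. norm (real n * Q 2 (scl n)) \<le> 6 * Q n (scl n)) sequentially"
    using eventually_ge_at_top[of 2]
  proof eventually_elim
    case (elim n)
    define h where "h = n div 2"
    define y where "y = real h * Q 2 (scl n)"
    define v where "v = Q n (scl n)"
    have y0: "0 \<le> y" using Q_bounds by (simp add: y_def)
    have "(1 - Q 2 (scl n)) ^ h \<le> exp (- Q 2 (scl n)) ^ h"
      using exp_ge_add_one_self[of "- Q 2 (scl n)"] Q_bounds by (intro power_mono) auto
    also have "\<dots> = exp (- y)" by (simp add: y_def exp_of_nat_mult[symmetric])
    finally have "1 - v \<le> exp (- y)" using Q_disjoint_pairs[of "scl n" n] by (simp add: v_def h_def)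
    \<comment> \<open>Multiplying by \<open>1 + y \<le> exp y\<close> avoids logarithms: the
      resulting \<open>(1 - v) * y \<le> v\<close> gives \<open>y \<le> 2 * v\<close> when
      \<open>v < 1/2\<close>.\<close>
    then have "(1 - v) * (1 + y) \<le> exp (- y) * exp y"
      using exp_ge_add_one_self[of y] y0 by (intro mult_mono) auto
    also have "\<dots> = 1" by (simp add: exp_minus)
    finally have "(1 - v) * y \<le> v" by (simp add: algebra_simps)
    moreover have "1/2 * y \<le> (1 - v) * y" using elim(1) y0 by (intro mult_right_mono) (auto simp: v_def)
    ultimately have "y \<le> 2 * v" by linarith
    moreover have "real n * Q 2 (scl n) \<le> 3 * y"
    proof -
      have "n \<le> 3 * h" using elim(2) by (simp add: h_def)
      then have "real n \<le> 3 * real h" by linarith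
      then show ?thesis unfolding y_def mult.assoc[symmetric] using Q_bounds by (intro mult_right_mono) auto
    qed
    ultimately show ?case using Q_bounds by (simp add: v_def)
  qed
  then show ?thesis using summable_mult[OF Q, of 6] by (rule summable_comparison_test_ev)
qed

text \<open>If \<open>scl m \<le> \<bar>z\<bar> < scl (m + 1)\<close> around the first crossing, the
  sum is at least \<open>m^2/2\<close>, while the cube is at most \<open>scl (m + 1)^3\<close>, of
  order \<open>(m * ln m) powr (3/2)\<close> and hence o(\<open>m^2\<close>). This replaces an
  explicit inverse of \<open>scl\<close>.\<close>

lemma cube_le_tail_sum:
  "\<exists>K\<ge>0. \<forall>z. ennreal (\<bar>z\<bar>^3) \<le> ennreal K + ennreal K * (\<Sum>n. ennreal (real n * indicator {n. scl n \<le> \<bar>z\<bar>} n))"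
proof -
  have "(\<lambda>m. (scl (m + 1))^3 / (1 + (real m)\<^sup>2/2)) \<longlonglongrightarrow> 0"
    unfolding scl_def by real_asymp
  then have "Bseq (\<lambda>m. (scl (m + 1))^3 / (1 + (real m)\<^sup>2/2))"
    by (intro convergent_imp_Bseq convergentI)
  then obtain K where K: "0 < K" "\<And>m. norm ((scl (m + 1))^3 / (1 + (real m)\<^sup>2/2)) \<le> K"
    by (auto simp: Bseq_def)
  show ?thesis
  proof (intro exI[of _ K] conjI allI)
    fix z :: real
    define s where "s = (\<Sum>n. ennreal (real n * indicator {n. scl n \<le> \<bar>z\<bar>} n))"
    have "eventually (\<lambda>n. \<bar>z\<bar> < scl n) sequentially"
      using filterlim_scl by (simp add: filterlim_at_top_dense)
    then obtain n0 where n0: "\<bar>z\<bar> < scl n0" by (auto dest: eventually_happens)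
    define l where "l = (LEAST n. \<bar>z\<bar> < scl n)"
    have l: "\<bar>z\<bar> < scl l" unfolding l_def using n0 by (rule LeastI)
    have "l \<noteq> 0" using l by (intro notI) (simp add: scl_def)
    then obtain m where m: "l = m + 1" by (cases l) auto
    have below: "scl n \<le> \<bar>z\<bar>" if "n \<le> m" for n
      using not_less_Least[of n "\<lambda>n. \<bar>z\<bar> < scl n"] that m by (auto simp: l_def[symmetric])
    have "ennreal ((real m)\<^sup>2/2) \<le> ennreal (\<Sum>n<Suc m. real n)"
    proof (rule ennreal_leI)
      have "(\<Sum>n<Suc m. real n) = real m * (real m + 1) / 2" by (induction m) (auto simp: field_simps)
      then show "(real m)\<^sup>2/2 \<le> (\<Sum>n<Suc m. real n)" by (simp add: power2_eq_square field_simps)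
    qed
    also have "\<dots> = (\<Sum>n<Suc m. ennreal (real n * indicator {n. scl n \<le> \<bar>z\<bar>} n))"
      using below by (subst sum_ennreal[symmetric]) (auto intro!: sum.cong)
    also have "\<dots> \<le> s" unfolding s_def by (intro sum_le_suminf) auto
    finally have ms: "ennreal ((real m)\<^sup>2/2) \<le> s" .
    have "\<bar>z\<bar>^3 \<le> (scl (m + 1))^3" using l m by (intro power_mono) auto
    also have "\<dots> \<le> K * (1 + (real m)\<^sup>2/2)"
    proof -
      have p: "0 < 1 + (real m)\<^sup>2/2" by (simp add: add_pos_nonneg)
      have "(scl (m + 1))^3 / (1 + (real m)\<^sup>2/2) \<le> K" using K(2)[of m] by simp
      then show ?thesis using p by (simp only: pos_divide_le_eq)
    qed
    finally have "ennreal (\<bar>z\<bar>^3) \<le> ennreal (K * (1 + (real m)\<^sup>2/2))" by (rule ennreal_leI)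
    also have "\<dots> = ennreal K + ennreal K * ennreal ((real m)\<^sup>2/2)"
      using K(1) by (simp only: distrib_left mult_1_right ennreal_plus ennreal_mult zero_le_divide_iff zero_le_power2
        zero_le_numeral simp_thms less_imp_le mult_nonneg_nonneg)
    also have "\<dots> \<le> ennreal K + ennreal K * s" using ms by (intro add_left_mono mult_left_mono) auto
    finally show "ennreal (\<bar>z\<bar>^3) \<le> ennreal K + ennreal K * (\<Sum>n. ennreal (real n * indicator {n. scl n \<le> \<bar>z\<bar>} n))"
      by (simp add: s_def)
  qed (use K in auto)
qed

text \<open>Integrating \<open>cube_le_tail_sum\<close> along the product of two entries gives a
  finite third moment of the product. For integrals in [0, \<infinity>] the expectation factorises
  as \<open>I * I\<close> before integrability is known, and \<open>I * I < \<infinity>\<close>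
  forces \<open>I < \<infinity>\<close>.\<close>

lemma third_moment:
  assumes Q: "summable (\<lambda>n. Q n (scl n))"
  shows "integrable M (\<lambda>\<omega>. \<bar>X 1 1 \<omega>\<bar>^3)"
proof -
  have [measurable]: "X 1 1 \<in> borel_measurable M" "X 1 2 \<in> borel_measurable M" "Z 1 1 2 \<in> borel_measurable M" by auto
  obtain K where K: "0 \<le> K" "\<And>z. ennreal (\<bar>z\<bar>^3) \<le> ennreal K + ennreal K * (\<Sum>n. ennreal (real n * indicator {n. scl n \<le> \<bar>z\<bar>} n))"
    using cube_le_tail_sum by blast
  define f where "f n \<omega> = ennreal (real n * indicator {n. scl n \<le> \<bar>Z 1 1 2 \<omega>\<bar>} n)" for n \<omega>
  define A where "A n = {\<omega>\<in>space M. scl n \<le> \<bar>Z 1 1 2 \<omega>\<bar>}" for n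
  have mA: "A n \<in> events" for n unfolding A_def by (rule Z_event) auto
  have f: "f n \<omega> = ennreal (real n) * indicator (A n) \<omega>" if "\<omega> \<in> space M" for n \<omega>
    using that by (auto simp: f_def A_def split: split_indicator)
  have mf [measurable]: "f n \<in> borel_measurable M" for n
    by (subst measurable_cong[OF f]) (use mA in auto)
  have "(\<integral>\<^sup>+\<omega>. ennreal (\<bar>Z 1 1 2 \<omega>\<bar>^3) \<partial>M) \<le> (\<integral>\<^sup>+\<omega>. ennreal K + ennreal K * (\<Sum>n. f n \<omega>) \<partial>M)"
    unfolding f_def by (intro nn_integral_mono K(2))
  also have "\<dots> = ennreal K + ennreal K * (\<integral>\<^sup>+\<omega>. (\<Sum>n. f n \<omega>) \<partial>M)"
    by (subst nn_integral_add) (auto simp: nn_integral_cmult emeasure_space_1)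
  also have "(\<integral>\<^sup>+\<omega>. (\<Sum>n. f n \<omega>) \<partial>M) = (\<Sum>n. \<integral>\<^sup>+\<omega>. f n \<omega> \<partial>M)"
    by (rule nn_integral_suminf) simp
  also have "\<dots> = (\<Sum>n. ennreal (real n * Q 2 (scl n)))"
  proof (intro suminf_cong)
    fix n
    have "(\<integral>\<^sup>+\<omega>. f n \<omega> \<partial>M) = (\<integral>\<^sup>+\<omega>. ennreal (real n) * indicator (A n) \<omega> \<partial>M)"
      by (intro nn_integral_cong f)
    also have "\<dots> = ennreal (real n) * emeasure M (A n)"
      by (rule nn_integral_cmult_indicator[OF mA])
    also have "\<dots> = ennreal (real n * Q 2 (scl n))"
      by (simp add: Q_two emeasure_eq_measure ennreal_mult A_def)
    finally show "(\<integral>\<^sup>+\<omega>. f n \<omega> \<partial>M) = ennreal (real n * Q 2 (scl n))" .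
  qed
  also have "\<dots> = ennreal (\<Sum>n. real n * Q 2 (scl n))"
    using summable_pair_tail[OF Q] Q_bounds by (intro suminf_ennreal2) auto
  finally have fin: "(\<integral>\<^sup>+\<omega>. ennreal (\<bar>Z 1 1 2 \<omega>\<bar>^3) \<partial>M) < \<infinity>"
    by (rule le_less_trans) (simp add: ennreal_mult_less_top)
  define I where "I = (\<integral>\<^sup>+\<omega>. ennreal (\<bar>X 1 1 \<omega>\<bar>^3) \<partial>M)"
  have ind: "indep_vars (\<lambda>_. borel) (\<lambda>a. X 1 a) {1, 2}"
    using indep_reindex[of "\<lambda>a. (1, a)" "{1, 2}"] by (simp add: inj_on_def)
  then have ind: "indep_vars (\<lambda>_. borel) (\<lambda>a \<omega>. ennreal (\<bar>X 1 a \<omega>\<bar>^3)) {1, 2}"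
    by (rule indep_vars_compose2) simp
  have X2: "(\<integral>\<^sup>+\<omega>. ennreal (\<bar>X 1 2 \<omega>\<bar>^3) \<partial>M) = I"
  proof -
    have "(\<integral>\<^sup>+\<omega>. ennreal (\<bar>X 1 2 \<omega>\<bar>^3) \<partial>M) = (\<integral>\<^sup>+x. ennreal (\<bar>x\<bar>^3) \<partial>distr M borel (X 1 2))"
      by (subst nn_integral_distr) auto
    also have "\<dots> = I" unfolding I_def using ident[of 1 2] by (simp add: nn_integral_distr)
    finally show ?thesis .
  qed
  have "(\<integral>\<^sup>+\<omega>. ennreal (\<bar>Z 1 1 2 \<omega>\<bar>^3) \<partial>M) = (\<integral>\<^sup>+\<omega>. (\<Prod>a\<in>{1, 2}. ennreal (\<bar>X 1 a \<omega>\<bar>^3)) \<partial>M)"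
    by (intro nn_integral_cong) (simp add: Z_def abs_mult power_mult_distrib ennreal_mult)
  also have "\<dots> = (\<Prod>a\<in>{1, 2}. \<integral>\<^sup>+\<omega>. ennreal (\<bar>X 1 a \<omega>\<bar>^3) \<partial>M)"
    by (rule indep_vars_nn_integral[OF _ ind]) auto
  also have "\<dots> = I * I" using X2 by (simp add: I_def)
  finally have "I * I < \<infinity>" using fin by simp
  then have "I < \<infinity>" by (cases "I = \<infinity>") (auto simp: less_top)
  then show ?thesis unfolding I_def by (intro integrableI_bounded) auto
qed

end

section \<open>The limit along geometric blocks\<close>

text \<open>From \<open>N \<ge> 3\<close> follows \<open>ln N \<ge> 1\<close>, so \<open>n\<close>
  and \<open>ln n\<close> both grow at most by the factor \<open>1 + d\<close> and the square root
  of the product does too.\<close>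

lemma scl_ratio:
  assumes "3 \<le> N" "N \<le> n" "real n \<le> (1 + d) * real N" "0 \<le> d"
  shows "scl n \<le> (1 + d) * scl N"
proof -
  have N: "0 < real N" "0 < real n" using assms by auto
  have "exp 1 \<le> real N" using exp_le assms(1) by linarith
  then have ln1: "1 \<le> ln (real N)" using N by (simp add: ln_ge_iff)
  have "ln (real n) \<le> ln ((1 + d) * real N)" using assms N by (subst ln_le_cancel_iff) auto
  also have "\<dots> = ln (1 + d) + ln (real N)" using assms N by (intro ln_mult_pos) auto
  also have "\<dots> \<le> d * ln (real N) + ln (real N)"
    using ln_add_one_self_le_self[OF assms(4)] mult_left_mono[OF ln1 assms(4)] by simp
  finally have l: "ln (real n) \<le> (1 + d) * ln (real N)" by (simp add: algebra_simps)
  have "real n * ln (real n) \<le> ((1 + d) * real N) * ((1 + d) * ln (real N))"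
    using assms l N by (intro mult_mono) auto
  also have "\<dots> = (1 + d)\<^sup>2 * (real N * ln (real N))" by (simp add: power2_eq_square)
  finally have "scl n \<le> sqrt ((1 + d)\<^sup>2 * (real N * ln (real N)))" by (simp add: scl_def)
  also have "\<dots> = (1 + d) * scl N" using assms by (simp add: scl_def real_sqrt_mult)
  finally show ?thesis .
qed

definition geo :: "real \<Rightarrow> nat \<Rightarrow> nat" where
  "geo \<delta> l = nat \<lfloor>(1 + \<delta>) ^ l\<rfloor>"

lemma geo_bounds:
  assumes "0 < \<delta>"
  shows "real (geo \<delta> l) \<le> (1 + \<delta>) ^ l" "(1 + \<delta>) ^ l < real (geo \<delta> l) + 1"
proof -
  have "0 \<le> \<lfloor>(1 + \<delta>) ^ l\<rfloor>" using assms by simp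
  then have "real (geo \<delta> l) = of_int \<lfloor>(1 + \<delta>) ^ l\<rfloor>" by (simp add: geo_def)
  then show "real (geo \<delta> l) \<le> (1 + \<delta>) ^ l" "(1 + \<delta>) ^ l < real (geo \<delta> l) + 1"
    by (simp_all add: floor_less_iff)
qed

lemma geo_0 [simp]: "geo \<delta> 0 = 1"
  by (simp add: geo_def)

lemma mono_geo: "0 < \<delta> \<Longrightarrow> mono (geo \<delta>)"
  unfolding geo_def by (intro monoI nat_mono floor_mono power_increasing) auto

lemma filterlim_geo: "0 < \<delta> \<Longrightarrow> filterlim (geo \<delta>) at_top sequentially"
proof -
  assume d: "0 < \<delta>"
  have "filterlim (\<lambda>l. (1 + \<delta>) ^ l - 1) at_top sequentially"
    using d by real_asymp
  then have "filterlim (\<lambda>l. real (geo \<delta> l)) at_top sequentially"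
    by (rule filterlim_at_top_mono) (use geo_bounds(2)[OF d] in \<open>auto intro!: always_eventually simp: less_imp_le algebra_simps\<close>)
  then show ?thesis using filterlim_sequentially_iff_filterlim_real by blast
qed

text \<open>Rounding down costs at most 1 in each term, which a second \<delta> absorbs once the
  term is large; for small \<open>l\<close> the sequence may even be constant.\<close>

lemma geo_Suc:
  assumes "0 < \<delta>" "1 + \<delta> \<le> \<delta> * real (geo \<delta> l)"
  shows "real (geo \<delta> (Suc l)) \<le> (1 + 2 * \<delta>) * real (geo \<delta> l)"
    and "\<delta> * real (geo \<delta> l) \<le> real (geo \<delta> (Suc l)) - real (geo \<delta> l) + 1"
proof -
  have "real (geo \<delta> (Suc l)) \<le> (1 + \<delta>) * (1 + \<delta>) ^ l" using geo_bounds(1)[OF assms(1), of "Suc l"] by simp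
  also have "\<dots> \<le> (1 + \<delta>) * (real (geo \<delta> l) + 1)"
    using assms geo_bounds(2)[OF assms(1), of l] by (intro mult_left_mono) auto
  finally show "real (geo \<delta> (Suc l)) \<le> (1 + 2 * \<delta>) * real (geo \<delta> l)" using assms by (simp add: algebra_simps)
  have "(1 + \<delta>) * real (geo \<delta> l) \<le> (1 + \<delta>) * (1 + \<delta>) ^ l"
    using assms geo_bounds(1)[OF assms(1), of l] by (intro mult_left_mono) auto
  also have "\<dots> < real (geo \<delta> (Suc l)) + 1" using geo_bounds(2)[OF assms(1), of "Suc l"] by simp
  finally show "\<delta> * real (geo \<delta> l) \<le> real (geo \<delta> (Suc l)) - real (geo \<delta> l) + 1"
    by (simp add: algebra_simps)
qed

lemma geo_cover:
  assumes "0 < \<delta>" "geo \<delta> l0 \<le> n"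
  shows "\<exists>l\<ge>l0. geo \<delta> l \<le> n \<and> n < geo \<delta> (Suc l)"
proof -
  have "eventually (\<lambda>l. n < geo \<delta> l) sequentially"
    by (rule eventually_compose_filterlim[OF eventually_gt_at_top filterlim_geo[OF assms(1)]])
  then obtain l1 where l1: "n < geo \<delta> l1" by (auto dest: eventually_happens)
  define l where "l = (LEAST l. n < geo \<delta> l)"
  have l: "n < geo \<delta> l" unfolding l_def using l1 by (rule LeastI)
  have "l0 < l" using l assms(2) monoD[OF mono_geo[OF assms(1)], of l l0] by (meson le_less_trans linorder_not_less not_less_iff_gr_or_eq)
  then obtain l' where l': "l = Suc l'" by (cases l) auto
  have "\<not> n < geo \<delta> l'" using not_less_Least[of l' "\<lambda>l. n < geo \<delta> l"] l' by (simp add: l_def[symmetric])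
  then show ?thesis using l l' \<open>l0 < l\<close> by (intro exI[of _ l']) auto
qed

text \<open>A negative power of a geometrically growing sequence is dominated by a geometric series.
  The factor \<open>exp (a * ln 2)\<close> pays for rounding, as \<open>(1 + \<delta>) ^ l\<close>
  is at most twice its integer part.\<close>

lemma summable_exp_geo:
  assumes "0 < \<delta>" "0 < a"
  shows "summable (\<lambda>l. exp (- a * ln (real (geo \<delta> l))))"
proof -
  define r where "r = exp (- a * ln (1 + \<delta>))"
  have r: "0 \<le> r" "r < 1" using assms by (auto simp: r_def)
  have bound: "exp (- a * ln (real (geo \<delta> l))) \<le> exp (a * ln 2) * r ^ l" for l
  proof -
    have g1: "1 \<le> geo \<delta> l" using monoD[OF mono_geo[OF assms(1)], of 0 l] by simp
    have "(1 + \<delta>) ^ l \<le> 2 * real (geo \<delta> l)" using geo_bounds(2)[OF assms(1), of l] g1 by linarith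
    then have "ln ((1 + \<delta>) ^ l) \<le> ln (2 * real (geo \<delta> l))" using assms g1 by (subst ln_le_cancel_iff) auto
    also have "\<dots> = ln 2 + ln (real (geo \<delta> l))" using g1 by (intro ln_mult_pos) auto
    finally have "real l * ln (1 + \<delta>) - ln 2 \<le> ln (real (geo \<delta> l))" using assms by (simp add: ln_realpow)
    then have "a * (real l * ln (1 + \<delta>) - ln 2) \<le> a * ln (real (geo \<delta> l))" using assms by (intro mult_left_mono) auto
    then have "exp (- a * ln (real (geo \<delta> l))) \<le> exp (a * ln 2 + real l * (- a * ln (1 + \<delta>)))"
      by (simp add: algebra_simps)
    also have "\<dots> = exp (a * ln 2) * r ^ l" unfolding r_def exp_add by (simp only: exp_of_nat_mult)
    finally show ?thesis .
  qed
  have "summable (\<lambda>l. exp (a * ln 2) * r ^ l)" using r by (intro summable_mult summable_geometric) auto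
  then show ?thesis
  proof (rule summable_comparison_test')
    show "norm (exp (- a * ln (real (geo \<delta> l)))) \<le> exp (a * ln 2) * r ^ l" for l
      using bound[of l] by (simp only: real_norm_def abs_exp_cancel)
  qed
qed

lemma eventually_geo: "0 < \<delta> \<Longrightarrow> eventually (\<lambda>l. x \<le> real (geo \<delta> l)) sequentially"
  using filterlim_compose[OF filterlim_real_sequentially filterlim_geo] by (simp add: filterlim_at_top)

text \<open>A block starting at \<open>N\<close> contains at least \<open>\<delta>/2 * N\<close>
  integers \<open>n\<close>. For each of them \<open>scl n \<le> 2 * scl N\<close>, so the term with
  the halved threshold \<open>\<eta>/2 * scl n\<close> dominates the one at \<open>N\<close>. Thus
  \<open>N\<close> times that term is at most \<open>2 / \<delta>\<close> times the block
  sum.\<close>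

lemma (in iid_array) summable_Q_geo:
  assumes Q: "summable (\<lambda>n. Q n (scl n))" and "0 < \<eta>" "0 < \<delta>" "\<delta> \<le> 1/2"
  shows "summable (\<lambda>l. real (geo \<delta> l) * Q (C * geo \<delta> l) (\<eta> * scl (geo \<delta> l)))"
proof -
  define g where "g n = Q (C * n) (\<eta>/2 * scl n)" for n
  have g: "summable g" unfolding g_def using assms by (intro Q_summable_scale[where q=1 and b=1]) auto
  have "summable (\<lambda>l. 2 / \<delta> * (\<Sum>n\<in>{geo \<delta> l..<geo \<delta> (Suc l)}. g n))"
    by (intro summable_mult summable_blocks g mono_geo assms) (simp add: g_def Q_bounds)
  moreover have "eventually (\<lambda>l. norm (real (geo \<delta> l) * Q (C * geo \<delta> l) (\<eta> * scl (geo \<delta> l)))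
    \<le> 2 / \<delta> * (\<Sum>n\<in>{geo \<delta> l..<geo \<delta> (Suc l)}. g n)) sequentially"
    using eventually_geo[OF assms(3), of "max 3 (2 * (1 + \<delta>) / \<delta>)"]
  proof eventually_elim
    case (elim l)
    define N where "N = geo \<delta> l"
    define N' where "N' = geo \<delta> (Suc l)"
    define v where "v = Q (C * N) (\<eta> * scl N)"
    have N3: "3 \<le> N" using elim by (simp add: N_def)
    have dN: "2 * (1 + \<delta>) \<le> \<delta> * real N" using elim assms by (simp add: N_def field_simps)
    have N': "real N' \<le> (1 + 2 * \<delta>) * real N" "\<delta> * real N \<le> real N' - real N + 1"
      unfolding N'_def N_def using dN assms by (intro geo_Suc; simp add: N_def)+
    have "1 \<le> \<delta> / 2 * real N" using dN assms by simp
    then have cnt: "\<delta> / 2 * real N \<le> real N' - real N" using N'(2) by (simp add: field_simps)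
    have vg: "v \<le> g n" if "n \<in> {N..<N'}" for n
    proof -
      have "real n \<le> real N'" using that by simp
      also note N'(1)
      also have "(1 + 2 * \<delta>) * real N \<le> (1 + 1) * real N" using assms by (intro mult_right_mono) auto
      finally have "scl n \<le> (1 + 1) * scl N" using N3 that by (intro scl_ratio) auto
      then have "\<eta>/2 * scl n \<le> \<eta>/2 * ((1 + 1) * scl N)" using assms by (intro mult_left_mono) auto
      then show ?thesis unfolding v_def g_def using that by (intro Q_mono) auto
    qed
    have "N \<le> N'" using monoD[OF mono_geo[OF assms(3)], of l "Suc l"] by (simp add: N_def N'_def)
    have "\<delta> / 2 * real N * v \<le> (real N' - real N) * v"
      using cnt Q_bounds by (intro mult_right_mono) (auto simp: v_def)
    also have "\<dots> = (\<Sum>n\<in>{N..<N'}. v)" using \<open>N \<le> N'\<close> by (simp add: of_nat_diff)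
    also have "\<dots> \<le> (\<Sum>n\<in>{N..<N'}. g n)" using vg by (intro sum_mono)
    finally have "real N * v \<le> 2 / \<delta> * (\<Sum>n\<in>{N..<N'}. g n)" using assms by (simp add: field_simps)
    then show ?case using Q_bounds by (simp add: v_def N_def N'_def)
  qed
  ultimately show ?thesis by (rule summable_comparison_test_ev[rotated])
qed

section \<open>From block events to almost sure convergence\<close>

context iid_array
begin

lemma Wmax_set: "{\<bar>\<Sum>k=1..n. X k i \<omega> * X k j \<omega>\<bar> | i j. 1 \<le> i \<and> i < j \<and> j \<le> p n}
   = (\<lambda>(i, j). \<bar>\<Sum>k=1..n. Z k i j \<omega>\<bar>) ` pairs (p n)"
  by (auto simp: pairs_def Z_def image_iff)

lemma Wmax_le:
  assumes "0 \<le> b" "\<And>i j. 1 \<le> i \<Longrightarrow> i < j \<Longrightarrow> j \<le> p n \<Longrightarrow> \<bar>\<Sum>k=1..n. Z k i j \<omega>\<bar> \<le> b"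
  shows "Wmax X p n \<omega> \<le> b"
proof -
  have "finite (insert 0 ((\<lambda>(i, j). \<bar>\<Sum>k=1..n. Z k i j \<omega>\<bar>) ` pairs (p n)))" by simp
  then show ?thesis
    unfolding Wmax_def Wmax_set using assms by (subst Max_le_iff) (auto simp: pairs_def)
qed

lemma Wmax_ge:
  assumes "1 \<le> i" "i < j" "j \<le> p n"
  shows "\<bar>\<Sum>k=1..n. Z k i j \<omega>\<bar> \<le> Wmax X p n \<omega>"
proof -
  have "finite (insert 0 ((\<lambda>(i, j). \<bar>\<Sum>k=1..n. Z k i j \<omega>\<bar>) ` pairs (p n)))" by simp
  then show ?thesis
    unfolding Wmax_def Wmax_set by (rule Max_ge) (use assms in \<open>auto simp: pairs_def\<close>)
qed

end

context iid_array_std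
begin

text \<open>The first Borel--Cantelli lemma is applied to the exceptional events of the blocks. Each
  \<open>n\<close> lies in one block, whose good event sandwiches the maximum at \<open>n\<close>
  between bounds in terms of \<open>scl N\<close>.\<close>

lemma Wmax_AE_close:
  assumes Q: "summable (\<lambda>n. Q n (scl n))" and \<epsilon>: "0 < \<epsilon>" "\<epsilon> \<le> 1/32"
    and p_pos: "\<And>n. p n \<ge> 1"
    and c: "0 < c1" "0 < c2" "\<And>n. n \<ge> 1 \<Longrightarrow> c1 \<le> real n / real (p n) \<and> real n / real (p n) \<le> c2"
  shows "AE \<omega> in M. eventually (\<lambda>n. \<bar>Wmax X p n \<omega> / scl n - 2\<bar> \<le> 6 * \<epsilon>) sequentially"
proof -
  \<comment> \<open>Within a block \<open>n \<le> 2 * N\<close>, so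
    \<open>p n \<le> n / c1 \<le> C * N\<close>; likewise
    \<open>2 * (N div q) \<le> n / c2 \<le> p n\<close> by the choice of \<open>q\<close>.\<close>
  define C where "C = max 2 (nat \<lceil>2 / c1\<rceil>)"
  define q where "q = max 1 (nat \<lceil>2 * c2\<rceil>)"
  \<comment> \<open>Consecutive members of \<open>geo \<delta>\<close> eventually have ratio at most
    \<open>1 + 2 * \<delta>\<close>, which is the ratio \<open>1 + \<epsilon>^2/8\<close> of
    \<open>block_event\<close>.\<close>
  define \<delta> where "\<delta> = \<epsilon>\<^sup>2 / 16"
  have C: "2 \<le> C" "2 / c1 \<le> real C" and q: "1 \<le> q" "2 * c2 \<le> real q"
    unfolding C_def q_def by (auto intro: max.coboundedI2 order_trans[OF real_nat_ceiling_ge])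
  have "\<epsilon>\<^sup>2 \<le> 1" using \<epsilon> by (intro power_le_one) auto
  then have \<delta>: "0 < \<delta>" "\<delta> \<le> 1/2" using \<epsilon> by (auto simp: \<delta>_def)
  define good where "good N \<omega> \<longleftrightarrow> (\<forall>n. N \<le> n \<longrightarrow> real n \<le> (1 + \<epsilon>\<^sup>2/8) * real N \<longrightarrow>
       (\<forall>i j. 1 \<le> i \<longrightarrow> i < j \<longrightarrow> j \<le> C * N \<longrightarrow> \<bar>\<Sum>k=1..n. Z k i j \<omega>\<bar> \<le> (2 + 2 * \<epsilon>) * scl N) \<and>
       (\<exists>i j. 1 \<le> i \<and> i < j \<and> j \<le> 2 * (N div q) \<and> (2 - 4 * \<epsilon>) * scl N \<le> \<bar>\<Sum>k=1..n. Z k i j \<omega>\<bar>))" for N \<omega>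
  obtain K where "eventually (\<lambda>N. \<exists>E\<in>events.
     prob E \<le> 2 * real N * Q (C * N) (\<epsilon>/64 * scl N) + K * exp (- 2 * \<epsilon> * ln (real N)) \<and>
     (\<forall>\<omega>\<in>space M - E. good N \<omega>)) sequentially"
    using block_event[OF \<epsilon> C(1) q(1)] unfolding good_def by blast
  then obtain N0 where "\<forall>N\<in>{N0..}. \<exists>E. E \<in> events \<and>
     prob E \<le> 2 * real N * Q (C * N) (\<epsilon>/64 * scl N) + K * exp (- 2 * \<epsilon> * ln (real N)) \<and>
     (\<forall>\<omega>\<in>space M - E. good N \<omega>)"
    unfolding eventually_sequentially Bex_def by (metis atLeast_iff)
  then obtain E where E: "\<And>N. N0 \<le> N \<Longrightarrow> E N \<in> events"
     "\<And>N. N0 \<le> N \<Longrightarrow> prob (E N) \<le> 2 * real N * Q (C * N) (\<epsilon>/64 * scl N) + K * exp (- 2 * \<epsilon> * ln (real N))"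
     "\<And>N \<omega>. N0 \<le> N \<Longrightarrow> \<omega> \<in> space M - E N \<Longrightarrow> good N \<omega>"
    using bchoice[of "{N0..}"] by (metis atLeast_iff)
  obtain L0 where L0: "\<And>l. L0 \<le> l \<Longrightarrow> max (real N0) (max 3 ((1 + \<delta>) / \<delta>)) \<le> real (geo \<delta> l)"
    using eventually_geo[OF \<delta>(1)] unfolding eventually_sequentially by meson
  define F where "F l = (if L0 \<le> l then E (geo \<delta> l) else {})" for l
  have F: "F l \<in> events" for l using E(1) L0[of l] by (auto simp: F_def)
  have "summable (\<lambda>l. 2 * (real (geo \<delta> l) * Q (C * geo \<delta> l) (\<epsilon>/64 * scl (geo \<delta> l))) + K * exp (- (2 * \<epsilon>) * ln (real (geo \<delta> l))))"
    using Q \<epsilon> \<delta> by (intro summable_add summable_mult summable_Q_geo summable_exp_geo) auto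
  then have "summable (\<lambda>l. prob (F l))"
  proof (rule summable_comparison_test_ev[rotated])
    show "eventually (\<lambda>l. norm (prob (F l)) \<le> 2 * (real (geo \<delta> l) * Q (C * geo \<delta> l) (\<epsilon>/64 * scl (geo \<delta> l)))
        + K * exp (- (2 * \<epsilon>) * ln (real (geo \<delta> l)))) sequentially"
      using eventually_ge_at_top[of L0]
    proof eventually_elim
      case (elim l)
      then have "N0 \<le> geo \<delta> l" using L0[of l] by simp
      then show ?case using E(2)[of "geo \<delta> l"] elim by (simp add: F_def mult.assoc)
    qed
  qed
  then have "AE \<omega> in M. eventually (\<lambda>l. \<omega> \<in> space M - F l) sequentially"
    using F by (intro borel_cantelli_AE1) (auto simp: less_top[symmetric])
  then show ?thesis
  proof eventually_elim
    case (elim \<omega>)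
    then obtain L1 where L1: "\<And>l. L1 \<le> l \<Longrightarrow> \<omega> \<in> space M - F l" unfolding eventually_sequentially by auto
    define L where "L = max L0 L1"
    show ?case
    proof (rule eventually_sequentiallyI[of "geo \<delta> L"])
      fix n assume "geo \<delta> L \<le> n"
      from geo_cover[OF \<delta>(1) this] obtain l where l: "L \<le> l" "geo \<delta> l \<le> n" "n < geo \<delta> (Suc l)" by blast
      define N where "N = geo \<delta> l"
      have Nb: "real N0 \<le> real N" "3 \<le> real N" "(1 + \<delta>) / \<delta> \<le> real N" using L0[of l] l by (auto simp: N_def L_def)
      then have N3: "3 \<le> N" "N0 \<le> N" by simp_all
      have Nn: "N \<le> n" using l by (simp add: N_def)
      have "1 + \<delta> \<le> \<delta> * real N" using Nb(3) \<delta> by (simp add: field_simps)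
      then have "real (geo \<delta> (Suc l)) \<le> (1 + 2 * \<delta>) * real N" using geo_Suc(1)[OF \<delta>(1)] by (simp add: N_def)
      then have nN: "real n \<le> (1 + \<epsilon>\<^sup>2/8) * real N" using l(3) by (simp add: \<delta>_def)
      have "\<omega> \<in> space M - E N" using L1[of l] l by (simp add: F_def L_def N_def)
      then have "good N \<omega>" using E(3) N3 by blast
      then have up: "\<And>i j. 1 \<le> i \<Longrightarrow> i < j \<Longrightarrow> j \<le> C * N \<Longrightarrow> \<bar>\<Sum>k=1..n. Z k i j \<omega>\<bar> \<le> (2 + 2 * \<epsilon>) * scl N"
        and lo: "\<exists>i j. 1 \<le> i \<and> i < j \<and> j \<le> 2 * (N div q) \<and> (2 - 4 * \<epsilon>) * scl N \<le> \<bar>\<Sum>k=1..n. Z k i j \<omega>\<bar>"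
        using Nn nN unfolding good_def by blast+
      have sN: "0 < scl N" "0 < scl n" using N3 Nn by (auto intro!: scl_pos)
      have sNn: "scl N \<le> scl n" using Nn by (rule scl_mono)
      have snN: "scl n \<le> (1 + \<epsilon>) * scl N"
      proof -
        have "scl n \<le> (1 + \<epsilon>\<^sup>2/8) * scl N" using N3 Nn nN by (intro scl_ratio) auto
        also have "\<dots> \<le> (1 + \<epsilon>) * scl N"
        proof (intro mult_right_mono)
          have "\<epsilon> * \<epsilon> \<le> \<epsilon> * 1" using \<epsilon> by (intro mult_left_mono) auto
          then show "1 + \<epsilon>\<^sup>2/8 \<le> 1 + \<epsilon>" using \<epsilon> by (simp add: power2_eq_square)
        qed simp
        finally show ?thesis .
      qed
      have pn: "0 < real (p n)" using p_pos[of n] by simp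
      have cn: "c1 * real (p n) \<le> real n" "real n \<le> c2 * real (p n)"
        using c(3)[of n] N3 Nn pn by (auto simp: field_simps)
      have pC: "p n \<le> C * N"
      proof -
        have "real (p n) \<le> real n / c1" using cn(1) c(1) by (simp add: field_simps)
        also have "\<dots> \<le> (2 * real N) / c1"
        proof (rule divide_right_mono)
          have "(1 + \<epsilon>\<^sup>2/8) * real N \<le> 2 * real N" using \<open>\<epsilon>\<^sup>2 \<le> 1\<close> by (intro mult_right_mono) auto
          then show "real n \<le> 2 * real N" using nN by linarith
        qed (use c in auto)
        also have "\<dots> = (2 / c1) * real N" by simp
        also have "\<dots> \<le> real C * real N" using C(2) by (intro mult_right_mono) auto
        finally have "real (p n) \<le> real (C * N)" by simp
        then show ?thesis by (simp only: of_nat_le_iff)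
      qed
      have pq: "2 * (N div q) \<le> p n"
      proof -
        have "2 * c2 * real (N div q) \<le> real q * real (N div q)" using q(2) by (intro mult_right_mono) auto
        also have "\<dots> = real (q * (N div q))" by simp
        also have "\<dots> \<le> real n" using Nn times_div_less_eq_dividend[of q N] by (intro of_nat_mono) linarith
        also have "\<dots> \<le> c2 * real (p n)" by (rule cn(2))
        finally have "c2 * (2 * real (N div q)) \<le> c2 * real (p n)" by (simp add: mult_ac)
        then have "real (2 * (N div q)) \<le> real (p n)" using c(2) by simp
        then show ?thesis by (simp only: of_nat_le_iff)
      qed
      have "Wmax X p n \<omega> \<le> (2 + 2 * \<epsilon>) * scl N"
        using pC sN \<epsilon> by (intro Wmax_le up) auto
      also have "\<dots> \<le> (2 + 2 * \<epsilon>) * scl n" using sNn \<epsilon> by (intro mult_left_mono) auto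
      finally have "Wmax X p n \<omega> / scl n \<le> 2 + 2 * \<epsilon>" using sN by (simp add: field_simps)
      moreover have "2 - 6 * \<epsilon> \<le> Wmax X p n \<omega> / scl n"
      proof -
        obtain i j where ij: "1 \<le> i" "i < j" "j \<le> 2 * (N div q)" "(2 - 4 * \<epsilon>) * scl N \<le> \<bar>\<Sum>k=1..n. Z k i j \<omega>\<bar>"
          using lo by blast
        have "(2 - 6 * \<epsilon>) * scl n \<le> (2 - 6 * \<epsilon>) * ((1 + \<epsilon>) * scl N)" using snN \<epsilon> by (intro mult_left_mono) auto
        also have "\<dots> = ((2 - 6 * \<epsilon>) * (1 + \<epsilon>)) * scl N" by simp
        \<comment> \<open>The 6 pays for passing from \<open>scl N\<close> to \<open>scl n\<close>:
          the product of \<open>2 - 6 * \<epsilon>\<close> and \<open>1 + \<epsilon>\<close> is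
          \<open>2 - 4 * \<epsilon> - 6 * \<epsilon>^2\<close>.\<close>
        also have "\<dots> \<le> (2 - 4 * \<epsilon>) * scl N" using sN by (intro mult_right_mono) (auto simp: algebra_simps)
        also have "\<dots> \<le> Wmax X p n \<omega>" using ij pq by (intro order_trans[OF ij(4)] Wmax_ge) auto
        finally show ?thesis using sN by (simp add: field_simps)
      qed
      ultimately show "\<bar>Wmax X p n \<omega> / scl n - 2\<bar> \<le> 6 * \<epsilon>" using \<epsilon> by linarith
    qed
  qed
qed

lemma Wmax_tendsto:
  assumes Q: "summable (\<lambda>n. Q n (scl n))"
    and p_pos: "\<And>n. p n \<ge> 1"
    and c: "0 < c1" "0 < c2" "\<And>n. n \<ge> 1 \<Longrightarrow> c1 \<le> real n / real (p n) \<and> real n / real (p n) \<le> c2"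
  shows "AE \<omega> in M. (\<lambda>n. Wmax X p n \<omega> / scl n) \<longlonglongrightarrow> 2"
proof -
  \<comment> \<open>The values \<open>1 / (m + 32)\<close> form a countable family tending to 0 that
    respects the bound 1/32.\<close>
  have "AE \<omega> in M. eventually (\<lambda>n. \<bar>Wmax X p n \<omega> / scl n - 2\<bar> \<le> 6 * (1 / (real m + 32))) sequentially" for m
    by (rule Wmax_AE_close[OF Q _ _ p_pos c]) (auto simp: field_simps)
  then have "AE \<omega> in M. \<forall>m. eventually (\<lambda>n. \<bar>Wmax X p n \<omega> / scl n - 2\<bar> \<le> 6 * (1 / (real m + 32))) sequentially"
    by (subst AE_all_countable) auto
  then show ?thesis
  proof eventually_elim
    case (elim \<omega>)
    show ?case
    proof (rule tendstoI)
      fix e :: real assume "0 < e"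
      obtain m where m: "6 / e < real m" using reals_Archimedean2 by blast
      have "6 * (1 / (real m + 32)) < e"
      proof -
        have "6 < e * real m" using m \<open>0 < e\<close> by (simp add: field_simps)
        then have "6 < e * (real m + 32)" using \<open>0 < e\<close> by (simp add: distrib_left)
        then show ?thesis by (simp add: field_simps)
      qed
      with elim show "eventually (\<lambda>n. dist (Wmax X p n \<omega> / scl n) 2 < e) sequentially"
        by (auto simp: dist_real_def elim!: eventually_mono dest!: spec[of _ m])
    qed
  qed
qed

end

section \<open>Necessity\<close>

lemma (in prob_space) second_moment_indep_sum:
  fixes Y :: "nat \<Rightarrow> 'a \<Rightarrow> real"
  assumes "finite K" and ind: "indep_vars (\<lambda>_. borel) Y K"
    and Y: "\<And>k. k \<in> K \<Longrightarrow> integrable M (Y k)" "\<And>k. k \<in> K \<Longrightarrow> expectation (Y k) = 0"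
      "\<And>k. k \<in> K \<Longrightarrow> integrable M (\<lambda>\<omega>. (Y k \<omega>)\<^sup>2)" "\<And>k. k \<in> K \<Longrightarrow> expectation (\<lambda>\<omega>. (Y k \<omega>)\<^sup>2) \<le> v"
  shows "integrable M (\<lambda>\<omega>. (\<Sum>k\<in>K. Y k \<omega>)\<^sup>2)" "expectation (\<lambda>\<omega>. (\<Sum>k\<in>K. Y k \<omega>)\<^sup>2) \<le> real (card K) * v"
proof -
  have kl: "integrable M (\<lambda>\<omega>. Y k \<omega> * Y l \<omega>) \<and> expectation (\<lambda>\<omega>. Y k \<omega> * Y l \<omega>) = (if k = l then expectation (\<lambda>\<omega>. (Y k \<omega>)\<^sup>2) else 0)"
    if "k \<in> K" "l \<in> K" for k l
  proof (cases "k = l")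
    case True then show ?thesis using Y that by (simp add: power2_eq_square[symmetric])
  next
    case False
    have iv: "indep_vars (\<lambda>_. borel) Y {k, l}" by (rule indep_vars_subset[OF ind]) (use that in auto)
    have eq: "(\<Prod>i\<in>{k, l}. Y i \<omega>) = Y k \<omega> * Y l \<omega>" for \<omega> using False by simp
    have "integrable M (\<lambda>\<omega>. \<Prod>i\<in>{k, l}. Y i \<omega>)"
      by (rule indep_vars_integrable[OF _ iv]) (use Y that in auto)
    moreover have "expectation (\<lambda>\<omega>. \<Prod>i\<in>{k, l}. Y i \<omega>) = (\<Prod>i\<in>{k, l}. expectation (Y i))"
      by (rule indep_vars_lebesgue_integral[OF _ iv]) (use Y that in auto)
    ultimately show ?thesis unfolding eq using False Y that by simp
  qed
  have sq: "(\<Sum>k\<in>K. Y k \<omega>)\<^sup>2 = (\<Sum>k\<in>K. \<Sum>l\<in>K. Y k \<omega> * Y l \<omega>)" for \<omega>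
    by (simp add: power2_eq_square sum_product)
  show "integrable M (\<lambda>\<omega>. (\<Sum>k\<in>K. Y k \<omega>)\<^sup>2)"
    unfolding sq using kl by (intro Bochner_Integration.integrable_sum) auto
  have "expectation (\<lambda>\<omega>. (\<Sum>k\<in>K. Y k \<omega>)\<^sup>2) = (\<Sum>k\<in>K. \<Sum>l\<in>K. expectation (\<lambda>\<omega>. Y k \<omega> * Y l \<omega>))"
    unfolding sq using kl by (simp add: Bochner_Integration.integral_sum Bochner_Integration.integrable_sum)
  also have "\<dots> = (\<Sum>k\<in>K. \<Sum>l\<in>K. if k = l then expectation (\<lambda>\<omega>. (Y k \<omega>)\<^sup>2) else 0)"
    using kl by (intro sum.cong) auto
  also have "\<dots> = (\<Sum>k\<in>K. expectation (\<lambda>\<omega>. (Y k \<omega>)\<^sup>2))" using \<open>finite K\<close> by simp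
  also have "\<dots> \<le> real (card K) * v" using Y(4) by (intro sum_bounded_above) auto
  finally show "expectation (\<lambda>\<omega>. (\<Sum>k\<in>K. Y k \<omega>)\<^sup>2) \<le> real (card K) * v" .
qed

context iid_array
begin

text \<open>A contradiction along a subsequence is enough, so second moments suffice: at
  \<open>n = j^2\<close> Chebyshev's inequality gives deviation probabilities O(1/j^2), and by
  Borel--Cantelli the sum stays above \<open>n * \<mu> / 2\<close>.\<close>

lemma mean_zero:
  assumes int1: "integrable M (X 1 1)" and int2: "integrable M (\<lambda>\<omega>. (X 1 1 \<omega>)\<^sup>2)"
    and ae: "AE \<omega> in M. eventually (\<lambda>n. \<bar>\<Sum>k=1..n. Z k 1 2 \<omega>\<bar> \<le> 3 * scl n) sequentially"
  shows "expectation (X 1 1) = 0"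
proof (rule ccontr)
  assume "expectation (X 1 1) \<noteq> 0"
  define \<mu> where "\<mu> = (expectation (X 1 1))\<^sup>2"
  define v where "v = (expectation (\<lambda>\<omega>. (X 1 1 \<omega>)\<^sup>2))\<^sup>2"
  define Y where "Y k \<omega> = Z k 1 2 \<omega> - \<mu>" for k \<omega>
  define B where "B n = {\<omega>\<in>space M. (real n * \<mu> / 2)\<^sup>2 \<le> (\<Sum>k=1..n. Y k \<omega>)\<^sup>2}" for n
  have \<mu>: "0 < \<mu>" using \<open>expectation (X 1 1) \<noteq> 0\<close> by (simp add: \<mu>_def)
  have Zm: "integrable M (Z k 1 2)" "expectation (Z k 1 2) = \<mu>" "integrable M (\<lambda>\<omega>. (Z k 1 2 \<omega>)\<^sup>2)"
    "expectation (\<lambda>\<omega>. (Z k 1 2 \<omega>)\<^sup>2) = v" if "1 \<le> k" for k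
    using moment_Z[of k 1 2 "\<lambda>x. x"] moment_Z[of k 1 2 "\<lambda>x. x\<^sup>2"] int1 int2 that
    by (simp_all add: \<mu>_def v_def power_mult_distrib)
  have Y2: "(Y k \<omega>)\<^sup>2 = (Z k 1 2 \<omega>)\<^sup>2 - 2 * \<mu> * Z k 1 2 \<omega> + \<mu>\<^sup>2" for k \<omega>
    by (simp add: Y_def power2_eq_square algebra_simps)
  have Ym: "integrable M (Y k)" "expectation (Y k) = 0" "integrable M (\<lambda>\<omega>. (Y k \<omega>)\<^sup>2)"
    "expectation (\<lambda>\<omega>. (Y k \<omega>)\<^sup>2) \<le> v" if "1 \<le> k" for k
  proof -
    show "integrable M (Y k)" "expectation (Y k) = 0" unfolding Y_def using Zm[OF that] by (simp_all add: prob_space)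
    show "integrable M (\<lambda>\<omega>. (Y k \<omega>)\<^sup>2)" unfolding Y2 using Zm[OF that] by simp
    show "expectation (\<lambda>\<omega>. (Y k \<omega>)\<^sup>2) \<le> v" unfolding Y2 using Zm[OF that] by (simp add: prob_space power2_eq_square)
  qed
  have ind: "indep_vars (\<lambda>_. borel) Y {1..}"
  proof -
    have "indep_vars (\<lambda>_. borel) (\<lambda>k \<omega>. (\<lambda>x. x 1 * x 2 - \<mu>) (\<lambda>a\<in>{1,2}. X k a \<omega>)) {1..}"
      by (rule indep_rows) auto
    then show ?thesis by (simp add: Y_def[abs_def] Z_def)
  qed
  have sm: "integrable M (\<lambda>\<omega>. (\<Sum>k=1..n. Y k \<omega>)\<^sup>2)" "expectation (\<lambda>\<omega>. (\<Sum>k=1..n. Y k \<omega>)\<^sup>2) \<le> real n * v" for n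
    using second_moment_indep_sum[of "{1..n}" Y v, OF _ indep_vars_subset[OF ind]] Ym by auto
  have mB: "B n \<in> events" for n
    unfolding B_def using borel_measurable_integrable[OF sm(1)[of n]] by measurable
  have pB: "prob (B n) \<le> 4 * v / \<mu>\<^sup>2 / real n" if "1 \<le> n" for n
  proof -
    have c: "0 < (real n * \<mu> / 2)\<^sup>2" using \<mu> that by simp
    have "prob (B n) \<le> expectation (\<lambda>\<omega>. (\<Sum>k=1..n. Y k \<omega>)\<^sup>2) / (real n * \<mu> / 2)\<^sup>2"
      unfolding B_def using sm(1)[of n] c by (intro integral_Markov_inequality_measure[where A="{}"]) auto
    also have "\<dots> \<le> real n * v / (real n * \<mu> / 2)\<^sup>2" using sm(2) c by (intro divide_right_mono) auto
    also have "\<dots> = 4 * v / \<mu>\<^sup>2 / real n" using that by (simp add: power2_eq_square field_simps)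
    finally show ?thesis .
  qed
  have "summable (\<lambda>j. 4 * v / \<mu>\<^sup>2 * inverse (real j ^ 2))"
    by (intro summable_mult inverse_power_summable) simp
  then have "summable (\<lambda>j. prob (B (j\<^sup>2)))"
  proof (rule summable_comparison_test_ev[rotated])
    show "eventually (\<lambda>j. norm (prob (B (j\<^sup>2))) \<le> 4 * v / \<mu>\<^sup>2 * inverse (real j ^ 2)) sequentially"
      using eventually_ge_at_top[of 1]
    proof eventually_elim
      case (elim j)
      then have "1 \<le> j\<^sup>2" by simp
      from pB[OF this] show ?case by (simp add: divide_inverse)
    qed
  qed
  then have "AE \<omega> in M. eventually (\<lambda>j. \<omega> \<in> space M - B (j\<^sup>2)) sequentially"
    using mB by (intro borel_cantelli_AE1) (auto simp: less_top[symmetric])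
  with ae have "AE \<omega> in M. False"
  proof eventually_elim
    case (elim \<omega>)
    have sqf: "filterlim (\<lambda>j::nat. j\<^sup>2) at_top sequentially"
      by (rule filterlim_at_top_mono[OF filterlim_ident]) (auto simp: power2_eq_square)
    have "eventually (\<lambda>n. 3 * scl n < real n * \<mu> / 2) sequentially"
      unfolding scl_def using \<mu> by real_asymp
    then have e1: "eventually (\<lambda>j. 3 * scl (j\<^sup>2) < real (j\<^sup>2) * \<mu> / 2) sequentially"
      by (rule eventually_compose_filterlim[OF _ sqf])
    have e2: "eventually (\<lambda>j. \<bar>\<Sum>k=1..j\<^sup>2. Z k 1 2 \<omega>\<bar> \<le> 3 * scl (j\<^sup>2)) sequentially"
      using elim(1) by (rule eventually_compose_filterlim[OF _ sqf])
    have "eventually (\<lambda>j. False) sequentially"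
      using e1 e2 elim(2)
    proof eventually_elim
      case (elim j)
      define n where "n = j\<^sup>2"
      have "\<not> (real n * \<mu> / 2)\<^sup>2 \<le> (\<Sum>k=1..n. Y k \<omega>)\<^sup>2" using elim(3) by (auto simp: B_def n_def)
      then have "\<bar>\<Sum>k=1..n. Y k \<omega>\<bar> < \<bar>real n * \<mu> / 2\<bar>" by (simp only: abs_le_square_iff[symmetric] not_le)
      then have lt: "\<bar>\<Sum>k=1..n. Y k \<omega>\<bar> < real n * \<mu> / 2" using \<mu> by simp
      have "(\<Sum>k=1..n. Y k \<omega>) = (\<Sum>k=1..n. Z k 1 2 \<omega>) - real n * \<mu>" by (simp add: Y_def sum_subtractf)
      then show False using lt elim(1,2) unfolding n_def[symmetric] by linarith
    qed
    then show False by simp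
  qed
  then show False by simp
qed

lemma summable_Q_of_Wmax:
  assumes lim: "AE \<omega> in M. (\<lambda>n. Wmax X p n \<omega> / scl n) \<longlonglongrightarrow> 2"
    and p_pos: "\<And>n. p n \<ge> 1"
    and c: "0 < c2" "\<And>n. n \<ge> 1 \<Longrightarrow> real n / real (p n) \<le> c2"
  shows "summable (\<lambda>n. Q n (scl n))"
proof -
  define q where "q = max 1 (nat \<lceil>2 * c2\<rceil>)"
  have q: "1 \<le> q" "2 * c2 \<le> real q"
    unfolding q_def by (auto intro: max.coboundedI2 order_trans[OF real_nat_ceiling_ge])
  have pn: "real n \<le> c2 * real (p n)" if "1 \<le> n" for n
    using c(2)[OF that] p_pos[of n] by (simp add: field_simps)
  \<comment> \<open>Both the sums to row \<open>n\<close> and to row \<open>n - 1\<close> must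
    involve the two columns of a product; \<open>q \<ge> 2 * c2\<close> and
    \<open>n \<le> 2 * (n - 1)\<close> ensure it.\<close>
  have cols: "n div q \<le> p n" "n div q \<le> p (n - 1)" if "2 \<le> n" for n
  proof -
    have "2 * c2 * real (n div q) \<le> real q * real (n div q)" using q(2) by (intro mult_right_mono) auto
    also have "\<dots> = real (q * (n div q))" by simp
    also have "\<dots> \<le> real n" by (intro of_nat_mono) simp
    finally have *: "c2 * (2 * real (n div q)) \<le> real n" by simp
    have "real n \<le> 2 * real (n - 1)" using that by (simp add: of_nat_diff)
    then have "c2 * (2 * real (n div q)) \<le> 2 * (c2 * real (p (n - 1)))"
      using * pn[of "n - 1"] that by linarith
    then have "c2 * real (n div q) \<le> c2 * real (p (n - 1))" by simp
    then show "n div q \<le> p (n - 1)" using c(1) by simp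
    have "c2 * (2 * real (n div q)) \<le> c2 * real (p n)" using * pn[of n] that by linarith
    then have "2 * real (n div q) \<le> real (p n)" using c(1) by simp
    then show "n div q \<le> p n" by linarith
  qed
  define A where "A n = (if n = 0 then {} else \<Union>(i, j)\<in>pairs (n div q). {\<omega>\<in>space M. 5 * scl n \<le> \<bar>Z n i j \<omega>\<bar>})" for n
  have mA: "A n \<in> events" for n unfolding A_def using row_event[of n] by auto
  \<comment> \<open>With tolerance 2/5 two consecutive maxima add up to at most
    \<open>24/5 * scl n\<close>, short of the threshold 5 in \<open>A n\<close>.\<close>
  have ae: "AE \<omega> in M. eventually (\<lambda>n. \<bar>Wmax X p n \<omega> / scl n - 2\<bar> < 2/5) sequentially"
    using lim by eventually_elim (auto dest!: tendstoD[where e="2/5"] simp: dist_real_def)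
  then have "AE \<omega> in M. eventually (\<lambda>n. \<omega> \<notin> A n) sequentially"
  proof eventually_elim
    case (elim \<omega>)
    then obtain n0 where n0: "\<And>n. n0 \<le> n \<Longrightarrow> \<bar>Wmax X p n \<omega> / scl n - 2\<bar> < 2/5"
      unfolding eventually_sequentially by auto
    have W: "Wmax X p n \<omega> \<le> 12/5 * scl n" if "n0 \<le> n" "2 \<le> n" for n
    proof -
      have "Wmax X p n \<omega> / scl n \<le> 12/5" using n0[OF that(1)] by linarith
      then show ?thesis using scl_pos[OF that(2)] by (simp add: field_simps)
    qed
    show ?case
    proof (rule eventually_sequentiallyI[of "max (Suc n0) 3"])
      fix n assume n: "max (Suc n0) 3 \<le> n"
      then have n2: "2 \<le> n" by simp
      show "\<omega> \<notin> A n"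
      proof
        assume "\<omega> \<in> A n"
        then obtain i j where ij: "1 \<le> i" "i < j" "j \<le> n div q" "5 * scl n \<le> \<bar>Z n i j \<omega>\<bar>"
          by (auto simp: A_def pairs_def split: if_splits)
        have "\<bar>\<Sum>k=1..n. Z k i j \<omega>\<bar> \<le> Wmax X p n \<omega>" using ij order_trans[OF ij(3) cols(1)[OF n2]] by (intro Wmax_ge)
        also have "\<dots> \<le> 12/5 * scl n" using n by (intro W) auto
        finally have 1: "\<bar>\<Sum>k=1..n. Z k i j \<omega>\<bar> \<le> 12/5 * scl n" .
        have "\<bar>\<Sum>k=1..n-1. Z k i j \<omega>\<bar> \<le> Wmax X p (n - 1) \<omega>" using ij order_trans[OF ij(3) cols(2)[OF n2]] by (intro Wmax_ge)
        also have "\<dots> \<le> 12/5 * scl (n - 1)" using n by (intro W) auto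
        also have "\<dots> \<le> 12/5 * scl n" by (intro mult_left_mono scl_mono) auto
        finally have 2: "\<bar>\<Sum>k=1..n-1. Z k i j \<omega>\<bar> \<le> 12/5 * scl n" .
        have "n = Suc (n - 1)" using n by simp
        then have "(\<Sum>k=1..n. Z k i j \<omega>) = (\<Sum>k=1..n-1. Z k i j \<omega>) + Z n i j \<omega>"
          by (metis sum.nat_ivl_Suc' sum.cl_ivl_Suc add.commute One_nat_def Suc_le_mono le0)
        moreover have "0 < scl n" using n by (intro scl_pos) auto
        ultimately show False using 1 2 ij(4) by linarith
      qed
    qed
  qed
  moreover have "indep_events (\<lambda>n. space M - A n) {1..}"
  proof -
    \<comment> \<open>\<open>A n\<close> is an event of row \<open>n\<close> alone; as a predicate
      on the row it falls under \<open>indep_rows\<close>.\<close>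
    define f where "f n x = (\<exists>r\<in>pairs (n div q). 5 * scl n \<le> \<bar>x (fst r) * x (snd r)\<bar>)" for n and x :: "nat \<Rightarrow> real"
    have mf: "f n \<in> measurable (PiM {1..} (\<lambda>_. borel)) (count_space UNIV)" for n
    proof -
      have "Measurable.pred (PiM {1..} (\<lambda>_. borel)) (\<lambda>x. 5 * scl n \<le> \<bar>x (fst r) * x (snd r) :: real\<bar>)" if "r \<in> pairs (n div q)" for r
      proof -
        have [measurable]: "(\<lambda>x. x (fst r)) \<in> borel_measurable (PiM {1..} (\<lambda>_. borel :: real measure))"
          "(\<lambda>x. x (snd r)) \<in> borel_measurable (PiM {1..} (\<lambda>_. borel :: real measure))"
          using that by (auto simp: pairs_def)
        show ?thesis by measurable
      qed
      then show ?thesis unfolding f_def by (intro pred_intros_finite) auto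
    qed
    have "indep_vars (\<lambda>_. count_space UNIV) (\<lambda>k \<omega>. f k (\<lambda>j\<in>{1..}. X k j \<omega>)) {1..}"
      by (rule indep_rows[OF order_refl mf])
    then have "indep_events (\<lambda>n. {\<omega>\<in>space M. \<not> f n (\<lambda>j\<in>{1..}. X n j \<omega>)}) {1..}"
      by (rule indep_eventsI_indep_vars) auto
    moreover have "{\<omega>\<in>space M. \<not> f n (\<lambda>j\<in>{1..}. X n j \<omega>)} = space M - A n" if "n \<in> {1..}" for n
      using that by (fastforce simp: f_def A_def pairs_def Z_def)
    ultimately show ?thesis unfolding indep_events_def_alt by (subst (asm) indep_sets_cong) auto
  qed
  ultimately have "summable (\<lambda>n. prob (A n))" using mA by (intro borel_cantelli_2) auto
  moreover have "prob (A n) = Q (n div q) (5 * scl n)" for n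
  proof (cases "n = 0")
    case True
    have "pairs 0 = {}" by (auto simp: pairs_def)
    then show ?thesis using True by (simp add: A_def Q_def)
  next
    case False
    then have "1 \<le> n" by simp
    from Q_row[OF this] False show ?thesis by (simp only: A_def if_False)
  qed
  ultimately have "summable (\<lambda>n. Q (n div q) (5 * scl n))" by simp
  from Q_summable_scale[OF this _ q(1), of 1 1] show ?thesis by simp
qed

text \<open>A positive \<open>t\<close> makes the 0 inserted into the maximum invisible.\<close>

lemma Mmax_event:
  assumes "0 < t"
  shows "{\<omega>\<in>space M. t \<le> Mmax X n \<omega>} = (\<Union>(i, j)\<in>pairs n. {\<omega>\<in>space M. t \<le> \<bar>Z 1 i j \<omega>\<bar>})"
proof -
  have eq: "{\<bar>X 1 i \<omega> * X 1 j \<omega>\<bar> | i j. 1 \<le> i \<and> i < j \<and> j \<le> n} = (\<lambda>(i, j). \<bar>Z 1 i j \<omega>\<bar>) ` pairs n" for \<omega>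
    by (auto simp: pairs_def Z_def image_iff)
  have "t \<le> Mmax X n \<omega> \<longleftrightarrow> (\<exists>(i, j)\<in>pairs n. t \<le> \<bar>Z 1 i j \<omega>\<bar>)" for \<omega>
    unfolding Mmax_def eq using assms by (subst Max_ge_iff) (auto simp: split_beta)
  then show ?thesis by (auto simp: split_beta)
qed

lemma summable_Mmax_iff:
  "summable (\<lambda>n. measure M {\<omega>\<in>space M. Mmax X n \<omega> \<ge> sqrt (real n * ln (real n))}) \<longleftrightarrow> summable (\<lambda>n. Q n (scl n))"
proof (rule summable_cong)
  show "eventually (\<lambda>n. measure M {\<omega>\<in>space M. Mmax X n \<omega> \<ge> sqrt (real n * ln (real n))} = Q n (scl n)) sequentially"
    using eventually_ge_at_top[of 2] by eventually_elim (simp add: Q_def scl_def[symmetric] Mmax_event scl_pos)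
qed

lemma integrable_of_third_moment:
  assumes "integrable M (\<lambda>\<omega>. \<bar>X 1 1 \<omega>\<bar>^3)"
  shows "integrable M (X 1 1)" "integrable M (\<lambda>\<omega>. (X 1 1 \<omega>)\<^sup>2)"
proof -
  have [measurable]: "X 1 1 \<in> borel_measurable M" by simp
  have i: "integrable M (\<lambda>\<omega>. 1 + \<bar>X 1 1 \<omega>\<bar>^3)" using assms by simp
  have le: "\<bar>x\<bar> \<le> 1 + \<bar>x\<bar>^3" "x\<^sup>2 \<le> 1 + \<bar>x\<bar>^3" for x :: real
  proof -
    have "\<bar>x\<bar> ^ 1 \<le> 1 + \<bar>x\<bar>^3 \<and> \<bar>x\<bar> ^ 2 \<le> 1 + \<bar>x\<bar>^3"
    proof (cases "\<bar>x\<bar> \<le> 1")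
      case True
      then have "\<bar>x\<bar> ^ n \<le> 1" "0 \<le> \<bar>x\<bar> ^ n" for n by (simp_all add: power_le_one)
      from this(1)[of 1] this(1)[of 2] this(2)[of 3] show ?thesis by linarith
    next
      case False
      then have "\<bar>x\<bar> ^ 1 \<le> \<bar>x\<bar> ^ 3" "\<bar>x\<bar> ^ 2 \<le> \<bar>x\<bar> ^ 3" by (intro power_increasing; simp)+
      then show ?thesis by linarith
    qed
    then show "\<bar>x\<bar> \<le> 1 + \<bar>x\<bar>^3" "x\<^sup>2 \<le> 1 + \<bar>x\<bar>^3" by auto
  qed
  show "integrable M (X 1 1)" by (rule Bochner_Integration.integrable_bound[OF i]) (use le in auto)
  show "integrable M (\<lambda>\<omega>. (X 1 1 \<omega>)\<^sup>2)" by (rule Bochner_Integration.integrable_bound[OF i]) (use le in auto)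
qed

lemma iid_array_scaled: "iid_array M (\<lambda>k i \<omega>. X k i \<omega> / s)"
proof
  have "indep_vars (\<lambda>_. borel) (\<lambda>p \<omega>. (\<lambda>x. x / s) ((case p of (k, i) \<Rightarrow> X k i) \<omega>)) ({1..} \<times> {1..})"
    by (rule indep_vars_compose2[OF indep]) simp
  moreover have "(\<lambda>(k, i) \<omega>. X k i \<omega> / s) = (\<lambda>p \<omega>. (\<lambda>x. x / s) ((case p of (k, i) \<Rightarrow> X k i) \<omega>))"
    by (auto simp: fun_eq_iff)
  ultimately show "indep_vars (\<lambda>_. borel) (\<lambda>(k, i) \<omega>. X k i \<omega> / s) ({1..} \<times> {1..})"
    by (simp only:)
  fix k i :: nat assume "1 \<le> k" "1 \<le> i"
  have *: "distr M borel (\<lambda>\<omega>. X k' i' \<omega> / s) = distr (distr M borel (X k' i')) borel (\<lambda>x. x / s)" if "1 \<le> k'" "1 \<le> i'" for k' i'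
    using that by (subst distr_distr) (auto simp: comp_def)
  show "distr M borel (\<lambda>\<omega>. X k i \<omega> / s) = distr M borel (\<lambda>\<omega>. X 1 1 \<omega> / s)"
    using *[of k i] *[of 1 1] ident[of k i] \<open>1 \<le> k\<close> \<open>1 \<le> i\<close> by simp
qed

text \<open>The sufficiency direction is applied to the array divided by \<open>sqrt v\<close>. Its
  products are those of \<open>X\<close> divided by \<open>v\<close>, so its summability condition
  is the old one with a rescaled threshold, and its maxima, divided by \<open>scl n\<close>, tend
  both to 2 and to \<open>2 / v\<close>.\<close>

lemma variance_one:
  assumes int1: "integrable M (X 1 1)" and mean: "expectation (X 1 1) = 0"
    and int2: "integrable M (\<lambda>\<omega>. (X 1 1 \<omega>)\<^sup>2)" and int3: "integrable M (\<lambda>\<omega>. \<bar>X 1 1 \<omega>\<bar>^3)"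
    and Q: "summable (\<lambda>n. Q n (scl n))"
    and lim: "AE \<omega> in M. (\<lambda>n. Wmax X p n \<omega> / scl n) \<longlonglongrightarrow> 2"
    and p_pos: "\<And>n. p n \<ge> 1"
    and c: "0 < c1" "0 < c2" "\<And>n. n \<ge> 1 \<Longrightarrow> c1 \<le> real n / real (p n) \<and> real n / real (p n) \<le> c2"
  shows "expectation (\<lambda>\<omega>. (X 1 1 \<omega>)\<^sup>2) = 1"
proof -
  define v where "v = expectation (\<lambda>\<omega>. (X 1 1 \<omega>)\<^sup>2)"
  have v0: "0 \<le> v" by (simp add: v_def)
  show ?thesis
  proof (cases "v = 0")
    \<comment> \<open>No rescaling is possible here, but then all entries vanish almost surely and
      the maxima are 0.\<close>
    case True
    have "AE \<omega> in M. X k i \<omega> = 0" if "1 \<le> k" "1 \<le> i" for k i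
    proof -
      have "expectation (\<lambda>\<omega>. (X k i \<omega>)\<^sup>2) = 0" "integrable M (\<lambda>\<omega>. (X k i \<omega>)\<^sup>2)"
        using moment_X[OF that, of "\<lambda>x. x\<^sup>2"] True int2 by (auto simp: v_def)
      then have "AE \<omega> in M. (X k i \<omega>)\<^sup>2 = 0" by (subst (asm) integral_nonneg_eq_0_iff_AE) auto
      then show ?thesis by simp
    qed
    then have "AE \<omega> in M. \<forall>k\<in>{1..}. \<forall>i\<in>{1..}. X k i \<omega> = 0"
      by (intro AE_ball_countable') auto
    with lim have "AE \<omega> in M. False"
    proof eventually_elim
      case (elim \<omega>)
      have "Wmax X p n \<omega> = 0" for n
      proof -
        have "Wmax X p n \<omega> \<le> 0" using elim(2) by (intro Wmax_le) (auto simp: Z_def)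
        moreover have "0 \<le> Wmax X p n \<omega>" unfolding Wmax_def Wmax_set by (intro Max_ge) auto
        ultimately show ?thesis by simp
      qed
      then have "(\<lambda>n. 0) \<longlonglongrightarrow> (2 :: real)" using elim(1) by simp
      then show False by (simp add: LIMSEQ_const_iff)
    qed
    then show ?thesis by simp
  next
    case False
    then have v: "0 < v" using v0 by simp
    define s where "s = sqrt v"
    have s: "0 < s" "s\<^sup>2 = v" using v by (auto simp: s_def)
    have [measurable]: "X 1 1 \<in> borel_measurable M" by simp
    interpret Y: iid_array M "\<lambda>k i \<omega>. X k i \<omega> / s" by (rule iid_array_scaled)
    have "s * s = v" using s(2) by (simp add: power2_eq_square)
    interpret Y: iid_array_std M "\<lambda>k i \<omega>. X k i \<omega> / s"
    proof
      show "expectation (\<lambda>\<omega>. (X 1 1 \<omega> / s)\<^sup>2) = 1" using s v by (simp add: power_divide) (simp add: v_def)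
      show "integrable M (\<lambda>\<omega>. \<bar>X 1 1 \<omega> / s\<bar>^3)" using int3 s by (simp add: power_divide)
    qed (use int1 int2 mean in \<open>auto simp: power_divide\<close>)
    have YZ: "Y.Z k i j \<omega> = Z k i j \<omega> / v" for k i j \<omega>
      unfolding Y.Z_def Z_def using \<open>s * s = v\<close> by simp
    have "Y.Q n t = Q n (v * t)" for n t
    proof -
      have "t \<le> \<bar>z / v\<bar> \<longleftrightarrow> v * t \<le> \<bar>z\<bar>" for z using v by (simp add: field_simps)
      then show ?thesis unfolding Y.Q_def Q_def YZ by simp
    qed
    then have "summable (\<lambda>n. Y.Q n (scl n))"
      using Q_summable_scale[where q=1 and b=1 and C=1 and \<eta>=v] Q v by simp
    from Y.Wmax_tendsto[OF this p_pos c]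
    have "AE \<omega> in M. (\<lambda>n. Wmax (\<lambda>k i \<omega>. X k i \<omega> / s) p n \<omega> / scl n) \<longlonglongrightarrow> 2" .
    moreover have W: "Wmax (\<lambda>k i \<omega>. X k i \<omega> / s) p n \<omega> = Wmax X p n \<omega> / v" for n \<omega>
    proof -
      have "(\<Sum>k=1..n. X k i \<omega> / s * (X k j \<omega> / s)) = (\<Sum>k=1..n. X k i \<omega> * X k j \<omega>) / v" for i j
        unfolding sum_divide_distrib using \<open>s * s = v\<close> by (intro sum.cong) auto
      then have 1: "insert 0 {\<bar>\<Sum>k=1..n. X k i \<omega> / s * (X k j \<omega> / s)\<bar> | i j. 1 \<le> i \<and> i < j \<and> j \<le> p n}
        = (\<lambda>w. w / v) ` insert 0 {\<bar>\<Sum>k=1..n. X k i \<omega> * X k j \<omega>\<bar> | i j. 1 \<le> i \<and> i < j \<and> j \<le> p n}"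
        using v by (auto simp: image_iff)
      have "mono (\<lambda>w. w / v)" using v by (intro monoI divide_right_mono) auto
      moreover have "finite {\<bar>\<Sum>k=1..n. X k i \<omega> * X k j \<omega>\<bar> | i j. 1 \<le> i \<and> i < j \<and> j \<le> p n}"
        unfolding Wmax_set by simp
      ultimately show ?thesis unfolding Wmax_def 1
        by (subst mono_Max_commute[symmetric]) simp_all
    qed
    ultimately have "AE \<omega> in M. (\<lambda>n. Wmax X p n \<omega> / v / scl n) \<longlonglongrightarrow> 2" by simp
    with lim have "AE \<omega> in M. v = 1"
    proof eventually_elim
      case (elim \<omega>)
      have "(\<lambda>n. Wmax X p n \<omega> / scl n / v) \<longlonglongrightarrow> 2 / v"
        using elim(1) v by (intro tendsto_divide tendsto_const) auto
      then have "(\<lambda>n. Wmax X p n \<omega> / v / scl n) \<longlonglongrightarrow> 2 / v" by (simp add: mult.commute)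
      then have "2 / v = 2" using elim(2) by (rule LIMSEQ_unique)
      then show "v = 1" using v by (simp add: field_simps)
    qed
    then show ?thesis by (simp add: v_def)
  qed
qed

end

theorem theorem2p3:
  fixes M :: "'a measure" and X :: "nat \<Rightarrow> nat \<Rightarrow> 'a \<Rightarrow> real" and p :: "nat \<Rightarrow> nat"
  assumes "prob_space M"
    and indep: "prob_space.indep_vars M (\<lambda>_. borel) (\<lambda>(k, i). X k i) ({1..} \<times> {1..})"
    and ident: "\<And>k i. k \<ge> 1 \<Longrightarrow> i \<ge> 1 \<Longrightarrow> distr M borel (X k i) = distr M borel (X 1 1)"
    and p_pos: "\<And>n. p n \<ge> 1"
    and p_ratio: "\<exists>c1 c2. 0 < c1 \<and> c1 \<le> c2 \<and> (\<forall>n\<ge>1. c1 \<le> real n / real (p n) \<and> real n / real (p n) \<le> c2)"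
  shows "(AE \<omega> in M. (\<lambda>n. Wmax X p n \<omega> / sqrt (real n * ln (real n))) \<longlonglongrightarrow> 2)
     \<longleftrightarrow> (integrable M (X 1 1) \<and> integrable M (\<lambda>\<omega>. (X 1 1 \<omega>)\<^sup>2)
          \<and> prob_space.expectation M (X 1 1) = 0
          \<and> prob_space.expectation M (\<lambda>\<omega>. (X 1 1 \<omega>)\<^sup>2) = 1
          \<and> summable (\<lambda>n. measure M {\<omega> \<in> space M. Mmax X n \<omega> \<ge> sqrt (real n * ln (real n))}))"
proof -
  interpret prob_space M by fact
  interpret iid_array M X by unfold_locales (fact indep, rule ident)
  obtain c1 c2 where c: "0 < c1" "0 < c2" "\<And>n. n \<ge> 1 \<Longrightarrow> c1 \<le> real n / real (p n) \<and> real n / real (p n) \<le> c2"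
  proof -
    from p_ratio obtain c1 c2 where "0 < c1" "c1 \<le> c2"
      "\<forall>n\<ge>1. c1 \<le> real n / real (p n) \<and> real n / real (p n) \<le> c2" by blast
    then show ?thesis using that[of c1 c2] by simp
  qed
  show ?thesis
    unfolding summable_Mmax_iff unfolding scl_def[symmetric]
  proof (intro iffI conjI; (elim conjE)?)
    assume lim: "AE \<omega> in M. (\<lambda>n. Wmax X p n \<omega> / scl n) \<longlonglongrightarrow> 2"
    show Q: "summable (\<lambda>n. Q n (scl n))"
      using lim p_pos c by (intro summable_Q_of_Wmax[where p=p and ?c2.0=c2]) auto
    note int3 = third_moment[OF Q]
    show int1: "integrable M (X 1 1)" and int2: "integrable M (\<lambda>\<omega>. (X 1 1 \<omega>)\<^sup>2)"
      by (rule integrable_of_third_moment[OF int3])+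
    show mean: "expectation (X 1 1) = 0"
    proof (rule mean_zero[OF int1 int2])
      show "AE \<omega> in M. eventually (\<lambda>n. \<bar>\<Sum>k=1..n. Z k 1 2 \<omega>\<bar> \<le> 3 * scl n) sequentially"
        using lim
      proof eventually_elim
        case (elim \<omega>)
        \<comment> \<open>For \<open>n > 2 * c2\<close> there are more than two columns, so the pair
          of columns 1 and 2 takes part in the maximum.\<close>
        obtain n1 :: nat where n1: "2 * c2 < real n1" using reals_Archimedean2 by blast
        have "eventually (\<lambda>n. Wmax X p n \<omega> / scl n < 3) sequentially" using elim by (rule order_tendstoD) simp
        then show ?case using eventually_ge_at_top[of "max 2 n1"]
        proof eventually_elim
          case (elim n)
          have "real n1 \<le> real n" using elim(2) by simp
          then have "2 * c2 < c2 * real (p n)" using c(3)[of n] n1 elim(2) p_pos[of n] by (simp add: field_simps)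
          then have "2 < real (p n)" using c(2) by (simp add: mult.commute)
          then have "\<bar>\<Sum>k=1..n. Z k 1 2 \<omega>\<bar> \<le> Wmax X p n \<omega>" by (intro Wmax_ge) auto
          also have "\<dots> \<le> 3 * scl n" using elim scl_pos[of n] by (simp add: field_simps)
          finally show ?case .
        qed
      qed
    qed
    show "expectation (\<lambda>\<omega>. (X 1 1 \<omega>)\<^sup>2) = 1"
      by (rule variance_one[OF int1 mean int2 int3 Q lim p_pos c])
  next
    assume *: "integrable M (X 1 1)" "integrable M (\<lambda>\<omega>. (X 1 1 \<omega>)\<^sup>2)" "expectation (X 1 1) = 0"
      "expectation (\<lambda>\<omega>. (X 1 1 \<omega>)\<^sup>2) = 1" "summable (\<lambda>n. Q n (scl n))"
    interpret iid_array_std M X by unfold_locales (use * third_moment[OF *(5)] in auto)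
    show "AE \<omega> in M. (\<lambda>n. Wmax X p n \<omega> / scl n) \<longlonglongrightarrow> 2"
      by (rule Wmax_tendsto[OF *(5) p_pos c])
  qed
qed

end
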